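(* Let $G$ be an $m$-uniform hypergraph. If $j(I(G))\neq0$ and $H$ is a subhypergraph of $G$, then $$j(I(H))\leq j(I(G)).$$
   Context: A hypergraph $G$ has a finite non-empty node set $V(G)$ and an edge set $E(G)$ consisting of subsets of $V(G)$; it is $m$-uniform ($m\ge1$) if every edge has exactly $m$ elements. $H$ is a subhypergraph of $G$ if $H$ is a hypergraph with $V(H)\subseteq V(G)$ and $E(H)\subseteq E(G)$. Fix a field $\Bbbk$ and view nodes as indeterminates. The edge ideal of a hypergraph $G$ with $V(G)=\{x_1,\dots,x_n\}$ is $I(G)=(x_{i_1}\cdots x_{i_m}:\{x_{i_1},\dots,x_{i_m}\}\in E(G))\subset \Bbbk[x_1,\dots,x_n]_{(x_1,\dots,x_n)}$; the edge ideal $I(H)$ is taken in the analogous local ring whose variables are only the nodes in $V(H)$. For an ideal $I$ in a Noetherian local ring $(R,\mathfrak m)$ of dimension $n\ge1$, the $j$-multiplicity is $j(I)=(n-1)!\lim_{t\to\infty}\lambda_R(\Gamma_{\mathfrak m}(I^t/I^{t+1}))/t^{n-1}$, where $\lambda_R$ is length and $\Gamma_{\mathfrak m}$ is the zeroth local cohomology. *)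

theory Defs
  imports
    Complex_Main
    "HOL-Library.Extended_Nat"
    "HOL-Library.Poly_Mapping"
    "HOL-Algebra.Algebra"
begin

section \<open>Hypergraphs\<close>

record 'v hypergraph =
  nodes :: "'v set"
  edges :: "'v set set"

definition is_hypergraph :: "'v hypergraph \<Rightarrow> bool"
  where "is_hypergraph G \<longleftrightarrow>
    finite (nodes G) \<and> nodes G \<noteq> {} \<and> (\<forall>e \<in> edges G. e \<subseteq> nodes G)"

definition uniform :: "nat \<Rightarrow> 'v hypergraph \<Rightarrow> bool"
  where "uniform m G \<longleftrightarrow> (\<forall>e \<in> edges G. card e = m)"

definition subhypergraph :: "'v hypergraph \<Rightarrow> 'v hypergraph \<Rightarrow> bool"
  where "subhypergraph H G \<longleftrightarrow>
    is_hypergraph H \<and> nodes H \<subseteq> nodes G \<and> edges H \<subseteq> edges G"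


section \<open>Localization of a commutative ring\<close>

definition loc_rel :: "('a, 'b) ring_scheme \<Rightarrow> 'a set \<Rightarrow> (('a \<times> 'a) \<times> ('a \<times> 'a)) set"
  where "loc_rel R S = {((a, s), (b, t)).
    a \<in> carrier R \<and> b \<in> carrier R \<and> s \<in> S \<and> t \<in> S \<and>
    (\<exists>u \<in> S. u \<otimes>\<^bsub>R\<^esub> (a \<otimes>\<^bsub>R\<^esub> t) = u \<otimes>\<^bsub>R\<^esub> (b \<otimes>\<^bsub>R\<^esub> s))}"

definition loc_frac :: "('a, 'b) ring_scheme \<Rightarrow> 'a set \<Rightarrow> 'a \<Rightarrow> 'a \<Rightarrow> ('a \<times> 'a) set"
  where "loc_frac R S a s = loc_rel R S `` {(a, s)}"

text \<open>Sum and product are the usual ones on representatives; each union below is a union of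
  equal classes, as in \<^theory>\<open>HOL.Equiv_Relations\<close>.\<close>

definition localization :: "('a, 'b) ring_scheme \<Rightarrow> 'a set \<Rightarrow> ('a \<times> 'a) set ring"
  where "localization R S = \<lparr>
    carrier = (carrier R \<times> S) // loc_rel R S,
    monoid.mult = (\<lambda>A B. \<Union>(a, s) \<in> A. \<Union>(b, t) \<in> B. loc_frac R S (a \<otimes>\<^bsub>R\<^esub> b) (s \<otimes>\<^bsub>R\<^esub> t)),
    one = loc_frac R S \<one>\<^bsub>R\<^esub> \<one>\<^bsub>R\<^esub>,
    ring.zero = loc_frac R S \<zero>\<^bsub>R\<^esub> \<one>\<^bsub>R\<^esub>,
    add = (\<lambda>A B. \<Union>(a, s) \<in> A. \<Union>(b, t) \<in> B.
      loc_frac R S ((a \<otimes>\<^bsub>R\<^esub> t) \<oplus>\<^bsub>R\<^esub> (b \<otimes>\<^bsub>R\<^esub> s)) (s \<otimes>\<^bsub>R\<^esub> t))\<rparr>"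

definition localization_at :: "('a, 'b) ring_scheme \<Rightarrow> 'a set \<Rightarrow> ('a \<times> 'a) set ring"
  where "localization_at R P = localization R (carrier R - P)"


section \<open>Dimension, length and zeroth local cohomology\<close>

text \<open>The supremum of the \<open>k\<close> for which there is a strict chain
  \<open>C 0 \<subset> C 1 \<subset> \<dots> \<subset> C k\<close> of members of the family.\<close>

definition chain_height :: "'a set set \<Rightarrow> enat"
  where "chain_height F =
    (SUP k \<in> {k. \<exists>C. (\<forall>i \<le> k. C i \<in> F) \<and> (\<forall>i < k. C i \<subset> C (Suc i))}. enat k)"

definition krull_dim :: "('a, 'b) ring_scheme \<Rightarrow> enat"
  where "krull_dim R = chain_height {P. primeideal P R}"

definition module_length :: "('a, 'b) ring_scheme \<Rightarrow> ('a, 'c, 'd) module_scheme \<Rightarrow> enat"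
  where "module_length R M = chain_height {N. submodule N R M}"

definition ideal_power :: "('a, 'b) ring_scheme \<Rightarrow> 'a set \<Rightarrow> nat \<Rightarrow> 'a set"
  where "ideal_power R I t = I [^]\<^bsub>ideals_set R\<^esub> t"

definition ideal_module :: "('a, 'b) ring_scheme \<Rightarrow> 'a set \<Rightarrow> ('a, 'a) module"
  where "ideal_module R I = \<lparr>
    carrier = I, monoid.mult = (\<otimes>\<^bsub>R\<^esub>), one = \<one>\<^bsub>R\<^esub>,
    ring.zero = \<zero>\<^bsub>R\<^esub>, add = (\<oplus>\<^bsub>R\<^esub>), smult = (\<otimes>\<^bsub>R\<^esub>)\<rparr>"

text \<open>The record type of modules extends that of rings; its fields \<open>mult\<close> and \<open>one\<close> play no
  role for a module.\<close>

definition quot_module :: "('a, 'c, 'd) module_scheme \<Rightarrow> 'c set \<Rightarrow> ('a, 'c set) module"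
  where "quot_module M N = \<lparr>
    carrier = a_rcosets\<^bsub>M\<^esub> N, monoid.mult = undefined, one = undefined,
    ring.zero = N, add = set_add M,
    smult = (\<lambda>a A. \<Union>x \<in> A. N +>\<^bsub>M\<^esub> (a \<odot>\<^bsub>M\<^esub> x))\<rparr>"

definition local_cohomology_0 ::
  "('a, 'b) ring_scheme \<Rightarrow> 'a set \<Rightarrow> ('a, 'c) module \<Rightarrow> ('a, 'c) module"
  where "local_cohomology_0 R J M = M\<lparr>carrier :=
    {x \<in> carrier M. \<exists>k. \<forall>a \<in> ideal_power R J k. a \<odot>\<^bsub>M\<^esub> x = \<zero>\<^bsub>M\<^esub>}\<rparr>"


section \<open>The j-multiplicity\<close>

text \<open>Meant for Noetherian local rings \<open>R\<close> of dimension at least 1. The dimension and the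
  lengths are then finite, and the maximal ideal is unique.\<close>

definition max_ideal :: "('a, 'b) ring_scheme \<Rightarrow> 'a set"
  where "max_ideal R = (THE M. maximalideal M R)"

definition j_multiplicity :: "('a, 'b) ring_scheme \<Rightarrow> 'a set \<Rightarrow> real"
  where "j_multiplicity R I =
    (let n = the_enat (krull_dim R) in
      fact (n - 1) *
      lim (\<lambda>t. real (the_enat (module_length R
            (local_cohomology_0 R (max_ideal R)
              (quot_module (ideal_module R (ideal_power R I t)) (ideal_power R I (Suc t))))))
          / real t ^ (n - 1)))"


section \<open>Edge ideals\<close>

text \<open>Polynomials in arbitrary indeterminates \<open>'v\<close> with coefficients in \<open>'k\<close> are finitely
  supported maps from exponent vectors to coefficients.\<close>

type_synonym ('v, 'k) mpoly = "('v \<Rightarrow>\<^sub>0 nat) \<Rightarrow>\<^sub>0 'k"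

definition Var :: "'v \<Rightarrow> ('v, 'k::field) mpoly"
  where "Var v = Poly_Mapping.single (Poly_Mapping.single v 1) 1"

definition mpoly_ring :: "'v set \<Rightarrow> ('v, 'k::field) mpoly ring"
  where "mpoly_ring V = \<lparr>
    carrier = {p. \<forall>u \<in> Poly_Mapping.keys p. Poly_Mapping.keys u \<subseteq> V},
    monoid.mult = (*), one = 1, ring.zero = 0, add = (+)\<rparr>"

text \<open>The ideal generated by the indeterminates in \<open>V\<close>, at which \<open>mpoly_ring V\<close> is localized.\<close>

definition var_ideal :: "'v set \<Rightarrow> ('v, 'k::field) mpoly set"
  where "var_ideal V = Idl\<^bsub>mpoly_ring V\<^esub> (Var ` V)"

text \<open>The field is passed as a type: \<open>'k\<close> cannot be inferred from the hypergraph.\<close>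

definition edge_ring ::
  "'k::field itself \<Rightarrow> 'v hypergraph \<Rightarrow> (('v, 'k) mpoly \<times> ('v, 'k) mpoly) set ring"
  where "edge_ring _ G = localization_at (mpoly_ring (nodes G)) (var_ideal (nodes G))"

definition edge_ideal ::
  "'k::field itself \<Rightarrow> 'v hypergraph \<Rightarrow> (('v, 'k) mpoly \<times> ('v, 'k) mpoly) set set"
  where "edge_ideal K G = Idl\<^bsub>edge_ring K G\<^esub>
    ((\<lambda>e. loc_frac (mpoly_ring (nodes G)) (carrier (mpoly_ring (nodes G)) - var_ideal (nodes G))
        (\<Prod>v \<in> e. Var v) 1) ` edges G)"

end

(*
  Since the edges all have m elements, the length of the zeroth local cohomology of I^t/I^(t+1)
  is the number f(t) of monomials u in I^t - I^(t+1) such that u times every monomial of some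
  large degree lies in I^(t+1). By Dickson's lemma f is eventually polynomial. Every monomial
  is counted in f(t) for at most one t, and its degree differs from mt by a bounded amount, so the
  partial sums F of f are O(t^n), where n is the number of nodes, and j(I) is the eventual value of
  the n-th difference of F.

  If j(I(G)) is nonzero, then the edges of G span the rational vector space on the nodes. Hence the
  nodes of H can be completed to a basis by r = n - n' edges of G, n' being the number of nodes
  of H. The monomials u + a_1 e_1 + ... + a_r e_r, with u counted for H, are pairwise
  distinct, and a fixed translation makes all of them count for G, at a level exceeding that
  of u plus a_1 + ... + a_r by at most a constant. Their number is the r-fold partial sum of F_H, whose
  n-th difference is eventually j(I(H)).
*)
theory Submission
  imports Defs
begin

section \<open>Finite differences and growth\<close>

text \<open>Spanning and translation rest on one kind of relation, v^D e^a = e^b with D > 0, where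
  e^a is a product of |a| edges. If some node v has no such relation, the translates by 1, v, ...,
  v^t of the counted monomials with a fixed cofactor w are pairwise distinct; only finitely many w
  occur, so F is O(t^(n-1)) and j(I) = 0. If v has one, comparing degrees in the uniform hypergraph
  gives |b| > |a|: in the presence of many factors e^a, a high power of v raises the order. A
  monomial multiplied by enough of all these e^a is therefore torsion modulo the next power of the
  ideal. F replaces f in the comparison because translation controls the order of a monomial only up
  to a constant. The definition of j uses \<open>lim\<close>, \<open>THE\<close> and
  \<open>the_enat\<close>, so convergence, uniqueness of the maximal ideal and finiteness of lengths
  and dimension have to be proved too; the Krull dimension is shown to be the number of
  nodes.\<close>

definition fdiff :: "(nat \<Rightarrow> real) \<Rightarrow> nat \<Rightarrow> real"
  where "fdiff h t = h (Suc t) - h t"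

text \<open>Being eventually a polynomial in \<open>t\<close>, encoded without naming the
  polynomial. In this form, closure under sums, shifts and partial sums is immediate.\<close>

definition poly_like :: "(nat \<Rightarrow> real) \<Rightarrow> bool"
  where "poly_like h \<longleftrightarrow> (\<exists>d. eventually (\<lambda>t. (fdiff ^^ d) h t = 0) sequentially)"

lemma fdiff_funpow_Suc: "(fdiff ^^ Suc d) h = (fdiff ^^ d) (fdiff h)"
  by (simp add: funpow_swap1)

lemma fdiff_funpow_add: "(fdiff ^^ d) (\<lambda>t. f t + g t) = (\<lambda>t. (fdiff ^^ d) f t + (fdiff ^^ d) g t)"
  by (induction d) (auto simp: fdiff_def fun_eq_iff)

lemma fdiff_funpow_minus: "(fdiff ^^ d) (\<lambda>t. - f t) = (\<lambda>t. - (fdiff ^^ d) f t)"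
  by (induction d) (auto simp: fdiff_def fun_eq_iff)

lemma fdiff_funpow_shift: "(fdiff ^^ d) (\<lambda>t. h (t + k)) = (\<lambda>t. (fdiff ^^ d) h (t + k))"
  by (induction d) (auto simp: fdiff_def fun_eq_iff)

lemma fdiff_funpow_cong:
  assumes "eventually (\<lambda>t. f t = g t) sequentially"
  shows "eventually (\<lambda>t. (fdiff ^^ d) f t = (fdiff ^^ d) g t) sequentially"
proof (induction d)
  case 0
  then show ?case using assms by simp
next
  case (Suc d)
  then have "eventually (\<lambda>t. (fdiff ^^ d) f (Suc t) = (fdiff ^^ d) g (Suc t)) sequentially"
    by (subst eventually_sequentially_Suc)
  with Suc show ?case
    by eventually_elim (simp add: fdiff_def[of "(fdiff ^^ d) f"] fdiff_def[of "(fdiff ^^ d) g"])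
qed

lemma fdiff_funpow_zero_mono:
  assumes "eventually (\<lambda>t. (fdiff ^^ d) h t = 0) sequentially" "d \<le> e"
  shows "eventually (\<lambda>t. (fdiff ^^ e) h t = 0) sequentially"
proof -
  have *: "(fdiff ^^ k) (\<lambda>t. 0) = (\<lambda>t. 0)" for k
    by (induction k) (auto simp: fdiff_def fun_eq_iff)
  have "eventually (\<lambda>t. (fdiff ^^ (e - d)) ((fdiff ^^ d) h) t = (fdiff ^^ (e - d)) (\<lambda>t. 0) t) sequentially"
    by (rule fdiff_funpow_cong) (use assms in simp)
  moreover have "(fdiff ^^ (e - d)) ((fdiff ^^ d) h) = (fdiff ^^ e) h"
    using assms(2) by (simp flip: funpow_add[THEN fun_cong, unfolded o_apply])
  ultimately show ?thesis by (simp add: *)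
qed

lemma poly_like_cong:
  assumes "eventually (\<lambda>t. f t = g t) sequentially" "poly_like f"
  shows "poly_like g"
proof -
  from assms(2) obtain d where "eventually (\<lambda>t. (fdiff ^^ d) f t = 0) sequentially"
    by (auto simp: poly_like_def)
  with fdiff_funpow_cong[OF assms(1), of d] have "eventually (\<lambda>t. (fdiff ^^ d) g t = 0) sequentially"
    by eventually_elim simp
  then show ?thesis by (auto simp: poly_like_def)
qed

lemma poly_like_zero [simp]: "poly_like (\<lambda>t. 0)"
  unfolding poly_like_def by (rule exI[of _ 0]) simp

lemma poly_like_add:
  assumes "poly_like f" "poly_like g"
  shows "poly_like (\<lambda>t. f t + g t)"
proof -
  from assms obtain d e where "eventually (\<lambda>t. (fdiff ^^ d) f t = 0) sequentially"
    "eventually (\<lambda>t. (fdiff ^^ e) g t = 0) sequentially" by (auto simp: poly_like_def)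
  then have "eventually (\<lambda>t. (fdiff ^^ max d e) f t = 0) sequentially"
    "eventually (\<lambda>t. (fdiff ^^ max d e) g t = 0) sequentially"
    by (auto intro: fdiff_funpow_zero_mono)
  then have "eventually (\<lambda>t. (fdiff ^^ max d e) (\<lambda>t. f t + g t) t = 0) sequentially"
    unfolding fdiff_funpow_add by eventually_elim simp
  then show ?thesis by (auto simp: poly_like_def)
qed

lemma poly_like_minus: "poly_like f \<Longrightarrow> poly_like (\<lambda>t. - f t)"
  by (auto simp: poly_like_def fdiff_funpow_minus)

lemma poly_like_diff: "poly_like f \<Longrightarrow> poly_like g \<Longrightarrow> poly_like (\<lambda>t. f t - g t)"
  using poly_like_add[of f "\<lambda>t. - g t"] poly_like_minus[of g] by simp

lemma poly_like_sum: "(\<And>i. i \<in> A \<Longrightarrow> poly_like (f i)) \<Longrightarrow> poly_like (\<lambda>t. \<Sum>i\<in>A. f i t)"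
  by (induction A rule: infinite_finite_induct) (auto intro: poly_like_add)

lemma poly_like_shift: "poly_like (\<lambda>t. h (t + k)) \<longleftrightarrow> poly_like h"
  unfolding poly_like_def fdiff_funpow_shift
  by (subst eventually_sequentially_seg) simp

lemma fdiff_partial_sum: "fdiff (\<lambda>t. \<Sum>s\<le>t. h s) = (\<lambda>t. h (t + 1))"
  by (simp add: fdiff_def fun_eq_iff)

text \<open>Differencing undoes summation up to a shift by one, which \<open>eventually\<close>
  absorbs. This links f with F, and later lets each adjoined generator raise the order of the
  difference by one while keeping its eventual value.\<close>

lemma fdiff_funpow_partial_sum:
  "eventually (\<lambda>t. (fdiff ^^ Suc d) (\<lambda>t. \<Sum>s\<le>t. h s) t = c) sequentially \<longleftrightarrow>
   eventually (\<lambda>t. (fdiff ^^ d) h t = c) sequentially"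
  unfolding fdiff_funpow_Suc fdiff_partial_sum fdiff_funpow_shift
  by (rule eventually_sequentially_seg)

lemma poly_like_partial_sum: "poly_like h \<Longrightarrow> poly_like (\<lambda>t. \<Sum>s\<le>t. h s)"
  unfolding poly_like_def using fdiff_funpow_partial_sum by blast

text \<open>At \<open>Suc t\<close> the quotient is the difference quotient of
  \<open>x ^ Suc d\<close> at 1 with increment \<open>1 / Suc t\<close>, so it tends to the
  derivative there.\<close>

lemma tendsto_fdiff_power: "(\<lambda>t. fdiff (\<lambda>t. real t ^ Suc d) t / real t ^ d) \<longlonglongrightarrow> real (Suc d)"
proof -
  have "((\<lambda>x::real. x ^ Suc d) has_field_derivative real (Suc d)) (at 1)"
    by (auto intro!: derivative_eq_intros)
  then have *: "((\<lambda>h. ((1 + h) ^ Suc d - 1) / h) \<longlongrightarrow> real (Suc d)) (at (0::real))"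
    by (simp add: DERIV_def)
  have "filterlim (\<lambda>t. inverse (real (Suc t))) (at 0) sequentially"
    unfolding filterlim_at using LIMSEQ_inverse_real_of_nat by auto
  from filterlim_compose[OF * this]
  have "(\<lambda>t. ((1 + inverse (real (Suc t))) ^ Suc d - 1) / inverse (real (Suc t))) \<longlonglongrightarrow> real (Suc d)" .
  moreover have "((1 + inverse (real (Suc t))) ^ Suc d - 1) / inverse (real (Suc t)) =
      fdiff (\<lambda>t. real t ^ Suc d) (Suc t) / real (Suc t) ^ d" for t
  proof -
    have "1 + inverse (real (Suc t)) = real (Suc (Suc t)) / real (Suc t)" by (simp add: field_simps)
    then have "(1 + inverse (real (Suc t))) ^ Suc d = real (Suc (Suc t)) ^ Suc d / real (Suc t) ^ Suc d"
      by (simp only: power_divide)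
    then show ?thesis unfolding fdiff_def by (simp add: field_simps del: of_nat_Suc)
  qed
  ultimately have "(\<lambda>t. fdiff (\<lambda>t. real t ^ Suc d) (Suc t) / real (Suc t) ^ d) \<longlonglongrightarrow> real (Suc d)"
    by simp
  then show ?thesis by (rule LIMSEQ_imp_Suc)
qed

text \<open>The limit-zero case of a Stolz-Cesaro theorem: small increments are summed from
  \<open>T\<close> on, and the growing denominator swallows the starting value
  \<open>g T\<close>.\<close>

lemma tendsto_fdiff_zero:
  assumes "(\<lambda>t. fdiff g t / real t ^ d) \<longlonglongrightarrow> 0"
  shows "(\<lambda>t. g t / real t ^ Suc d) \<longlonglongrightarrow> 0"
proof (rule LIMSEQ_I)
  fix r :: real assume r: "r > 0"
  from LIMSEQ_D[OF assms, of "r / 2"] r obtain T0 where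
    T0: "\<And>t. t \<ge> T0 \<Longrightarrow> norm (fdiff g t / real t ^ d - 0) < r / 2" by auto
  \<comment> \<open>The successor keeps \<open>t\<close> positive, so that the division by
    \<open>real t ^ d\<close> can be undone.\<close>
  define T where "T = Suc T0"
  have step: "\<bar>fdiff g t\<bar> \<le> r / 2 * real t ^ d" if "t \<ge> T" for t
    using T0[of t] that by (simp add: T_def field_simps)
  have bound: "\<bar>g (T + k)\<bar> \<le> \<bar>g T\<bar> + r / 2 * real k * real (T + k) ^ d" for k
  proof (induction k)
    case (Suc k)
    have mono: "real (T + k) ^ d \<le> real (T + Suc k) ^ d" by (rule power_mono) auto
    have "\<bar>g (T + Suc k)\<bar> \<le> \<bar>g (T + k)\<bar> + \<bar>fdiff g (T + k)\<bar>" by (simp add: fdiff_def)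
    also have "\<dots> \<le> \<bar>g T\<bar> + r / 2 * real k * real (T + k) ^ d + r / 2 * real (T + k) ^ d"
      using Suc step[of "T + k"] by simp
    also have "\<dots> = \<bar>g T\<bar> + r / 2 * real (Suc k) * real (T + k) ^ d" by (simp add: algebra_simps)
    also have "\<dots> \<le> \<bar>g T\<bar> + r / 2 * real (Suc k) * real (T + Suc k) ^ d"
      using mono r by (intro add_left_mono mult_left_mono) auto
    finally show ?case .
  qed simp
  \<comment> \<open>Half of \<open>r\<close> pays for the increments, the other half for
    \<open>g T\<close> as soon as \<open>t\<close> exceeds \<open>N\<close>.\<close>
  obtain N where N: "\<bar>g T\<bar> / (r / 2) < real N" using reals_Archimedean2 by blast
  have "norm (g t / real t ^ Suc d - 0) < r" if t: "t \<ge> max T (Suc N)" for t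
  proof -
    have t1: "t \<ge> T" "real t > real N" "real t \<ge> 1" using t by auto
    have "\<bar>g t\<bar> \<le> \<bar>g T\<bar> + r / 2 * real (t - T) * real t ^ d" using bound[of "t - T"] t1 by simp
    also have "\<dots> \<le> \<bar>g T\<bar> + r / 2 * real t * real t ^ d"
      using r by (intro add_left_mono mult_right_mono mult_left_mono) auto
    also have "\<dots> < r / 2 * real t * real t ^ d + r / 2 * real t * real t ^ d"
    proof -
      have "\<bar>g T\<bar> < r / 2 * real t" 
      proof -
        have "\<bar>g T\<bar> < r / 2 * real N" using N r by (simp add: pos_divide_less_eq mult.commute)
        also have "\<dots> \<le> r / 2 * real t" using t1 r by (intro mult_left_mono) auto
        finally show ?thesis .
      qed
      also have "\<dots> \<le> r / 2 * real t * real t ^ d"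
        using mult_left_mono[of 1 "real t ^ d" "r / 2 * real t"] t1 r by simp
      finally show ?thesis by simp
    qed
    also have "\<dots> = r * real t ^ Suc d" by simp
    finally show ?thesis using t1 by (simp add: field_simps)
  qed
  then show "\<exists>no. \<forall>n\<ge>no. norm (g n / real n ^ Suc d - 0) < r" by blast
qed

text \<open>Subtracting the multiple of \<open>t ^ Suc d\<close> whose differences have the same
  asymptotics reduces this to limit zero.\<close>

lemma tendsto_of_fdiff:
  assumes "(\<lambda>t. fdiff h t / real t ^ d) \<longlonglongrightarrow> l"
  shows "(\<lambda>t. h t / real t ^ Suc d) \<longlonglongrightarrow> l / real (Suc d)"
proof -
  define a where "a = l / real (Suc d)"
  define g where "g = (\<lambda>t. h t - a * real t ^ Suc d)"
  have "(\<lambda>t. fdiff h t / real t ^ d - a * (fdiff (\<lambda>t. real t ^ Suc d) t / real t ^ d)) \<longlonglongrightarrow>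
      l - a * real (Suc d)"
    by (intro tendsto_diff tendsto_mult tendsto_const assms tendsto_fdiff_power)
  moreover have "fdiff h t / real t ^ d - a * (fdiff (\<lambda>t. real t ^ Suc d) t / real t ^ d) =
      fdiff g t / real t ^ d" for t
    by (simp add: g_def fdiff_def diff_divide_distrib right_diff_distrib)
  ultimately have "(\<lambda>t. fdiff g t / real t ^ d) \<longlonglongrightarrow> 0"
    by (simp add: a_def del: of_nat_Suc power_Suc)
  from tendsto_fdiff_zero[OF this] have "(\<lambda>t. g t / real t ^ Suc d + a) \<longlonglongrightarrow> 0 + a"
    by (intro tendsto_add tendsto_const)
  moreover have "eventually (\<lambda>t. g t / real t ^ Suc d + a = h t / real t ^ Suc d) sequentially"
    using eventually_gt_at_top[of 0] by eventually_elim (simp add: g_def field_simps)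
  ultimately show ?thesis unfolding a_def by (simp add: tendsto_cong)
qed

lemma tendsto_of_fdiff_funpow:
  assumes "eventually (\<lambda>t. (fdiff ^^ d) h t = c) sequentially"
  shows "(\<lambda>t. h t / real t ^ d) \<longlonglongrightarrow> c / fact d"
  using assms
proof (induction d arbitrary: h)
  case 0
  then show ?case by (simp add: tendsto_eventually)
next
  case (Suc d)
  then have "(\<lambda>t. fdiff h t / real t ^ d) \<longlonglongrightarrow> c / fact d"
    by (simp add: funpow_swap1)
  from tendsto_of_fdiff[OF this] show ?case by (simp add: mult.commute)
qed

lemma tendsto_zero_of_bound:
  assumes "\<And>t. \<bar>h t\<bar> \<le> C * real (Suc t) ^ n" "n < d"
  shows "(\<lambda>t. h t / real t ^ d) \<longlonglongrightarrow> 0"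
proof (rule tendsto_0_le[OF lim_inverse_n])
  have C: "C \<ge> 0" using assms(1)[of 0] by simp
  show "eventually (\<lambda>t. norm (h t / real t ^ d) \<le> norm (inverse (real t)) * (C * 2 ^ n)) sequentially"
    using eventually_gt_at_top[of 0]
  proof eventually_elim
    case (elim t)
    then have t: "real t \<ge> 1" by simp
    have "real (Suc t) ^ n \<le> (2 * real t) ^ n" using t by (intro power_mono) auto
    also have "\<dots> = 2 ^ n * real t ^ n" by (simp add: power_mult_distrib)
    finally have "\<bar>h t\<bar> \<le> C * (2 ^ n * real t ^ n)"
      using assms(1)[of t] mult_left_mono[OF _ C] by (meson order_trans)
    then have "\<bar>h t\<bar> * real t \<le> C * 2 ^ n * real t ^ Suc n" using t by (simp add: mult_right_mono)
    also have "\<dots> \<le> C * 2 ^ n * real t ^ d"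
      using t assms(2) C by (intro mult_left_mono power_increasing) auto
    finally show ?case using t by (simp add: field_simps)
  qed
qed

text \<open>Take the least \<open>d\<close> for which the \<open>d\<close>-th difference eventually
  vanishes. If \<open>d = Suc e\<close>, the \<open>e\<close>-th difference is eventually constant,
  and h grows like this constant over \<open>fact e\<close> times \<open>t ^ e\<close>. For
  \<open>e > n\<close> the bound forces the constant to be 0, against minimality; so
  \<open>d\<close> is at most \<open>Suc n\<close>.\<close>

lemma poly_like_bounded:
  assumes "poly_like h" "\<And>t. \<bar>h t\<bar> \<le> C * real (Suc t) ^ n"
  shows "\<exists>c. eventually (\<lambda>t. (fdiff ^^ n) h t = c) sequentially"
proof -
  define d where "d = (LEAST d. eventually (\<lambda>t. (fdiff ^^ d) h t = 0) sequentially)"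
  have d: "eventually (\<lambda>t. (fdiff ^^ d) h t = 0) sequentially"
    unfolding d_def using assms(1)[unfolded poly_like_def] by (rule LeastI_ex)
  show ?thesis
  proof (cases "d \<le> n")
    case True
    then show ?thesis using fdiff_funpow_zero_mono[OF d] by blast
  next
    case False
    then obtain e where e: "d = Suc e" "n \<le> e" by (cases d) auto
    from d obtain T where T: "\<And>t. t \<ge> T \<Longrightarrow> (fdiff ^^ e) h (Suc t) = (fdiff ^^ e) h t"
      unfolding e eventually_sequentially by (auto simp: fdiff_def)
    have "(fdiff ^^ e) h (T + k) = (fdiff ^^ e) h T" for k
      by (induction k) (use T in auto)
    then have c: "eventually (\<lambda>t. (fdiff ^^ e) h t = (fdiff ^^ e) h T) sequentially"
      unfolding eventually_sequentially by (metis le_Suc_ex)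
    show ?thesis
    proof (cases "e = n")
      case True
      then show ?thesis using c by blast
    next
      case False
      with e have "n < e" by simp
      from tendsto_zero_of_bound[OF assms(2) this] tendsto_of_fdiff_funpow[OF c]
      have "(fdiff ^^ e) h T = 0" using LIMSEQ_unique by fastforce
      with c have "eventually (\<lambda>t. (fdiff ^^ e) h t = 0) sequentially" by simp
      then have "d \<le> e" unfolding d_def by (rule Least_le)
      with e show ?thesis by simp
    qed
  qed
qed

section \<open>Counting exponent vectors\<close>

abbreviation lookup where "lookup \<equiv> Poly_Mapping.lookup"
abbreviation keys where "keys \<equiv> Poly_Mapping.keys"
abbreviation single where "single \<equiv> Poly_Mapping.single"

definition mdeg :: "('x \<Rightarrow>\<^sub>0 nat) \<Rightarrow> nat"
  where "mdeg u = (\<Sum>x\<in>keys u. lookup u x)"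

text \<open>Serves both for monomials in the nodes and, with the index set \<open>{..<q}\<close>,
  for the multiplicities in a product of generators.\<close>

definition expvecs :: "'x set \<Rightarrow> ('x \<Rightarrow>\<^sub>0 nat) set"
  where "expvecs Y = {u. keys u \<subseteq> Y}"

lemma mdeg_eq_sum: "finite Y \<Longrightarrow> keys u \<subseteq> Y \<Longrightarrow> mdeg u = (\<Sum>x\<in>Y. lookup u x)"
  unfolding mdeg_def by (rule sum.mono_neutral_left) (auto simp: in_keys_iff)

lemma mdeg_add: "mdeg (u + v) = mdeg u + mdeg v"
proof -
  let ?Y = "keys u \<union> keys v"
  have "keys (u + v) \<subseteq> ?Y" by (rule keys_add)
  then show ?thesis by (simp add: mdeg_eq_sum[of ?Y] lookup_add sum.distrib)
qed

lemma mdeg_zero [simp]: "mdeg 0 = 0"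
  by (simp add: mdeg_def)

lemma mdeg_single [simp]: "mdeg (single x n) = n"
  by (simp add: mdeg_def)

lemma mdeg_sum: "mdeg (\<Sum>i\<in>A. f i) = (\<Sum>i\<in>A. mdeg (f i))"
  by (induction A rule: infinite_finite_induct) (auto simp: mdeg_add)

lemma mdeg_eq_0_iff [simp]: "mdeg u = 0 \<longleftrightarrow> u = 0"
  by (auto simp: mdeg_def in_keys_iff intro!: poly_mapping_eqI)

lemma mdeg_pos_iff [simp]: "0 < mdeg u \<longleftrightarrow> u \<noteq> 0"
  by (metis mdeg_eq_0_iff neq0_conv)

lemma single_eq_0_iff [simp]: "single x v = 0 \<longleftrightarrow> v = 0"
  by (metis lookup_single_eq lookup_zero single_zero)

lemma lookup_le_mdeg: "lookup u x \<le> mdeg u"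
proof (cases "x \<in> keys u")
  case True
  then show ?thesis unfolding mdeg_def by (intro member_le_sum) auto
qed (simp add: in_keys_iff)

lemma keys_add_nat: "keys (u + v) = keys u \<union> keys (v :: 'x \<Rightarrow>\<^sub>0 nat)"
  by (auto simp: in_keys_iff lookup_add)

lemma expvecs_add_iff [simp]: "u + v \<in> expvecs Y \<longleftrightarrow> u \<in> expvecs Y \<and> v \<in> expvecs Y"
  by (auto simp: expvecs_def keys_add_nat)

lemma zero_in_expvecs [simp]: "0 \<in> expvecs Y"
  by (simp add: expvecs_def)

lemma single_in_expvecs [simp]: "x \<in> Y \<Longrightarrow> single x n \<in> expvecs Y"
  by (simp add: expvecs_def)

lemma sum_in_expvecs: "(\<And>i. i \<in> A \<Longrightarrow> f i \<in> expvecs Y) \<Longrightarrow> (\<Sum>i\<in>A. f i) \<in> expvecs Y"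
  by (induction A rule: infinite_finite_induct) auto

text \<open>Subtraction is truncated pointwise, so this is how divisibility of monomials yields a
  cofactor.\<close>

lemma pointwise_le_imp_add:
  fixes u v :: "'x \<Rightarrow>\<^sub>0 nat"
  assumes "\<And>x. lookup u x \<le> lookup v x"
  shows "u + (v - u) = v"
  by (rule poly_mapping_eqI) (use assms in \<open>simp add: lookup_add lookup_minus\<close>)

lemma expvecs_Suc_decomp:
  assumes "a \<in> expvecs Y" "mdeg a = Suc t"
  obtains i b where "i \<in> Y" "b \<in> expvecs Y" "mdeg b = t" "a = b + single i 1"
proof -
  have "a \<noteq> 0" using assms(2) by auto
  then obtain i where i: "lookup a i \<noteq> 0" by (auto simp: poly_mapping_eq_iff fun_eq_iff)
  let ?b = "a - single i 1"
  have a: "a = ?b + single i 1"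
    using i by (intro poly_mapping_eqI) (auto simp: lookup_add lookup_minus lookup_single when_def)
  have "?b \<in> expvecs Y" using assms(1) by (subst (asm) a) simp
  moreover have "mdeg a = mdeg ?b + 1" by (subst a) (simp add: mdeg_add)
  moreover have "i \<in> Y" using assms(1) i by (auto simp: expvecs_def in_keys_iff)
  ultimately show thesis using a assms(2) that by simp
qed

text \<open>The exponent sets of monomial ideals in the variables \<open>V\<close>.\<close>

definition upset :: "'v set \<Rightarrow> ('v \<Rightarrow>\<^sub>0 nat) set \<Rightarrow> bool"
  where "upset V U \<longleftrightarrow> U \<subseteq> expvecs V \<and> (\<forall>u\<in>U. \<forall>w\<in>expvecs V. u + w \<in> U)"

text \<open>A monomial of degree at least \<open>k\<close> is a multiple of one of degree exactly
  \<open>k\<close>; variables are peeled off one at a time. Torsion may thus be tested in a single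
  degree.\<close>

lemma upset_add_multiple:
  assumes "upset V U" "\<And>w. w \<in> expvecs V \<Longrightarrow> mdeg w = k \<Longrightarrow> u + w \<in> U" "w \<in> expvecs V" "mdeg w \<ge> k"
  shows "u + w \<in> U"
  using assms(3,4)
proof (induction "mdeg w - k" arbitrary: w)
  case 0
  then show ?case using assms(2) by simp
next
  case (Suc d)
  then obtain d' where "mdeg w = Suc d'" by (cases "mdeg w") auto
  with Suc.prems(1) obtain i b where ib: "i \<in> V" "b \<in> expvecs V" "mdeg b = d'" "w = b + single i 1"
    by (auto elim: expvecs_Suc_decomp)
  have "u + b \<in> U" by (rule Suc.hyps(1)) (use Suc ib \<open>mdeg w = Suc d'\<close> in auto)
  then have "u + b + single i 1 \<in> U"
    using single_in_expvecs[OF ib(1)] assms(1) by (simp add: upset_def del: single_in_expvecs)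
  then show ?case by (simp add: ib(4) add.assoc)
qed

lemma finite_expvecs_le:
  assumes "finite Y"
  shows "finite {u \<in> expvecs Y. mdeg u \<le> N}" and "card {u \<in> expvecs Y. mdeg u \<le> N} \<le> Suc N ^ card Y"
proof -
  let ?S = "{u \<in> expvecs Y. mdeg u \<le> N}"
  let ?f = "\<lambda>u. restrict (lookup u) Y"
  have inj: "inj_on ?f ?S"
  proof (rule inj_onI)
    fix u v assume uv: "u \<in> ?S" "v \<in> ?S" and eq: "?f u = ?f v"
    have "lookup u x = lookup v x" for x
    proof (cases "x \<in> Y")
      case True
      then show ?thesis using fun_cong[OF eq, of x] by simp
    next
      case False
      then have "x \<notin> keys u" "x \<notin> keys v" using uv by (auto simp: expvecs_def)
      then show ?thesis by (simp add: in_keys_iff)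
    qed
    then show "u = v" by (rule poly_mapping_eqI)
  qed
  have sub: "?f ` ?S \<subseteq> Y \<rightarrow>\<^sub>E {..N}"
    using lookup_le_mdeg order_trans by fastforce
  have fin: "finite (Y \<rightarrow>\<^sub>E {..N})" using assms by (intro finite_PiE) auto
  show "finite ?S" using inj_on_finite[OF inj sub fin] .
  show "card ?S \<le> Suc N ^ card Y"
    using card_inj_on_le[OF inj sub fin] assms by (simp add: card_PiE)
qed

lemma finite_expvecs_eq: "finite Y \<Longrightarrow> finite {u \<in> expvecs Y. mdeg u = N}"
  by (rule finite_subset[OF _ finite_expvecs_le(1)[of Y N]]) auto

section \<open>Dickson's lemma and Hilbert functions of monomial ideals\<close>

lemma mono_subseq_nat:
  fixes g :: "nat \<Rightarrow> nat"
  shows "\<exists>\<phi> :: nat \<Rightarrow> nat. strict_mono \<phi> \<and> mono (\<lambda>i. g (\<phi> i))"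
proof -
  from seq_monosub[of g] obtain \<phi> :: "nat \<Rightarrow> nat" where \<phi>: "strict_mono \<phi>" "monoseq (\<lambda>i. g (\<phi> i))" by auto
  show ?thesis
  proof (cases "incseq (\<lambda>i. g (\<phi> i))")
    case True
    then show ?thesis using \<phi> by blast
  next
    case False
    with \<phi> have dec: "decseq (\<lambda>i. g (\<phi> i))" by (simp add: monoseq_iff)
    \<comment> \<open>A decreasing sequence of naturals is constant from its minimum on, so a tail
      of it is also increasing.\<close>
    obtain k where k: "\<And>i. g (\<phi> k) \<le> g (\<phi> i)"
      using ex_has_least_nat[of "\<lambda>_. True" 0 "\<lambda>i. g (\<phi> i)"] by auto
    have "g (\<phi> (i + k)) = g (\<phi> k)" for i
      using decseqD[OF dec, of k "i + k"] k[of "i + k"] by simp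
    moreover have "strict_mono (\<lambda>i. \<phi> (i + k))"
      using \<phi>(1) by (simp add: strict_mono_def)
    ultimately show ?thesis by (intro exI[of _ "\<lambda>i. \<phi> (i + k)"]) (auto simp: mono_def)
  qed
qed

text \<open>One coordinate after another, passing each time to a further subsequence, which keeps
  the monotonicity already obtained.\<close>

lemma dickson:
  fixes f :: "nat \<Rightarrow> ('x \<Rightarrow>\<^sub>0 nat)"
  assumes "finite Y"
  shows "\<exists>\<phi> :: nat \<Rightarrow> nat. strict_mono \<phi> \<and> (\<forall>x\<in>Y. mono (\<lambda>i. lookup (f (\<phi> i)) x))"
  using assms
proof induction
  case empty
  then show ?case by (intro exI[of _ id]) (auto simp: strict_mono_def)
next
  case (insert x Y)
  then obtain \<phi> :: "nat \<Rightarrow> nat" where \<phi>: "strict_mono \<phi>" "\<And>y. y \<in> Y \<Longrightarrow> mono (\<lambda>i. lookup (f (\<phi> i)) y)" by auto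
  from mono_subseq_nat[of "\<lambda>i. lookup (f (\<phi> i)) x"] obtain \<psi> :: "nat \<Rightarrow> nat" where
    \<psi>: "strict_mono \<psi>" "mono (\<lambda>i. lookup (f (\<phi> (\<psi> i))) x)" by auto
  have "strict_mono (\<lambda>i. \<phi> (\<psi> i))" using \<phi>(1) \<psi>(1) by (simp add: strict_mono_def)
  moreover have "mono (\<lambda>i. lookup (f (\<phi> (\<psi> i))) y)" if "y \<in> Y" for y
    using \<phi>(2)[OF that] strict_mono_mono[OF \<psi>(1)] by (simp add: mono_def)
  ultimately show ?case using \<psi>(2) by (intro exI[of _ "\<lambda>i. \<phi> (\<psi> i)"]) auto
qed

lemma dickson_expvecs:
  fixes f :: "nat \<Rightarrow> ('x \<Rightarrow>\<^sub>0 nat)"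
  assumes "finite Y" "\<And>i. f i \<in> expvecs Y"
  obtains \<phi> :: "nat \<Rightarrow> nat" where "strict_mono \<phi>" "\<And>i j. i \<le> j \<Longrightarrow> f (\<phi> i) + (f (\<phi> j) - f (\<phi> i)) = f (\<phi> j)"
proof -
  from dickson[OF assms(1), of f] obtain \<phi> :: "nat \<Rightarrow> nat" where
    \<phi>: "strict_mono \<phi>" "\<And>x. x \<in> Y \<Longrightarrow> mono (\<lambda>i. lookup (f (\<phi> i)) x)" by auto
  have "f (\<phi> i) + (f (\<phi> j) - f (\<phi> i)) = f (\<phi> j)" if "i \<le> j" for i j
  proof (rule pointwise_le_imp_add)
    fix x show "lookup (f (\<phi> i)) x \<le> lookup (f (\<phi> j)) x"
    proof (cases "x \<in> Y")
      case True
      then show ?thesis using \<phi>(2) that by (auto simp: mono_def)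
    next
      case False
      then have "x \<notin> keys (f (\<phi> i))" using assms(2) by (auto simp: expvecs_def)
      then show ?thesis by (simp add: in_keys_iff)
    qed
  qed
  with \<phi>(1) show thesis by (rule that)
qed

lemma expvecs_insert_decomp:
  assumes "a \<in> expvecs (insert x Y)"
  obtains b where "b \<in> expvecs Y" "a = b + single x (lookup a x)"
proof
  let ?b = "a - single x (lookup a x)"
  have "y \<in> Y" if "y \<in> keys ?b" for y
    using that assms by (cases "y = x") (auto simp: expvecs_def subset_iff in_keys_iff lookup_minus lookup_single)
  then show "?b \<in> expvecs Y" by (auto simp: expvecs_def)
  show "a = ?b + single x (lookup a x)"
    by (rule poly_mapping_eqI) (auto simp: lookup_add lookup_minus lookup_single when_def)
qed

text \<open>An ascending chain of monomial ideals is stationary: otherwise the elements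
  \<open>a K\<close> that are new after stage \<open>K\<close> form a sequence in which Dickson's
  lemma finds a divisibility that makes one of them old.\<close>

lemma slices_stabilize:
  fixes U :: "nat \<Rightarrow> ('x \<Rightarrow>\<^sub>0 nat) set"
  assumes "finite Y" "\<And>k. U k \<subseteq> expvecs Y"
    and up: "\<And>k a b. a \<in> U k \<Longrightarrow> b \<in> expvecs Y \<Longrightarrow> a + b \<in> U k"
    and inc: "\<And>k l. k \<le> l \<Longrightarrow> U k \<subseteq> U l"
  shows "\<exists>K. \<forall>k\<ge>K. U k = U K"
proof (rule ccontr)
  assume "\<not> ?thesis"
  then have "\<forall>K. \<exists>k a. k \<ge> K \<and> a \<in> U k \<and> a \<notin> U K" using inc by blast
  then obtain k a where ka: "\<And>K. k K \<ge> K" "\<And>K. a K \<in> U (k K)" "\<And>K. a K \<notin> U K" by metis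
  have "a K \<in> expvecs Y" for K using ka(2) assms(2) by blast
  with assms(1) obtain \<phi> :: "nat \<Rightarrow> nat" where \<phi>: "strict_mono \<phi>"
    "\<And>i j. i \<le> j \<Longrightarrow> a (\<phi> i) + (a (\<phi> j) - a (\<phi> i)) = a (\<phi> j)"
    using dickson_expvecs[of Y a] by blast
  \<comment> \<open>Stage \<open>k (\<phi> 0)\<close> already contains \<open>a (\<phi> 0)\<close>,
    hence its multiple \<open>a (\<phi> j)\<close>, which was chosen outside the larger
    \<open>U (\<phi> j)\<close>.\<close>
  define j where "j = k (\<phi> 0)"
  have j: "a (\<phi> j) = a (\<phi> 0) + (a (\<phi> j) - a (\<phi> 0))" using \<phi>(2)[of 0 j] by simp
  then have "a (\<phi> j) - a (\<phi> 0) \<in> expvecs Y" using ka(2) assms(2) by (metis expvecs_add_iff subsetD)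
  with up[OF ka(2)[of "\<phi> 0"]] j have "a (\<phi> j) \<in> U j" by (metis j_def)
  moreover have "j \<le> \<phi> j" using \<phi>(1) by (rule strict_mono_imp_increasing)
  ultimately show False using inc ka(3) by blast
qed

text \<open>Hilbert's theorem for monomial ideals, by induction on the variables. Slicing by the
  exponent \<open>k\<close> of \<open>x\<close> gives up-sets \<open>S k\<close> in fewer variables,
  increasing in \<open>k\<close> and thus constant from some \<open>K\<close> on.\<close>

lemma poly_like_card_upset:
  assumes "finite Y" "U \<subseteq> expvecs Y" "\<And>a b. a \<in> U \<Longrightarrow> b \<in> expvecs Y \<Longrightarrow> a + b \<in> U"
  shows "poly_like (\<lambda>t. real (card {a \<in> U. mdeg a = t}))"
  using assms
proof (induction Y arbitrary: U rule: finite_induct)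
  case empty
  then have "U \<subseteq> {0}" by (auto simp: expvecs_def)
  have "{a \<in> U. mdeg a = t} = {}" if "t \<ge> 1" for t using that \<open>U \<subseteq> {0}\<close> by auto
  then have "eventually (\<lambda>t. 0 = real (card {a \<in> U. mdeg a = t})) sequentially"
    by (intro eventually_sequentiallyI[of 1]) (simp only: card.empty of_nat_0)
  then show ?case by (rule poly_like_cong) simp
next
  case (insert x Y)
  define S where "S k = {a \<in> expvecs Y. a + single x k \<in> U}" for k
  define h where "h k t = real (card {a \<in> S k. mdeg a = t})" for k t
  have up: "a + b \<in> S k" if "a \<in> S k" "b \<in> expvecs Y" for a b k
  proof -
    have "b \<in> expvecs (insert x Y)" using that by (auto simp: expvecs_def)
    then show ?thesis using insert.prems(2)[of "a + single x k" b] that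
      by (simp add: S_def ac_simps)
  qed
  have pl: "poly_like (h k)" for k
    unfolding h_def by (rule insert.IH) (use up in \<open>auto simp: S_def\<close>)
  have inc: "S k \<subseteq> S l" if "k \<le> l" for k l
  proof
    fix a assume a: "a \<in> S k"
    have "single x k + single x (l - k) = single x l" using that by (simp flip: single_add)
    then show "a \<in> S l" using a insert.prems(2)[of "a + single x k" "single x (l - k)"]
      by (simp add: S_def add.assoc)
  qed
  obtain K where K: "\<And>k. k \<ge> K \<Longrightarrow> S k = S K"
    using slices_stabilize[OF insert.hyps(1), of S] up inc by (metis (no_types, lifting) S_def mem_Collect_eq subsetI)
  have x: "lookup a x = 0" if "a \<in> expvecs Y" for a
    using that insert.hyps(2) by (auto simp: expvecs_def in_keys_iff)
  have count: "real (card {a \<in> U. mdeg a = t}) = (\<Sum>k\<le>t. h k (t - k))" for t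
  proof -
    let ?A = "\<lambda>k. {a \<in> S k. mdeg a = t - k}"
    have fin: "finite (?A k)" for k
      by (rule finite_subset[OF _ finite_expvecs_eq[OF insert.hyps(1), of "t - k"]]) (auto simp: S_def)
    have "{a \<in> U. mdeg a = t} = (\<Union>k\<le>t. (\<lambda>a. a + single x k) ` ?A k)"
    proof (intro equalityI subsetI)
      fix a assume a: "a \<in> {a \<in> U. mdeg a = t}"
      then have "a \<in> expvecs (insert x Y)" using insert.prems by auto
      then obtain b where b: "b \<in> expvecs Y" "a = b + single x (lookup a x)"
        by (rule expvecs_insert_decomp)
      have "mdeg a = mdeg b + lookup a x" by (subst b) (simp add: mdeg_add)
      then show "a \<in> (\<Union>k\<le>t. (\<lambda>a. a + single x k) ` ?A k)"
        using a b by (intro UN_I[of "lookup a x"]) (auto simp: S_def)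
    qed (auto simp: S_def mdeg_add)
    moreover have "card \<dots> = (\<Sum>k\<le>t. card ((\<lambda>a. a + single x k) ` ?A k))"
    proof (rule card_UN_disjoint)
      show "\<forall>k\<in>{..t}. \<forall>l\<in>{..t}. k \<noteq> l \<longrightarrow> (\<lambda>a. a + single x k) ` ?A k \<inter> (\<lambda>a. a + single x l) ` ?A l = {}"
      proof (intro ballI impI equals0I)
        fix k l c assume "k \<noteq> l" "c \<in> (\<lambda>a. a + single x k) ` ?A k \<inter> (\<lambda>a. a + single x l) ` ?A l"
        then obtain a b where "c = a + single x k" "c = b + single x l" "a \<in> expvecs Y" "b \<in> expvecs Y"
          unfolding S_def by (elim IntE imageE) blast
        then have "lookup c x = k" "lookup c x = l" by (metis add_0 lookup_add lookup_single_eq x)+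
        with \<open>k \<noteq> l\<close> show False by simp
      qed
    qed (use fin in auto)
    moreover have "card ((\<lambda>a. a + single x k) ` ?A k) = card (?A k)" for k
      by (rule card_image) (simp add: inj_on_def)
    ultimately show ?thesis by (simp add: h_def)
  qed
  \<comment> \<open>Starting at degree \<open>K\<close>, each of the first \<open>K\<close> slices
    contributes a shifted function, and the equal slices together contribute a partial sum.\<close>
  have "real (card {a \<in> U. mdeg a = t + K}) = (\<Sum>k<K. h k (t + (K - k))) + (\<Sum>s\<le>t. h K s)" for t
  proof -
    have split: "{..t + K} = {..<K} \<union> {K..t + K}" by auto
    have "(\<Sum>k\<le>t + K. h k (t + K - k)) = (\<Sum>k<K. h k (t + K - k)) + (\<Sum>k=K..t + K. h k (t + K - k))"
      unfolding split by (rule sum.union_disjoint) auto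
    also have "(\<Sum>k=K..t + K. h k (t + K - k)) = (\<Sum>k=K..t + K. h K (t + K - k))"
    proof (rule sum.cong[OF refl])
      fix k assume "k \<in> {K..t + K}"
      then have "S k = S K" by (intro K) simp
      then show "h k (t + K - k) = h K (t + K - k)" by (simp only: h_def)
    qed
    also have "\<dots> = (\<Sum>s\<le>t. h K s)"
      by (rule sum.reindex_bij_witness[of _ "\<lambda>s. t + K - s" "\<lambda>k. t + K - k"]) auto
    also have "(\<Sum>k<K. h k (t + K - k)) = (\<Sum>k<K. h k (t + (K - k)))" by (rule sum.cong) auto
    finally show ?thesis by (simp add: count)
  qed
  moreover have "poly_like (\<lambda>t. (\<Sum>k<K. h k (t + (K - k))) + (\<Sum>s\<le>t. h K s))"
    by (intro poly_like_add poly_like_sum poly_like_partial_sum pl) (simp only: poly_like_shift pl)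
  ultimately have "poly_like (\<lambda>t. real (card {a \<in> U. mdeg a = t + K}))" by simp
  then show ?case by (simp only: poly_like_shift[of "\<lambda>t. real (card {a \<in> U. mdeg a = t})"])
qed

section \<open>Powers of an ideal generated by monomials of one degree, and their torsion\<close>

locale monomial_gens =
  fixes V :: "'v set" and es :: "nat \<Rightarrow> ('v \<Rightarrow>\<^sub>0 nat)" and q m :: nat
  assumes finite_V: "finite V" and V_nonempty: "V \<noteq> {}" and m_pos: "m \<ge> 1"
    and es_expvecs: "\<And>i. i < q \<Longrightarrow> es i \<in> expvecs V"
    and mdeg_es: "\<And>i. i < q \<Longrightarrow> mdeg (es i) = m"
begin

text \<open>The exponent of the product of the generators with multiplicities \<open>a\<close>; the
  inner constant sum is \<open>lookup a i\<close> times \<open>es i\<close>.\<close>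

definition esum :: "(nat \<Rightarrow>\<^sub>0 nat) \<Rightarrow> ('v \<Rightarrow>\<^sub>0 nat)"
  where "esum a = (\<Sum>i<q. \<Sum>_<lookup a i. es i)"

text \<open>The exponents of the monomials in the \<open>t\<close>-th power of the ideal.\<close>

definition Pw :: "nat \<Rightarrow> ('v \<Rightarrow>\<^sub>0 nat) set"
  where "Pw t = {w + esum a | w a. w \<in> expvecs V \<and> a \<in> expvecs {..<q} \<and> mdeg a = t}"

text \<open>The monomials of the \<open>t\<close>-th power that a power of the maximal ideal carries
  into the next one.\<close>

definition sat :: "nat \<Rightarrow> ('v \<Rightarrow>\<^sub>0 nat) set"
  where "sat t = {u \<in> Pw t. \<exists>k. \<forall>w \<in> expvecs V. mdeg w = k \<longrightarrow> u + w \<in> Pw (Suc t)}"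

definition jset :: "nat \<Rightarrow> ('v \<Rightarrow>\<^sub>0 nat) set"
  where "jset t = sat t - Pw (Suc t)"

lemma lookup_esum: "lookup (esum a) v = (\<Sum>i<q. lookup a i * lookup (es i) v)"
  by (simp add: esum_def lookup_sum)

lemma esum_add: "esum (a + b) = esum a + esum b"
  by (rule poly_mapping_eqI) (simp add: lookup_esum lookup_add algebra_simps sum.distrib)

lemma esum_zero [simp]: "esum 0 = 0"
  by (simp add: esum_def)

lemma esum_sum: "esum (\<Sum>i\<in>A. f i) = (\<Sum>i\<in>A. esum (f i))"
  by (induction A rule: infinite_finite_induct) (auto simp: esum_add)

lemma esum_single: "i < q \<Longrightarrow> esum (single i 1) = es i"
  by (rule poly_mapping_eqI) (auto simp: lookup_esum lookup_single when_def if_distrib[of "\<lambda>x. x * _"] cong: if_cong)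

lemma esum_in_expvecs [simp]: "esum a \<in> expvecs V"
  unfolding esum_def by (intro sum_in_expvecs es_expvecs) auto

lemma mdeg_esum: "a \<in> expvecs {..<q} \<Longrightarrow> mdeg (esum a) = m * mdeg a"
  unfolding esum_def by (simp add: mdeg_sum mdeg_es mdeg_eq_sum[of "{..<q}" a] expvecs_def sum_distrib_left mult.commute)

lemma PwI: "w \<in> expvecs V \<Longrightarrow> a \<in> expvecs {..<q} \<Longrightarrow> w + esum a \<in> Pw (mdeg a)"
  by (auto simp: Pw_def)

lemma PwE:
  assumes "u \<in> Pw t"
  obtains w a where "w \<in> expvecs V" "a \<in> expvecs {..<q}" "mdeg a = t" "u = w + esum a"
  using assms by (auto simp: Pw_def)

lemma Pw_subset: "Pw t \<subseteq> expvecs V"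
  by (auto elim!: PwE)

lemma Pw_add: "u \<in> Pw t \<Longrightarrow> v \<in> expvecs V \<Longrightarrow> u + v \<in> Pw t"
  by (erule PwE) (use PwI[of "_ + v"] in \<open>auto simp: ac_simps\<close>)

lemma upset_Pw: "upset V (Pw t)"
  using Pw_subset Pw_add by (auto simp: upset_def)

lemma Pw_add_esum:
  assumes "u \<in> Pw t" "b \<in> expvecs {..<q}"
  shows "u + esum b \<in> Pw (t + mdeg b)"
proof -
  from assms(1) obtain w a where wa: "w \<in> expvecs V" "a \<in> expvecs {..<q}" "mdeg a = t" "u = w + esum a"
    by (rule PwE)
  then show ?thesis using PwI[of w "a + b"] assms(2) by (simp add: mdeg_add esum_add add.assoc)
qed

lemma Pw_0: "Pw 0 = expvecs V"
  using PwI[of _ 0] Pw_subset by fastforce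

lemma Pw_Suc_subset: "Pw (Suc t) \<subseteq> Pw t"
proof
  fix u assume "u \<in> Pw (Suc t)"
  then obtain w a where wa: "w \<in> expvecs V" "a \<in> expvecs {..<q}" "mdeg a = Suc t" "u = w + esum a"
    by (rule PwE)
  from wa(2,3) obtain i b where ib: "i < q" "b \<in> expvecs {..<q}" "mdeg b = t" "a = b + single i 1"
    by (auto elim: expvecs_Suc_decomp)
  have "u = (w + es i) + esum b" using ib(1) by (simp add: wa(4) ib(4) esum_add esum_single ac_simps flip: One_nat_def)
  then show "u \<in> Pw t" using PwI[of "w + es i" b] wa(1) ib es_expvecs[of i] by simp
qed

lemma Pw_antimono: "s \<le> t \<Longrightarrow> Pw t \<subseteq> Pw s"
  using Pw_Suc_subset by (rule lift_Suc_antimono_le)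

lemma mdeg_Pw: "u \<in> Pw t \<Longrightarrow> m * t \<le> mdeg u"
  by (auto elim!: PwE simp: mdeg_add mdeg_esum)

lemma sat_add_esum: assumes "u \<in> sat t" "b \<in> expvecs {..<q}" shows "u + esum b \<in> sat (t + mdeg b)"
proof -
  from assms(1) obtain k where k: "u \<in> Pw t" "\<And>w. w \<in> expvecs V \<Longrightarrow> mdeg w = k \<Longrightarrow> u + w \<in> Pw (Suc t)"
    by (auto simp: sat_def)
  have "u + esum b + w \<in> Pw (Suc (t + mdeg b))" if "w \<in> expvecs V" "mdeg w = k" for w
    using Pw_add_esum[OF k(2)[OF that] assms(2)] by (simp add: ac_simps)
  with k(1) assms(2) show ?thesis by (auto simp: sat_def intro: Pw_add_esum)
qed

text \<open>With unbounded cofactors, Dickson's lemma for the pairs \<open>(w, a)\<close> yields two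
  presentations, the second dividing out to the first with a cofactor \<open>w1 - w0\<close> of
  degree beyond the saturation degree \<open>k\<close> of the first. This cofactor pushes the first
  monomial into the next power, and the factor \<open>esum (a1 - a0)\<close> transports that to the
  second.\<close>

lemma jset_residue_bound:
  "\<exists>B. \<forall>w\<in>expvecs V. \<forall>a\<in>expvecs {..<q}. w + esum a \<in> jset (mdeg a) \<longrightarrow> mdeg w \<le> B"
proof (rule ccontr)
  assume "\<not> ?thesis"
  then have "\<forall>B. \<exists>w a. w \<in> expvecs V \<and> a \<in> expvecs {..<q} \<and> w + esum a \<in> jset (mdeg a) \<and> B < mdeg w"
    by (meson not_le)
  then obtain w a where wa: "\<And>B. w B \<in> expvecs V" "\<And>B. a B \<in> expvecs {..<q}"
    "\<And>B. w B + esum (a B) \<in> jset (mdeg (a B))" "\<And>B. B < mdeg (w B)" by metis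
  obtain \<phi> :: "nat \<Rightarrow> nat" where \<phi>: "strict_mono \<phi>"
    "\<And>i j. i \<le> j \<Longrightarrow> w (\<phi> i) + (w (\<phi> j) - w (\<phi> i)) = w (\<phi> j)"
    using dickson_expvecs[of V w] finite_V wa(1) by blast
  obtain \<psi> :: "nat \<Rightarrow> nat" where \<psi>: "strict_mono \<psi>"
    "\<And>i j. i \<le> j \<Longrightarrow> a (\<phi> (\<psi> i)) + (a (\<phi> (\<psi> j)) - a (\<phi> (\<psi> i))) = a (\<phi> (\<psi> j))"
    using dickson_expvecs[of "{..<q}" "\<lambda>i. a (\<phi> i)"] wa(2) by blast
  define w0 a0 where "w0 = w (\<phi> (\<psi> 0))" and "a0 = a (\<phi> (\<psi> 0))"
  have "w0 + esum a0 \<in> jset (mdeg a0)" using wa(3) by (simp add: w0_def a0_def)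
  then obtain k where k: "\<And>w. w \<in> expvecs V \<Longrightarrow> mdeg w = k \<Longrightarrow> w0 + esum a0 + w \<in> Pw (Suc (mdeg a0))"
    by (auto simp: jset_def sat_def)
  \<comment> \<open>Since \<open>mdeg (w B) > B\<close>, this index makes the degree of
    \<open>w1 - w0\<close> at least \<open>k\<close>.\<close>
  define j where "j = mdeg w0 + k"
  define w1 a1 where "w1 = w (\<phi> (\<psi> j))" and "a1 = a (\<phi> (\<psi> j))"
  have w1: "w1 = w0 + (w1 - w0)" and a1: "a1 = a0 + (a1 - a0)"
    using \<phi>(2)[of "\<psi> 0" "\<psi> j"] \<psi>(2)[of 0 j] \<psi>(1)
    by (auto simp: w0_def w1_def a0_def a1_def strict_mono_less_eq)
  have d: "w1 - w0 \<in> expvecs V" "a1 - a0 \<in> expvecs {..<q}"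
    using w1 a1 wa(1,2) by (metis expvecs_add_iff w1_def, metis expvecs_add_iff a1_def)
  have "j \<le> \<phi> (\<psi> j)"
    using strict_mono_imp_increasing[OF \<phi>(1), of "\<psi> j"] strict_mono_imp_increasing[OF \<psi>(1), of j] by simp
  also have "\<dots> < mdeg w1" using wa(4) by (simp add: w1_def)
  also have "\<dots> = mdeg w0 + mdeg (w1 - w0)" by (metis mdeg_add w1)
  finally have "k \<le> mdeg (w1 - w0)" by (simp add: j_def)
  from upset_add_multiple[OF upset_Pw k d(1) this] have "w0 + esum a0 + (w1 - w0) \<in> Pw (Suc (mdeg a0))" .
  from Pw_add_esum[OF this d(2)] have "w1 + esum a1 \<in> Pw (Suc (mdeg a1))"
    by (subst w1, subst (1 2) a1) (simp add: esum_add mdeg_add ac_simps)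
  then show False using wa(3) by (auto simp: jset_def w1_def a1_def)
qed

lemma jset_bound:
  "\<exists>B. (\<forall>t u. u \<in> jset t \<longrightarrow>
      (\<exists>w a. w \<in> expvecs V \<and> a \<in> expvecs {..<q} \<and> mdeg a = t \<and> mdeg w \<le> B \<and> u = w + esum a)) \<and>
    (\<forall>t u. u \<in> jset t \<longrightarrow> mdeg u \<le> m * t + B)"
proof -
  from jset_residue_bound obtain B where
    B: "\<And>w a. w \<in> expvecs V \<Longrightarrow> a \<in> expvecs {..<q} \<Longrightarrow> w + esum a \<in> jset (mdeg a) \<Longrightarrow> mdeg w \<le> B" by blast
  have 1: "\<exists>w a. w \<in> expvecs V \<and> a \<in> expvecs {..<q} \<and> mdeg a = t \<and> mdeg w \<le> B \<and> u = w + esum a"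
    if "u \<in> jset t" for t u
  proof -
    from that have "u \<in> Pw t" by (auto simp: jset_def sat_def)
    then show ?thesis using B that by (metis PwE)
  qed
  have "mdeg u \<le> m * t + B" if "u \<in> jset t" for t u
    using 1[OF that] by (auto simp: mdeg_add mdeg_esum)
  with 1 show ?thesis by blast
qed

lemma jset_subset_expvecs: "jset t \<subseteq> expvecs V"
  using Pw_subset by (auto simp: jset_def sat_def)

lemma finite_jset: "finite (jset t)"
proof -
  obtain B where "\<And>t u. u \<in> jset t \<Longrightarrow> mdeg u \<le> m * t + B" using jset_bound by blast
  then have "jset t \<subseteq> {u \<in> expvecs V. mdeg u \<le> m * t + B}" using jset_subset_expvecs by blast
  then show ?thesis using finite_expvecs_le(1)[OF finite_V] by (rule finite_subset)
qed

lemma jset_disjoint: assumes "s \<noteq> t" shows "jset s \<inter> jset t = {}"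
proof -
  have *: "jset s \<inter> jset t = {}" if "s < t" for s t
    using Pw_antimono[of "Suc s" t] that by (auto simp: jset_def sat_def)
  show ?thesis using *[of s t] *[of t s] assms by (metis Int_commute linorder_neqE_nat)
qed

text \<open>Each monomial of \<^term>\<open>jset t\<close> is counted through the presentation \<^term>\<open>w + esum a\<close> with
  lexicographically least \<^term>\<open>a\<close>. For fixed \<^term>\<open>w\<close>, both the exponents \<^term>\<open>a\<close> that are not
  least and those that leave \<^term>\<open>jset t\<close> upwards form up-sets.\<close>

lemma poly_like_card_jset: "poly_like (\<lambda>t. real (card (jset t)))"
proof -
  obtain B where B: "\<And>t u. u \<in> jset t \<Longrightarrow> mdeg u \<le> m * t + B" using jset_bound by blast
  define W where "W = {w \<in> expvecs V. mdeg w \<le> B}"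
  let ?M = "expvecs {..<q}"
  \<comment> \<open>The order on the exponents \<open>a\<close> is linear and invariant under
    translation. Invariance makes \<open>bigger w\<close> an up-set, linearity makes the least
    presentation unique.\<close>
  define bigger where "bigger w a \<longleftrightarrow> (\<exists>w'\<in>expvecs V. \<exists>a'\<in>?M. a' < a \<and> mdeg a' = mdeg a \<and> w' + esum a' = w + esum a)" for w a
  define U2 where "U2 w = {a \<in> ?M. w + esum a \<in> Pw (Suc (mdeg a)) \<or> bigger w a}" for w
  define U1 where "U1 w = {a \<in> ?M. w + esum a \<in> sat (mdeg a)}" for w
  define D where "D w t = {a \<in> U1 w - U2 w. mdeg a = t}" for w t
  have finW: "finite W" unfolding W_def by (rule finite_expvecs_le(1)[OF finite_V])
  have up2: "a + b \<in> U2 w" if "a \<in> U2 w" "b \<in> ?M" for a b w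
  proof -
    have "bigger w (a + b)" if big: "bigger w a"
    proof -
      from big obtain w' a' where *: "w' \<in> expvecs V" "a' \<in> ?M" "a' < a" "mdeg a' = mdeg a" "w' + esum a' = w + esum a"
        by (auto simp: bigger_def)
      have "w' + esum (a' + b) = w + esum (a + b)" using *(5) by (simp add: esum_add flip: add.assoc)
      moreover have "a' + b < a + b" using *(3) by (rule add_strict_right_mono)
      ultimately show ?thesis using * \<open>b \<in> ?M\<close> unfolding bigger_def
        by (intro bexI[of _ w'] bexI[of _ "a' + b"]) (auto simp: mdeg_add)
    qed
    moreover have "w + esum (a + b) \<in> Pw (Suc (mdeg (a + b)))" if "w + esum a \<in> Pw (Suc (mdeg a))"
      using Pw_add_esum[OF that \<open>b \<in> ?M\<close>] by (simp add: esum_add mdeg_add add.assoc)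
    ultimately show ?thesis using that by (auto simp: U2_def)
  qed
  have up1: "a + b \<in> U1 w" if "a \<in> U1 w" "b \<in> ?M" for a b w
    using sat_add_esum[of "w + esum a" "mdeg a" b] that by (simp add: U1_def esum_add mdeg_add add.assoc)
  have finD: "finite {a \<in> U1 w \<union> U2 w. mdeg a = t}" for w t
    by (rule finite_subset[OF _ finite_expvecs_eq[of "{..<q}" t]]) (auto simp: U1_def U2_def)
  \<comment> \<open>The set to be counted, \<open>U1 w - U2 w\<close>, is not an up-set, but it is
    the difference of the two up-sets \<open>U1 w \<union> U2 w\<close> and
    \<open>U2 w\<close>.\<close>
  have "poly_like (\<lambda>t. real (card {a \<in> U1 w \<union> U2 w. mdeg a = t}) - real (card {a \<in> U2 w. mdeg a = t}))" for w
  proof (intro poly_like_diff poly_like_card_upset[of "{..<q}"])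
    show "U1 w \<union> U2 w \<subseteq> ?M" "U2 w \<subseteq> ?M" by (auto simp: U1_def U2_def)
  qed (use up1 up2 in auto)
  moreover have "real (card {a \<in> U1 w \<union> U2 w. mdeg a = t}) - real (card {a \<in> U2 w. mdeg a = t}) = real (card (D w t))" for w t
  proof -
    have "{a \<in> U1 w \<union> U2 w. mdeg a = t} = D w t \<union> {a \<in> U2 w. mdeg a = t}" by (auto simp: D_def)
    moreover have "finite (D w t)" "finite {a \<in> U2 w. mdeg a = t}"
      by (rule finite_subset[OF _ finD[of w t]]; auto simp: D_def)+
    ultimately have "card {a \<in> U1 w \<union> U2 w. mdeg a = t} = card (D w t) + card {a \<in> U2 w. mdeg a = t}"
      by (simp add: card_Un_disjoint D_def Int_def)
    then show ?thesis by simp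
  qed
  ultimately have pl: "poly_like (\<lambda>t. real (card (D w t)))" for w by simp
  have "card (jset t) = (\<Sum>w\<in>W. card (D w t))" for t
  proof -
    have "bij_betw (\<lambda>(w, a). w + esum a) (Sigma W (\<lambda>w. D w t)) (jset t)"
      unfolding bij_betw_def
    proof
      show "inj_on (\<lambda>(w, a). w + esum a) (Sigma W (\<lambda>w. D w t))"
      proof (rule inj_onI, clarify)
        fix w a w' a' assume *: "w \<in> W" "w' \<in> W" "a \<in> D w t" "a' \<in> D w' t" "w + esum a = w' + esum a'"
        have "\<not> a < a'" "\<not> a' < a" using * by (auto simp: D_def U2_def U1_def bigger_def W_def)
        then have "a = a'" by simp
        with * show "w = w' \<and> a = a'" by simp
      qed
      show "(\<lambda>(w, a). w + esum a) ` Sigma W (\<lambda>w. D w t) = jset t"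
      proof (intro equalityI subsetI)
        fix u assume u: "u \<in> jset t"
        define R where "R = {a \<in> ?M. mdeg a = t \<and> (\<exists>w\<in>expvecs V. u = w + esum a)}"
        have "finite R" by (rule finite_subset[OF _ finite_expvecs_eq[of "{..<q}" t]]) (auto simp: R_def)
        moreover have "R \<noteq> {}" using u by (auto simp: R_def jset_def sat_def elim!: PwE)
        ultimately have min: "Min R \<in> R" "\<And>b. b \<in> R \<Longrightarrow> \<not> b < Min R" by (auto simp: not_less)
        define a where "a = Min R"
        from min(1) obtain w where w: "w \<in> expvecs V" "u = w + esum a" "a \<in> ?M" "mdeg a = t" by (auto simp: R_def a_def)
        have "mdeg w \<le> B" using B[OF u] w by (simp add: mdeg_add mdeg_esum)
        moreover have "\<not> bigger w a" 
        proof
          assume "bigger w a"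
          then obtain w' a' where "w' \<in> expvecs V" "a' \<in> ?M" "a' < a" "mdeg a' = mdeg a" "w' + esum a' = w + esum a"
            unfolding bigger_def by blast
          then have "a' \<in> R" using w(2,4) by (auto simp: R_def intro!: bexI[of _ w'])
          with min(2) \<open>a' < a\<close> show False by (simp add: a_def)
        qed
        ultimately show "u \<in> (\<lambda>(w, a). w + esum a) ` Sigma W (\<lambda>w. D w t)"
          using u w by (auto simp: W_def D_def U1_def U2_def jset_def intro!: image_eqI[of _ _ "(w, a)"])
      qed (auto simp: D_def U1_def U2_def jset_def)
    qed
    then have "card (jset t) = card (Sigma W (\<lambda>w. D w t))" by (simp add: bij_betw_same_card)
    also have "\<dots> = (\<Sum>w\<in>W. card (D w t))"
    proof (rule card_SigmaI)
      show "finite W" by fact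
      show "\<forall>w\<in>W. finite (D w t)" by (intro ballI finite_subset[OF _ finD[of _ t]]) (auto simp: D_def)
    qed
    finally show ?thesis .
  qed
  then show ?thesis using poly_like_sum[of W "\<lambda>w t. real (card (D w t))"] pl by simp
qed

end

section \<open>Comparison of the multiplicities of two sets of generators\<close>

lemma sum_const_single: "(\<Sum>_<K. single v D) = single v (K * D)" for K D :: nat
  by (induction K) (auto simp: single_add add.commute)

lemma mdeg_sum_const: "mdeg (\<Sum>_<k. u) = k * mdeg u" for k :: nat
  by (simp only: mdeg_sum sum_constant card_lessThan of_nat_id)

context monomial_gens
begin

definition jset_le :: "nat \<Rightarrow> ('v \<Rightarrow>\<^sub>0 nat) set"
  where "jset_le t = (\<Union>s\<le>t. jset s)"

definition jcount :: "nat \<Rightarrow> real"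
  where "jcount t = (\<Sum>s\<le>t. real (card (jset s)))"

lemma card_jset_le: "real (card (jset_le t)) = jcount t"
  unfolding jset_le_def jcount_def by (subst card_UN_disjoint) (auto simp: finite_jset jset_disjoint)

lemma finite_jset_le: "finite (jset_le t)"
  by (simp add: jset_le_def finite_jset)

lemma jset_le_bound:
  "\<exists>B. (\<forall>t u. u \<in> jset_le t \<longrightarrow>
      (\<exists>w a. w \<in> expvecs V \<and> a \<in> expvecs {..<q} \<and> mdeg a \<le> t \<and> mdeg w \<le> B \<and> u = w + esum a)) \<and>
    (\<forall>t. jset_le t \<subseteq> {u \<in> expvecs V. mdeg u \<le> m * t + B})"
proof -
  obtain B where B: "\<And>t u. u \<in> jset t \<Longrightarrow> \<exists>w a. w \<in> expvecs V \<and> a \<in> expvecs {..<q} \<and> mdeg a = t \<and> mdeg w \<le> B \<and> u = w + esum a"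
    "\<And>t u. u \<in> jset t \<Longrightarrow> mdeg u \<le> m * t + B" using jset_bound by blast
  have "mdeg u \<le> m * t + B" if "u \<in> jset s" "s \<le> t" for u s t
    using B(2)[OF that(1)] mult_le_mono2[OF that(2), of m] by linarith
  then have "jset_le t \<subseteq> {u \<in> expvecs V. mdeg u \<le> m * t + B}" for t
    using jset_subset_expvecs[THEN subsetD] by (auto simp: jset_le_def)
  moreover have "\<exists>w a. w \<in> expvecs V \<and> a \<in> expvecs {..<q} \<and> mdeg a \<le> t \<and> mdeg w \<le> B \<and> u = w + esum a"
    if "u \<in> jset_le t" for u t
    using that B(1) unfolding jset_le_def by fastforce
  ultimately show ?thesis by blast
qed

lemma jcount_bound: "\<exists>C. \<forall>t. \<bar>jcount t\<bar> \<le> C * real (Suc t) ^ card V"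
proof -
  obtain B where B: "\<And>t. jset_le t \<subseteq> {u \<in> expvecs V. mdeg u \<le> m * t + B}" using jset_le_bound by blast
  have "\<bar>jcount t\<bar> \<le> real (m + B + 1) ^ card V * real (Suc t) ^ card V" for t
  proof -
    have "card (jset_le t) \<le> card {u \<in> expvecs V. mdeg u \<le> m * t + B}"
      by (rule card_mono[OF finite_expvecs_le(1)[OF finite_V] B])
    also have "\<dots> \<le> Suc (m * t + B) ^ card V" by (rule finite_expvecs_le(2)[OF finite_V])
    also have "\<dots> \<le> ((m + B + 1) * Suc t) ^ card V" by (intro power_mono) (auto simp: algebra_simps)
    finally have "real (card (jset_le t)) \<le> real (((m + B + 1) * Suc t) ^ card V)" by (simp only: of_nat_le_iff)
    then have "real (card (jset_le t)) \<le> real (m + B + 1) ^ card V * real (Suc t) ^ card V"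
      by (simp only: of_nat_power of_nat_mult power_mult_distrib)
    moreover have "\<bar>jcount t\<bar> = real (card (jset_le t))" by (simp flip: card_jset_le)
    ultimately show ?thesis by (simp only:)
  qed
  then show ?thesis by blast
qed

lemma poly_like_jcount: "poly_like jcount"
  using poly_like_partial_sum[OF poly_like_card_jset] by (simp add: jcount_def[abs_def])

text \<open>The description denotes a genuine value: F grows at most like \<open>t ^ card V\<close>,
  so \<open>poly_like_bounded\<close> makes this difference eventually constant. It is the
  combinatorial form of j(I).\<close>

definition jmult :: real
  where "jmult = (THE c. eventually (\<lambda>t. (fdiff ^^ card V) jcount t = c) sequentially)"

lemma eventually_jmult: "eventually (\<lambda>t. (fdiff ^^ card V) jcount t = jmult) sequentially"
proof -
  obtain C where "\<And>t. \<bar>jcount t\<bar> \<le> C * real (Suc t) ^ card V" using jcount_bound by blast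
  from poly_like_bounded[OF poly_like_jcount this]
  obtain c where c: "eventually (\<lambda>t. (fdiff ^^ card V) jcount t = c) sequentially" by blast
  have "jmult = c" unfolding jmult_def
  proof (rule the_equality)
    show "eventually (\<lambda>t. (fdiff ^^ card V) jcount t = c) sequentially" by (fact c)
    fix d assume "eventually (\<lambda>t. (fdiff ^^ card V) jcount t = d) sequentially"
    with c have "eventually (\<lambda>t::nat. c = d) sequentially" by eventually_elim simp
    then show "d = c" by simp
  qed
  with c show ?thesis by simp
qed

lemma jcount_tendsto: "(\<lambda>t. jcount t / real t ^ card V) \<longlonglongrightarrow> jmult / fact (card V)"
  using eventually_jmult by (rule tendsto_of_fdiff_funpow)

lemma card_jset_tendsto:
  "(\<lambda>t. real (card (jset t)) / real t ^ (card V - 1)) \<longlonglongrightarrow> jmult / fact (card V - 1)"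
proof -
  \<comment> \<open>Needed to write \<open>card V\<close> as \<open>Suc (card V - 1)\<close>: the
    difference of order \<open>card V\<close> of the partial sums is the one of order
    \<open>card V - 1\<close> of the summands.\<close>
  have "card V > 0" using finite_V V_nonempty by (simp add: card_gt_0_iff)
  then have "eventually (\<lambda>t. (fdiff ^^ Suc (card V - 1)) (\<lambda>t. \<Sum>s\<le>t. real (card (jset s))) t = jmult) sequentially"
    using eventually_jmult by (simp add: jcount_def[abs_def])
  then show ?thesis unfolding fdiff_funpow_partial_sum by (rule tendsto_of_fdiff_funpow)
qed

text \<open>If no multiple of \<^term>\<open>v\<close> is an integer combination of the generators, then translating by
  multiples of \<^term>\<open>v\<close> shows that there are too few monomials in \<^term>\<open>jset_le t\<close>.\<close>

lemma multiple_of_var_if_jmult: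
  assumes "jmult \<noteq> 0" "v \<in> V"
  shows "\<exists>D>0. \<exists>a\<in>expvecs {..<q}. \<exists>b\<in>expvecs {..<q}. single v D + esum a = esum b"
proof (rule ccontr)
  assume "\<not> ?thesis"
  then have no: "single v D + esum a \<noteq> esum b" if "D > 0" "a \<in> expvecs {..<q}" "b \<in> expvecs {..<q}" for D a b
    using that by blast
  obtain B where B:
    "\<And>t u. u \<in> jset_le t \<Longrightarrow> \<exists>w a. w \<in> expvecs V \<and> a \<in> expvecs {..<q} \<and> mdeg a \<le> t \<and> mdeg w \<le> B \<and> u = w + esum a"
    "\<And>t. jset_le t \<subseteq> {u \<in> expvecs V. mdeg u \<le> m * t + B}" using jset_le_bound by blast
  define W where "W = {w \<in> expvecs V. mdeg w \<le> B}"
  \<comment> \<open>Fixing the cofactor \<open>w\<close> makes any two elements differ by a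
    difference of two values of \<open>esum\<close>, to which \<open>no\<close> applies.\<close>
  define P where "P w t = {u \<in> jset_le t. \<exists>a\<in>expvecs {..<q}. u = w + esum a}" for w t
  define C where "C = m + B + 2"
  let ?n = "card V"
  have finW: "finite W" unfolding W_def by (rule finite_expvecs_le(1)[OF finite_V])
  \<comment> \<open>The \<open>Suc t\<close> translates of \<open>P w t\<close> by multiples of
    \<open>v\<close> are disjoint, yet all lie in degrees O(t), where there are only O(t^n)
    monomials. The constant \<open>C\<close> makes \<open>C * Suc t\<close> exceed that degree
    bound.\<close>
  have P: "Suc t * card (P w t) \<le> (C * Suc t) ^ ?n" for w t
  proof -
    let ?f = "\<lambda>(k, u). u + single v k"
    have inj: "inj_on ?f ({..t} \<times> P w t)"
    proof (rule inj_onI, clarify)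
      fix k u k' u' assume *: "u \<in> P w t" "u' \<in> P w t" "u + single v k = u' + single v k'"
      have "\<not> k < k'" if "u \<in> P w t" "u' \<in> P w t" "u + single v k = u' + single v k'" for u u' k k'
      proof
        assume kk: "k < k'"
        from that obtain a a' where a: "a \<in> expvecs {..<q}" "a' \<in> expvecs {..<q}" "u = w + esum a" "u' = w + esum a'"
          by (auto simp: P_def)
        have "single v k' = single v (k' - k) + single v k" using kk by (simp flip: single_add)
        with that(3) a have "w + (esum a + single v k) = w + (single v (k' - k) + esum a' + single v k)"
          by (simp add: ac_simps)
        then have "single v (k' - k) + esum a' = esum a" by simp
        then show False using no[of "k' - k" a' a] a kk by simp
      qed
      from this[of u u' k k'] this[of u' u k' k] * have "k = k'" by simp
      with * show "k = k' \<and> u = u'" by simp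
    qed
    have sub: "?f ` ({..t} \<times> P w t) \<subseteq> {u \<in> expvecs V. mdeg u \<le> m * t + B + t}"
      using B(2)[of t] assms(2) by (fastforce simp: P_def mdeg_add)
    have "Suc t * card (P w t) = card ({..t} \<times> P w t)" by (simp add: card_cartesian_product)
    also have "\<dots> \<le> card {u \<in> expvecs V. mdeg u \<le> m * t + B + t}"
      by (rule card_inj_on_le[OF inj sub finite_expvecs_le(1)[OF finite_V]])
    also have "\<dots> \<le> Suc (m * t + B + t) ^ ?n" by (rule finite_expvecs_le(2)[OF finite_V])
    also have "\<dots> \<le> (C * Suc t) ^ ?n" by (intro power_mono) (auto simp: algebra_simps C_def)
    finally show ?thesis .
  qed
  have bound: "jcount t * real (Suc t) \<le> (real (card W) * real C ^ ?n) * real (Suc t) ^ ?n" for t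
  proof -
    have "jset_le t \<subseteq> (\<Union>w\<in>W. P w t)" using B(1) by (fastforce simp: W_def P_def)
    then have "card (jset_le t) \<le> card (\<Union>w\<in>W. P w t)"
      by (rule card_mono[rotated]) (use finW finite_jset_le in \<open>auto simp: P_def\<close>)
    also have "\<dots> \<le> (\<Sum>w\<in>W. card (P w t))" by (rule card_UN_le[OF finW])
    finally have "Suc t * card (jset_le t) \<le> (\<Sum>w\<in>W. Suc t * card (P w t))"
      unfolding sum_distrib_left[symmetric] by (rule mult_le_mono2)
    also have "\<dots> \<le> (\<Sum>w\<in>W. (C * Suc t) ^ ?n)" by (intro sum_mono P)
    also have "\<dots> = card W * (C ^ ?n * Suc t ^ ?n)"
      by (simp only: sum_constant of_nat_id power_mult_distrib)
    finally have "real (Suc t * card (jset_le t)) \<le> real (card W * (C ^ ?n * Suc t ^ ?n))" by (simp only: of_nat_le_iff)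
    then show ?thesis by (simp only: of_nat_mult of_nat_power card_jset_le[symmetric] mult.commute mult.left_commute mult.assoc)
  qed
  have nonneg: "jcount t \<ge> 0" for t by (simp flip: card_jset_le)
  have "(\<lambda>t. jcount t * real (Suc t) / real t ^ Suc ?n) \<longlonglongrightarrow> 0"
    by (rule tendsto_zero_of_bound[where n = ?n and C = "real (card W) * real C ^ ?n"])
      (use bound nonneg in \<open>auto simp: abs_mult\<close>)
  then have "(\<lambda>t. jcount t / real t ^ ?n) \<longlonglongrightarrow> 0"
  proof (rule tendsto_0_le)
    show "eventually (\<lambda>t. norm (jcount t / real t ^ ?n) \<le> norm (jcount t * real (Suc t) / real t ^ Suc ?n) * 1) sequentially"
      using eventually_gt_at_top[of 0]
    proof eventually_elim
      case (elim t)
      have "jcount t * real t \<le> jcount t * real (Suc t)" using nonneg by (intro mult_left_mono) auto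
      then have "jcount t / real t ^ ?n \<le> jcount t * real (Suc t) / real t ^ Suc ?n"
        using elim by (simp add: field_simps)
      then show ?case using nonneg[of t] by simp
    qed
  qed
  from LIMSEQ_unique[OF this jcount_tendsto] assms(1) show False by simp
qed

text \<open>Since \<open>m\<close> is positive, the degree of a monomial bounds the powers that
  contain it.\<close>

lemma max_order:
  assumes "u \<in> expvecs V"
  obtains t where "u \<in> Pw t" "u \<notin> Pw (Suc t)"
proof -
  have "\<exists>t. u \<notin> Pw t"
  proof
    show "u \<notin> Pw (Suc (mdeg u))"
    proof
      assume "u \<in> Pw (Suc (mdeg u))"
      from mdeg_Pw[OF this] m_pos have "Suc (mdeg u) \<le> mdeg u"
        by (metis One_nat_def mult_le_mono1 nat_mult_1 order_trans)
      then show False by simp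
    qed
  qed
  moreover have "u \<in> Pw 0" using assms by (simp add: Pw_0)
  ultimately have "\<exists>t. u \<in> Pw t \<and> u \<notin> Pw (Suc t)"
    using nat_induct[of "\<lambda>t. u \<in> Pw t"] by blast
  then show thesis using that by blast
qed

text \<open>In \<^term>\<open>c\<close>, a large multiple of the sum of the \<^term>\<open>esum (a0 v)\<close>, every \<^term>\<open>esum (a0 v)\<close> can be
  traded together with a power of \<^term>\<open>v\<close> for a larger number of generators. The gain exceeds
  the defect of \<^term>\<open>w + esum a + c\<close>, which is at most \<^term>\<open>B\<close>.\<close>

lemma shift_into_jset:
  assumes "\<And>v. v \<in> V \<Longrightarrow> \<exists>D>0. \<exists>a\<in>expvecs {..<q}. \<exists>b\<in>expvecs {..<q}. single v D + esum a = esum b"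
  shows "\<exists>c N. \<forall>w\<in>expvecs V. \<forall>a\<in>expvecs {..<q}. mdeg w \<le> B \<longrightarrow> (\<exists>t\<le>mdeg a + N. w + esum a + c \<in> jset t)"
proof -
  from assms have "\<forall>v\<in>V. \<exists>D a b. D > 0 \<and> a \<in> expvecs {..<q} \<and> b \<in> expvecs {..<q} \<and> single v D + esum a = esum b"
    by blast
  then obtain D a0 b0 where rel: "\<And>v. v \<in> V \<Longrightarrow> D v > (0::nat) \<and> a0 v \<in> expvecs {..<q} \<and> b0 v \<in> expvecs {..<q} \<and>
      single v (D v) + esum (a0 v) = esum (b0 v)"
    by metis
  \<comment> \<open>The order of the translated monomial can exceed its visible
    \<open>mdeg a + mdeg c0\<close> by at most \<open>B\<close>. A trade of \<open>K\<close> copies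
    gains at least \<open>K\<close>, one more than this.\<close>
  define K where "K = Suc B"
  define c0 where "c0 = (\<Sum>v\<in>V. \<Sum>_<K. a0 v)"
  have c0: "c0 \<in> expvecs {..<q}" unfolding c0_def using rel by (intro sum_in_expvecs) auto
  have "\<exists>t\<le>mdeg a + (B + mdeg c0). w + esum a + esum c0 \<in> jset t"
    if wa: "w \<in> expvecs V" "a \<in> expvecs {..<q}" "mdeg w \<le> B" for w a
  proof -
    define u where "u = w + esum a + esum c0"
    have "u \<in> expvecs V" using wa by (simp add: u_def)
    \<comment> \<open>The true order of \<open>u\<close>; other presentations may put it above the
      visible one, so only an upper bound on \<open>t\<close> is available.\<close>
    then obtain t where t: "u \<in> Pw t" "u \<notin> Pw (Suc t)" by (rule max_order)
    have "m * t \<le> mdeg u" by (rule mdeg_Pw[OF t(1)])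
    also have "mdeg u = mdeg w + m * (mdeg a + mdeg c0)"
      using wa c0 by (simp add: u_def mdeg_add mdeg_esum algebra_simps)
    also have "\<dots> \<le> m * B + m * (mdeg a + mdeg c0)" using wa(3) m_pos by (intro add_right_mono) (metis One_nat_def mult_le_mono nat_mult_1)
    also have "\<dots> = m * (mdeg a + (B + mdeg c0))" by (simp add: algebra_simps)
    finally have t_le: "t \<le> mdeg a + (B + mdeg c0)" using m_pos by simp
    have step: "u + single v (K * D v) \<in> Pw (Suc t)" if v: "v \<in> V" for v
    proof -
      define c1 where "c1 = (\<Sum>v\<in>V - {v}. \<Sum>_<K. a0 v)"
      have c0_eq: "c0 = (\<Sum>_<K. a0 v) + c1" unfolding c0_def c1_def using v finite_V by (simp add: sum.remove)
      define b where "b = a + c1 + (\<Sum>_<K. b0 v)"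
      have c1: "c1 \<in> expvecs {..<q}" using c0 by (simp add: c0_eq)
      have b: "b \<in> expvecs {..<q}" using wa c1 rel[OF v] by (auto simp: b_def simp del: sum_constant intro: sum_in_expvecs)
      have "esum (\<Sum>_<K. b0 v) = single v (K * D v) + esum (\<Sum>_<K. a0 v)"
        using rel[OF v] by (simp add: esum_sum del: sum_constant flip: sum.distrib sum_const_single)
      then have eq: "u + single v (K * D v) = w + esum b"
        by (simp add: u_def b_def c0_eq esum_add ac_simps)
      \<comment> \<open>Here equal degree of the generators enters: as \<open>D v > 0\<close>, the
        right side of the relation has more generators than the left.\<close>
      have "m * mdeg (b0 v) = D v + m * mdeg (a0 v)"
        using rel[OF v] by (metis mdeg_add mdeg_esum mdeg_single)
      then have "m * mdeg (a0 v) < m * mdeg (b0 v)" using rel[OF v] by simp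
      then have "mdeg (a0 v) < mdeg (b0 v)" by simp
      then have "K * Suc (mdeg (a0 v)) \<le> K * mdeg (b0 v)" by (intro mult_le_mono2) simp
      then have "mdeg a + mdeg c0 + K \<le> mdeg b" by (simp add: b_def c0_eq mdeg_add mdeg_sum_const del: sum_constant)
      then have "Suc t \<le> mdeg b" using t_le by (simp add: K_def)
      then show ?thesis using PwI[OF wa(1) b] Pw_antimono eq by auto
    qed
    \<comment> \<open>Pigeonhole: a monomial of this degree has some exponent at least
      \<open>K * D v\<close>, which suffices for the trade at \<open>v\<close>.\<close>
    define k where "k = (\<Sum>v\<in>V. K * D v)"
    have "u + x \<in> Pw (Suc t)" if x: "x \<in> expvecs V" "mdeg x = k" for x
    proof -
      have "\<exists>v\<in>V. K * D v \<le> lookup x v"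
      proof (rule ccontr)
        assume "\<not> ?thesis"
        then have "(\<Sum>v\<in>V. lookup x v) < (\<Sum>v\<in>V. K * D v)"
          using finite_V V_nonempty by (intro sum_strict_mono) (auto simp: not_le)
        moreover have "mdeg x = (\<Sum>v\<in>V. lookup x v)" using x by (intro mdeg_eq_sum[OF finite_V]) (simp add: expvecs_def)
        ultimately show False using x(2) by (simp add: k_def)
      qed
      then obtain v where v: "v \<in> V" "K * D v \<le> lookup x v" by blast
      have eq: "single v (K * D v) + (x - single v (K * D v)) = x"
        by (rule pointwise_le_imp_add) (use v in \<open>auto simp: lookup_single when_def\<close>)
      then have "x - single v (K * D v) \<in> expvecs V" using x(1) by (metis expvecs_add_iff)
      from Pw_add[OF step[OF v(1)] this] show ?thesis using eq by (simp add: add.assoc)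
    qed
    with t have "u \<in> jset t" by (auto simp: jset_def sat_def)
    with t_le show ?thesis by (auto simp: u_def)
  qed
  then show ?thesis by blast
qed

end

section \<open>Linear algebra of exponent vectors over the rationals\<close>

definition qscale :: "rat \<Rightarrow> ('v \<Rightarrow>\<^sub>0 rat) \<Rightarrow> ('v \<Rightarrow>\<^sub>0 rat)"
  where "qscale c f = Poly_Mapping.map ((*) c) f"

definition qvec :: "('v \<Rightarrow>\<^sub>0 nat) \<Rightarrow> ('v \<Rightarrow>\<^sub>0 rat)"
  where "qvec u = Poly_Mapping.map of_nat u"

lemma lookup_qscale [simp]: "lookup (qscale c f) x = c * lookup f x"
  by (simp add: qscale_def Poly_Mapping.map.rep_eq when_def)

lemma lookup_qvec [simp]: "lookup (qvec u) x = of_nat (lookup u x)"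
  by (simp add: qvec_def Poly_Mapping.map.rep_eq when_def)

interpretation qv: vector_space qscale
  by unfold_locales (auto intro!: poly_mapping_eqI simp: lookup_add algebra_simps)

lemma qvec_add: "qvec (u + v) = qvec u + qvec v"
  by (rule poly_mapping_eqI) (simp add: lookup_add)

lemma qvec_sum: "qvec (\<Sum>i\<in>A. f i) = (\<Sum>i\<in>A. qvec (f i))"
  by (rule poly_mapping_eqI) (simp add: lookup_sum)

lemma inj_qvec: "inj qvec"
  by (rule injI) (metis (mono_tags) lookup_qvec of_nat_eq_iff poly_mapping_eqI)

lemma qvec_single: "qvec (single v n) = qscale (of_nat n) (qvec (single v 1))"
  by (rule poly_mapping_eqI) (simp add: lookup_single when_def)

lemma inj_qvec_var: "inj (\<lambda>v. qvec (single v (1::nat)))"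
proof (rule injI)
  fix x y :: 'v assume "qvec (single x (1::nat)) = qvec (single y 1)"
  then have "lookup (qvec (single x (1::nat))) x = lookup (qvec (single y 1)) x" by simp
  then show "x = y" by (simp add: lookup_single when_def split: if_splits)
qed

lemma independent_qvec_vars:
  assumes "finite V"
  shows "qv.independent ((\<lambda>v. qvec (single v 1)) ` V)"
proof
  let ?e = "\<lambda>v. qvec (single v (1::nat))"
  have inj: "inj_on ?e V" using inj_qvec_var by (rule inj_on_subset) simp
  assume "qv.dependent (?e ` V)"
  then obtain c v where c: "v \<in> V" "c (?e v) \<noteq> 0" "(\<Sum>x\<in>?e ` V. qscale (c x) x) = 0"
    using assms by (auto simp: qv.dependent_finite)
  from c(3) have "lookup (\<Sum>x\<in>V. qscale (c (?e x)) (?e x)) v = 0"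
    by (simp only: sum.reindex[OF inj] o_def lookup_zero)
  moreover have "lookup (\<Sum>x\<in>V. qscale (c (?e x)) (?e x)) v = c (?e v)"
    using assms c(1) by (simp add: lookup_sum lookup_single when_def if_distrib cong: if_cong)
  ultimately show False using c(2) by simp
qed

lemma qvec_in_span_vars:
  assumes "u \<in> expvecs V" "finite V"
  shows "qvec u \<in> qv.span ((\<lambda>v. qvec (single v 1)) ` V)"
proof -
  have "qvec u = (\<Sum>v\<in>V. qscale (of_nat (lookup u v)) (qvec (single v 1)))"
  proof (rule poly_mapping_eqI)
    fix x
    show "lookup (qvec u) x = lookup (\<Sum>v\<in>V. qscale (of_nat (lookup u v)) (qvec (single v 1))) x"
      using assms by (cases "x \<in> V") (auto simp: lookup_sum lookup_single when_def if_distrib expvecs_def in_keys_iff subset_iff cong: if_cong)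
  qed
  also have "\<dots> \<in> qv.span ((\<lambda>v. qvec (single v 1)) ` V)"
    by (intro qv.span_sum qv.span_scale qv.span_base) auto
  finally show ?thesis .
qed

lemma (in monomial_gens) qvec_esum_in_span: "qvec (esum a) \<in> qv.span (qvec ` es ` {..<q})"
  unfolding esum_def qvec_sum by (intro qv.span_sum qv.span_base) auto

text \<open>Dividing the relation of a node by \<open>D\<close> puts the node into the rational span
  of the generators. Hence a maximal independent extension of the variables of \<open>V'\<close> by
  generators has at least \<open>card V\<close> elements.\<close>

lemma (in monomial_gens) extend_vars_to_basis:
  assumes "\<And>v. v \<in> V \<Longrightarrow> \<exists>D>0. \<exists>a\<in>expvecs {..<q}. \<exists>b\<in>expvecs {..<q}. single v D + esum a = esum b"
    and "V' \<subseteq> V"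
  obtains B where "B \<subseteq> es ` {..<q}" "card V' + card B = card V"
    "qv.independent ((\<lambda>v. qvec (single v 1)) ` V' \<union> qvec ` B)"
    "qvec ` B \<inter> (\<lambda>v. qvec (single v 1)) ` V' = {}"
proof -
  let ?e = "\<lambda>v. qvec (single v (1::nat))"
  let ?S = "?e ` V'" and ?E = "qvec ` es ` {..<q}"
  note inj = inj_qvec_var
  have finV': "finite V'" using assms(2) finite_V by (rule finite_subset)
  obtain B0 where B0: "?S \<subseteq> B0" "B0 \<subseteq> ?S \<union> ?E" "qv.independent B0" "?S \<union> ?E \<subseteq> qv.span B0"
    using qv.maximal_independent_subset_extend[of ?S "?S \<union> ?E"] independent_qvec_vars[OF finV'] by blast
  have finB0: "finite B0" using B0(2) finV' by (auto intro: finite_subset)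
  have "?e v \<in> qv.span B0" if v: "v \<in> V" for v
  proof -
    from assms(1)[OF v] obtain D a b where D: "D > 0" "single v D + esum a = esum b" by blast
    have "qscale (of_nat D) (?e v) + qvec (esum a) = qvec (esum b)"
      by (simp only: D(2)[symmetric] qvec_add qvec_single[of v D])
    then have "qscale (of_nat D) (?e v) = qvec (esum b) - qvec (esum a)" by (simp add: algebra_simps)
    moreover have "qvec (esum x) \<in> qv.span B0" for x
      using qvec_esum_in_span[of x] qv.span_minimal[OF _ qv.subspace_span, of ?E B0] B0(4) by blast
    ultimately have "qscale (of_nat D) (?e v) \<in> qv.span B0" by (simp add: qv.span_diff)
    then have "qscale (1 / of_nat D) (qscale (of_nat D) (?e v)) \<in> qv.span B0" by (rule qv.span_scale)
    then show ?thesis using D(1) by simp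
  qed
  then have "card (?e ` V) \<le> card B0"
    using qv.independent_span_bound[OF finB0 independent_qvec_vars[OF finite_V]] by blast
  moreover have "card (?e ` V) = card V" "card ?S = card V'"
    using inj by (auto intro!: card_image intro: inj_on_subset)
  moreover have "card (B0 - ?S) = card B0 - card ?S" using B0(1) finV' by (intro card_Diff_subset) auto
  ultimately have "card V - card V' \<le> card (B0 - ?S)" by simp
  \<comment> \<open>Only a lower bound on the size of \<open>B0\<close> has been derived, so a
    subset of the exact size is selected.\<close>
  then obtain B1 where B1: "B1 \<subseteq> B0 - ?S" "card B1 = card V - card V'"
    by (meson obtain_subset_with_card_n)
  define B where "B = {e \<in> es ` {..<q}. qvec e \<in> B1}"
  have B1_eq: "qvec ` B = B1" 
  proof (intro equalityI subsetI)
    fix x assume x: "x \<in> B1"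
    then have "x \<in> ?E" using B1(1) B0(2) by blast
    then obtain i where "i < q" "x = qvec (es i)" by auto
    then show "x \<in> qvec ` B" using x by (auto simp: B_def)
  qed (auto simp: B_def)
  have "card B = card B1" using card_image[OF inj_on_subset[OF inj_qvec subset_UNIV], of B] B1_eq by simp
  then have "card V' + card B = card V" using B1(2) card_mono[OF finite_V assms(2)] by simp
  moreover have "qv.independent (?S \<union> qvec ` B)"
    using qv.independent_mono[OF B0(3), of "?S \<union> B1"] B0(1) B1(1) B1_eq by auto
  ultimately show thesis using that[of B] B1 B1_eq by (auto simp: B_def)
qed

lemma qvec_sum_const: "qvec (\<Sum>_<k. e) = qscale (of_nat k) (qvec e)" for k :: nat
  by (rule poly_mapping_eqI) (simp add: lookup_sum)

text \<open>Adjoining all multiples of one further independent generator replaces the counting function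
  by its partial sums, which preserves the eventual value of the highest difference.\<close>

lemma (in monomial_gens) thicken_family:
  assumes "finite B" "B \<subseteq> es ` {..<q}"
    and "qv.independent ((\<lambda>v. qvec (single v 1)) ` V' \<union> qvec ` B)"
    and "qvec ` B \<inter> (\<lambda>v. qvec (single v 1)) ` V' = {}"
    and "\<And>t. finite (Y0 t)" "\<And>t y. y \<in> Y0 t \<Longrightarrow> qvec y \<in> qv.span ((\<lambda>v. qvec (single v 1)) ` V')"
    and "\<And>t y. y \<in> Y0 t \<Longrightarrow> \<exists>w\<in>expvecs V. \<exists>a\<in>expvecs {..<q}. mdeg w \<le> N \<and> mdeg a \<le> t \<and> y = w + esum a"
    and "eventually (\<lambda>t. (fdiff ^^ d) (\<lambda>t. real (card (Y0 t))) t = c) sequentially"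
  shows "\<exists>Y. (\<forall>t. finite (Y t)) \<and>
    (\<forall>t. \<forall>y\<in>Y t. qvec y \<in> qv.span ((\<lambda>v. qvec (single v 1)) ` V' \<union> qvec ` B)) \<and>
    (\<forall>t. \<forall>y\<in>Y t. \<exists>w\<in>expvecs V. \<exists>a\<in>expvecs {..<q}. mdeg w \<le> N \<and> mdeg a \<le> t \<and> y = w + esum a) \<and>
    eventually (\<lambda>t. (fdiff ^^ (d + card B)) (\<lambda>t. real (card (Y t))) t = c) sequentially"
  using assms(1-4)
proof (induction B rule: finite_induct)
  case empty
  then show ?case using assms(5-8) by (intro exI[of _ Y0]) auto
next
  case (insert e B)
  let ?S = "(\<lambda>v. qvec (single v (1::nat))) ` V' \<union> qvec ` B"
  have ind: "qv.independent ?S" by (rule qv.independent_mono[OF insert.prems(2)]) auto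
  have "B \<subseteq> es ` {..<q}" "qvec ` B \<inter> (\<lambda>v. qvec (single v (1::nat))) ` V' = {}"
    using insert.prems by auto
  from insert.IH[OF this(1) ind this(2)] obtain Y where Y: "\<And>t. finite (Y t)"
    "\<And>t y. y \<in> Y t \<Longrightarrow> qvec y \<in> qv.span ?S"
    "\<And>t y. y \<in> Y t \<Longrightarrow> \<exists>w\<in>expvecs V. \<exists>a\<in>expvecs {..<q}. mdeg w \<le> N \<and> mdeg a \<le> t \<and> y = w + esum a"
    "eventually (\<lambda>t. (fdiff ^^ (d + card B)) (\<lambda>t. real (card (Y t))) t = c) sequentially"
    by blast
  have "qvec e \<notin> ?S" using insert.hyps(2) insert.prems(3) inj_qvec by (auto dest: injD)
  then have e: "qvec e \<notin> qv.span ?S" using insert.prems(2) by (simp add: qv.independent_insert)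
  from insert.prems(1) obtain i where i: "i < q" "e = es i" by auto
  define sh where "sh k = (\<lambda>y. y + (\<Sum>_<k. e))" for k :: nat
  \<comment> \<open>Adjoining \<open>k\<close> copies of \<open>e\<close> raises the level by
    \<open>k\<close>, so they are put on top of level \<open>t - k\<close>.\<close>
  define Y' where "Y' t = (\<Union>k\<le>t. sh k ` Y (t - k))" for t
  \<comment> \<open>If two shifts agreed, a nonzero multiple of \<open>e\<close> would be a
    difference of elements of the span, against independence. The union is therefore disjoint and
    its size is a partial sum.\<close>
  have less: False if "y \<in> Y s" "y' \<in> Y s'" "sh k y = sh k' y'" "k < k'" for y y' k k' s s'
  proof -
    have "qvec y + qscale (of_nat k) (qvec e) = qvec y' + qscale (of_nat k') (qvec e)"
      using that(3) by (simp add: sh_def flip: qvec_sum_const qvec_add)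
    then have "qscale (of_nat k' - of_nat k) (qvec e) = qvec y - qvec y'"
      by (simp add: qv.scale_left_diff_distrib algebra_simps)
    moreover have "qvec y - qvec y' \<in> qv.span ?S" using Y(2) that by (intro qv.span_diff) auto
    ultimately have "qscale (of_nat k' - of_nat k) (qvec e) \<in> qv.span ?S" by simp
    then have "qscale (1 / (of_nat k' - of_nat k)) (qscale (of_nat k' - of_nat k) (qvec e)) \<in> qv.span ?S"
      by (rule qv.span_scale)
    then show False using e that(4) by simp
  qed
  have "card (Y' t) = (\<Sum>s\<le>t. card (Y s))" for t
  proof -
    have "card (Y' t) = (\<Sum>k\<le>t. card (sh k ` Y (t - k)))"
      unfolding Y'_def
    proof (rule card_UN_disjoint)
      show "\<forall>k\<in>{..t}. \<forall>l\<in>{..t}. k \<noteq> l \<longrightarrow> sh k ` Y (t - k) \<inter> sh l ` Y (t - l) = {}"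
      proof (intro ballI impI equals0I)
        fix k l c assume kl: "k \<noteq> l" "c \<in> sh k ` Y (t - k) \<inter> sh l ` Y (t - l)"
        then obtain y y' where y: "y \<in> Y (t - k)" "y' \<in> Y (t - l)" "c = sh k y" "c = sh l y'" by blast
        show False using less[of y _ y' _ k l] less[of y' _ y _ l k] y kl(1) by (metis linorder_neqE_nat)
      qed
    qed (use Y(1) in auto)
    also have "\<dots> = (\<Sum>k\<le>t. card (Y (t - k)))"
      by (intro sum.cong refl card_image) (simp add: inj_on_def sh_def)
    also have "\<dots> = (\<Sum>s\<le>t. card (Y s))"
      by (rule sum.reindex_bij_witness[of _ "\<lambda>s. t - s" "\<lambda>k. t - k"]) auto
    finally show ?thesis .
  qed
  then have cardY': "(\<lambda>t. real (card (Y' t))) = (\<lambda>t. \<Sum>s\<le>t. real (card (Y s)))" by simp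
  show ?case
  proof (intro exI[of _ Y'] conjI allI ballI)
    show "finite (Y' t)" for t using Y(1) by (simp add: Y'_def)
    show "eventually (\<lambda>t. (fdiff ^^ (d + card (insert e B))) (\<lambda>t. real (card (Y' t))) t = c) sequentially"
    proof -
      have "card (insert e B) = Suc (card B)" using insert.hyps by simp
      then show ?thesis unfolding cardY' by (simp only: add_Suc_right fdiff_funpow_partial_sum Y(4))
    qed
    fix t y assume "y \<in> Y' t"
    then obtain k x where kx: "k \<le> t" "x \<in> Y (t - k)" "y = x + (\<Sum>_<k. e)" by (auto simp: Y'_def sh_def)
    have sub: "?S \<subseteq> (\<lambda>v. qvec (single v 1)) ` V' \<union> qvec ` insert e B" by auto
    have "qvec x \<in> qv.span ((\<lambda>v. qvec (single v 1)) ` V' \<union> qvec ` insert e B)"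
      using Y(2)[OF kx(2)] qv.span_mono[OF sub] by blast
    then show "qvec y \<in> qv.span ((\<lambda>v. qvec (single v 1)) ` V' \<union> qvec ` insert e B)"
      unfolding kx(3) qvec_add qvec_sum_const by (intro qv.span_add qv.span_scale) (auto intro: qv.span_base)
    from Y(3)[OF kx(2)] obtain w a where wa: "w \<in> expvecs V" "a \<in> expvecs {..<q}" "mdeg w \<le> N" "mdeg a \<le> t - k" "x = w + esum a"
      by blast
    let ?b = "a + (\<Sum>_<k. single i 1)"
    have "y = w + esum ?b" using kx(3) wa(5) i by (simp add: esum_add esum_sum esum_single ac_simps del: sum_constant flip: One_nat_def)
    moreover have "?b \<in> expvecs {..<q}" using wa(2) i(1) by (auto simp del: sum_constant intro!: sum_in_expvecs)
    moreover have "mdeg ?b \<le> t" using wa(4) kx(1) by (simp add: mdeg_add mdeg_sum_const del: sum_constant)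
    ultimately show "\<exists>w\<in>expvecs V. \<exists>a\<in>expvecs {..<q}. mdeg w \<le> N \<and> mdeg a \<le> t \<and> y = w + esum a"
      using wa by blast
  qed
qed

text \<open>The comparison is made between limits after division by \<open>t ^ card V\<close>, into
  which both multiplicities enter with the same factor \<open>fact (card V)\<close>: the thickened
  family of \<open>V'\<close> has differences of order \<open>card V\<close>, not
  \<open>card V'\<close>.\<close>

theorem jmult_mono:
  assumes "monomial_gens V es q m" "monomial_gens V' es' q' m" "V' \<subseteq> V"
    and sub: "\<And>i. i < q' \<Longrightarrow> \<exists>j<q. es' i = es j"
    and nonzero: "monomial_gens.jmult V es q \<noteq> 0"
  shows "monomial_gens.jmult V' es' q' \<le> monomial_gens.jmult V es q"
proof -
  interpret G: monomial_gens V es q m by fact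
  interpret H: monomial_gens V' es' q' m by fact
  let ?e = "\<lambda>v. qvec (single v (1::nat))"
  have rel: "\<exists>D>0. \<exists>a\<in>expvecs {..<q}. \<exists>b\<in>expvecs {..<q}. single v D + G.esum a = G.esum b" if "v \<in> V" for v
    using G.multiple_of_var_if_jmult[OF nonzero that] .
  from sub obtain g where g: "\<And>i. i < q' \<Longrightarrow> g i < q \<and> es' i = es (g i)" by metis
  \<comment> \<open>The two indexings of generators are unrelated; \<open>g\<close> sends each
    generator of \<open>H\<close> to an equal one of \<open>G\<close> and keeps the number of
    factors.\<close>
  have transfer: "\<exists>b\<in>expvecs {..<q}. mdeg b = mdeg a \<and> G.esum b = H.esum a" if a: "a \<in> expvecs {..<q'}" for a
  proof (intro bexI[of _ "\<Sum>i<q'. \<Sum>_<lookup a i. single (g i) 1"] conjI)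
    show "mdeg (\<Sum>i<q'. \<Sum>_<lookup a i. single (g i) 1) = mdeg a"
      using a by (simp add: mdeg_sum[of _ "{..<q'}"] mdeg_sum_const mdeg_eq_sum[of "{..<q'}" a] expvecs_def del: sum_constant)
    show "G.esum (\<Sum>i<q'. \<Sum>_<lookup a i. single (g i) 1) = H.esum a"
      unfolding G.esum_sum H.esum_def using g by (intro sum.cong refl) (auto simp: G.esum_single G.esum_sum simp del: sum_constant simp flip: One_nat_def)
    show "(\<Sum>i<q'. \<Sum>_<lookup a i. single (g i) 1) \<in> expvecs {..<q}"
      using g by (intro sum_in_expvecs single_in_expvecs) auto
  qed
  have expV: "expvecs V' \<subseteq> expvecs V" using assms(3) by (auto simp: expvecs_def)
  obtain N where N: "\<And>t u. u \<in> H.jset_le t \<Longrightarrow> \<exists>w a. w \<in> expvecs V' \<and> a \<in> expvecs {..<q'} \<and> mdeg a \<le> t \<and> mdeg w \<le> N \<and> u = w + H.esum a"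
    using H.jset_le_bound by blast
  have Y0: "\<exists>w\<in>expvecs V. \<exists>a\<in>expvecs {..<q}. mdeg w \<le> N \<and> mdeg a \<le> t \<and> y = w + G.esum a" if y: "y \<in> H.jset_le t" for t y
  proof -
    from N[OF y] obtain w a where wa: "w \<in> expvecs V'" "a \<in> expvecs {..<q'}" "mdeg a \<le> t" "mdeg w \<le> N" "y = w + H.esum a"
      by blast
    with transfer[OF wa(2)] expV show ?thesis by (metis subsetD)
  qed
  have span0: "qvec y \<in> qv.span (?e ` V')" if "y \<in> H.jset_le t" for t y
    using that H.jset_subset_expvecs by (intro qvec_in_span_vars H.finite_V) (auto simp: H.jset_le_def)
  have diff0: "eventually (\<lambda>t. (fdiff ^^ card V') (\<lambda>t. real (card (H.jset_le t))) t = H.jmult) sequentially"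
    using H.eventually_jmult by (simp add: H.card_jset_le)
  obtain B where B: "B \<subseteq> es ` {..<q}" "card V' + card B = card V"
    "qv.independent (?e ` V' \<union> qvec ` B)" "qvec ` B \<inter> ?e ` V' = {}"
    using G.extend_vars_to_basis[OF rel assms(3)] by blast
  have finB: "finite B" using B(1) by (rule finite_subset) simp
  obtain Y where "(\<forall>t. finite (Y t)) \<and>
    (\<forall>t. \<forall>y\<in>Y t. qvec y \<in> qv.span (?e ` V' \<union> qvec ` B)) \<and>
    (\<forall>t. \<forall>y\<in>Y t. \<exists>w\<in>expvecs V. \<exists>a\<in>expvecs {..<q}. mdeg w \<le> N \<and> mdeg a \<le> t \<and> y = w + G.esum a) \<and>
    eventually (\<lambda>t. (fdiff ^^ (card V' + card B)) (\<lambda>t. real (card (Y t))) t = H.jmult) sequentially"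
    using G.thicken_family[OF finB B(1,3,4) H.finite_jset_le span0 Y0 diff0] by (rule exE)
  then have Y: "\<And>t. finite (Y t)"
    "\<And>t y. y \<in> Y t \<Longrightarrow> \<exists>w\<in>expvecs V. \<exists>a\<in>expvecs {..<q}. mdeg w \<le> N \<and> mdeg a \<le> t \<and> y = w + G.esum a"
    "eventually (\<lambda>t. (fdiff ^^ card V) (\<lambda>t. real (card (Y t))) t = H.jmult) sequentially"
    by (simp_all only: B(2) simp_thms)
  \<comment> \<open>The cofactor bound \<open>N\<close> holds at every level and survives
    thickening, so a single translation \<open>c\<close> serves all \<open>t\<close>.\<close>
  from G.shift_into_jset[OF rel, of N] obtain c M where
    c: "\<And>w a. w \<in> expvecs V \<Longrightarrow> a \<in> expvecs {..<q} \<Longrightarrow> mdeg w \<le> N \<Longrightarrow> \<exists>t\<le>mdeg a + M. w + G.esum a + c \<in> G.jset t"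
    by blast
  have le: "real (card (Y t)) \<le> G.jcount (t + M)" for t
  proof -
    have "(\<lambda>y. y + c) ` Y t \<subseteq> G.jset_le (t + M)"
    proof
      fix z assume "z \<in> (\<lambda>y. y + c) ` Y t"
      then obtain y where y: "y \<in> Y t" "z = y + c" by blast
      from Y(2)[OF y(1)] obtain w a where wa: "w \<in> expvecs V" "a \<in> expvecs {..<q}" "mdeg w \<le> N" "mdeg a \<le> t" "y = w + G.esum a"
        by blast
      from c[OF wa(1-3)] obtain s where "s \<le> mdeg a + M" "z \<in> G.jset s" using y(2) wa(5) by auto
      then show "z \<in> G.jset_le (t + M)" using wa(4) by (auto simp: G.jset_le_def intro!: bexI[of _ s])
    qed
    then have "card (Y t) \<le> card (G.jset_le (t + M))"
      by (intro card_inj_on_le[of "\<lambda>y. y + c"] G.finite_jset_le) (simp add: inj_on_def)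
    then show ?thesis by (simp flip: G.card_jset_le)
  qed
  have "(\<lambda>t. real (card (Y t)) / real t ^ card V) \<longlonglongrightarrow> H.jmult / fact (card V)"
    using Y(3) by (rule tendsto_of_fdiff_funpow)
  \<comment> \<open>The constant delay \<open>M\<close> does not affect the eventual value of the
    highest difference, hence not the limit.\<close>
  moreover have "eventually (\<lambda>t. (fdiff ^^ card V) (\<lambda>t. G.jcount (t + M)) t = G.jmult) sequentially"
    unfolding fdiff_funpow_shift using G.eventually_jmult by (rule sequentially_offset)
  then have "(\<lambda>t. G.jcount (t + M) / real t ^ card V) \<longlonglongrightarrow> G.jmult / fact (card V)"
    by (rule tendsto_of_fdiff_funpow)
  ultimately have "H.jmult / fact (card V) \<le> G.jmult / fact (card V)"
    by (rule LIMSEQ_le) (use le in \<open>auto intro!: divide_right_mono\<close>)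
  then show ?thesis by (simp add: divide_le_cancel)
qed

section \<open>Monomial ideals in the local polynomial ring\<close>

text \<open>The linear span of the monomials with exponents in \<open>U\<close>; for an up-set this
  is a monomial ideal, for a finite set a space of finite dimension. Both uses occur.\<close>

definition polys_on :: "('v \<Rightarrow>\<^sub>0 nat) set \<Rightarrow> ('v, 'k::field) mpoly set"
  where "polys_on U = {p. keys p \<subseteq> U}"

lemma polys_on_mono: "U \<subseteq> U' \<Longrightarrow> polys_on U \<subseteq> polys_on U'"
  by (auto simp: polys_on_def)

lemma polys_on_add: "p \<in> polys_on U \<Longrightarrow> p' \<in> polys_on U \<Longrightarrow> p + p' \<in> polys_on U"
  using keys_add[of p p'] by (auto simp: polys_on_def)

lemma polys_on_zero [simp]: "0 \<in> polys_on U"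
  by (simp add: polys_on_def)

lemma polys_on_uminus: "p \<in> polys_on U \<Longrightarrow> - p \<in> polys_on U"
  by (simp add: polys_on_def in_keys_iff subset_iff)

lemma polys_on_sum: "(\<And>i. i \<in> A \<Longrightarrow> f i \<in> polys_on U) \<Longrightarrow> (\<Sum>i\<in>A. f i) \<in> polys_on U"
  by (induction A rule: infinite_finite_induct) (auto intro: polys_on_add)

lemma polys_on_single: "u \<in> U \<Longrightarrow> single u c \<in> polys_on U"
  by (simp add: polys_on_def)

lemma polys_on_mult:
  assumes "p \<in> polys_on U" "p' \<in> polys_on U'" "\<And>u u'. u \<in> U \<Longrightarrow> u' \<in> U' \<Longrightarrow> u + u' \<in> W"
  shows "p * p' \<in> polys_on W"
  using keys_mult[of p p'] assms by (fastforce simp: polys_on_def)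

lemma polys_on_empty [simp]: "polys_on {} = {0}"
  by (auto simp: polys_on_def)

lemma poly_eq_sum_single: "p = (\<Sum>u\<in>keys p. single u (lookup p u))"
  by (rule poly_mapping_eqI) (auto simp: lookup_sum lookup_single when_def in_keys_iff)

lemma polys_on_induct [consumes 1, case_names zero add single]:
  assumes "p \<in> polys_on U" "P 0" "\<And>p p'. p \<in> polys_on U \<Longrightarrow> p' \<in> polys_on U \<Longrightarrow> P p \<Longrightarrow> P p' \<Longrightarrow> P (p + p')"
    "\<And>u c. u \<in> U \<Longrightarrow> P (single u c)"
  shows "P p"
proof -
  have "P (\<Sum>u\<in>A. single u (lookup p u))" if "finite A" "A \<subseteq> U" for A
    using that
  proof (induction A)
    case (insert u A)
    then have "(\<Sum>u\<in>A. single u (lookup p u)) \<in> polys_on U" by (intro polys_on_sum polys_on_single) auto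
    with insert show ?case using assms(3)[OF polys_on_single[of u U "lookup p u"]] assms(4)[of u] by auto
  qed (simp add: assms(2))
  from this[of "keys p"] assms(1) show ?thesis by (simp add: polys_on_def flip: poly_eq_sum_single)
qed

lemma lookup_const_mult: "lookup (single 0 c * p) u = c * lookup p u"
  by (simp add: Poly_Mapping.map.rep_eq when_def flip: mult_map_scale_conv_mult)

lemma lookup_single_mult: "lookup (single w c * p) (w + u) = c * lookup (p :: ('v, 'k::field) mpoly) u"
proof -
  have "(\<Sum>l. lookup (single w c) l * (\<Sum>q. lookup p q when w + u = l + q)) =
      (\<Sum>l. (c * (\<Sum>q. lookup p q when w + u = l + q)) when w = l)"
    by (rule Sum_any.cong) (simp add: lookup_single when_mult)
  also have "\<dots> = c * (\<Sum>q. lookup p q when w + u = w + q)" by simp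
  also have "\<dots> = c * lookup p u" by simp
  finally show ?thesis by (simp add: lookup_mult)
qed

text \<open>0 is a sum of exponent vectors only as 0 + 0. Consequently nonzero constant terms are
  preserved by products.\<close>

lemma lookup_mult_zero: "lookup (p * p') 0 = lookup p 0 * lookup (p' :: ('v, 'k::field) mpoly) 0"
proof -
  define r where "r = p - single 0 (lookup p 0)"
  have p: "p = single 0 (lookup p 0) + r" by (simp add: r_def)
  have "lookup (r * p') 0 = 0"
  proof (rule ccontr)
    assume "lookup (r * p') 0 \<noteq> 0"
    then obtain a b where "a \<in> keys r" "0 = a + b" using keys_mult[of r p'] by (auto simp: in_keys_iff)
    then have "mdeg a = 0" by (metis add_is_0 mdeg_add mdeg_zero)
    with \<open>a \<in> keys r\<close> show False by (simp add: r_def in_keys_iff lookup_minus)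
  qed
  then show ?thesis by (subst (1) p) (simp add: distrib_right lookup_add lookup_const_mult)
qed

text \<open>A polynomial with nonzero constant term is a nonzerodivisor modulo a monomial ideal: at
  an exponent \<open>u\<close> of \<open>p\<close> outside \<open>U\<close> of least degree, the
  other terms of \<open>s\<close> meet only exponents inside \<open>U\<close>, so the coefficient of
  \<open>s * p\<close> is \<open>lookup s 0 * lookup p u\<close>. For empty \<open>U\<close> this is
  cancellation in the polynomial ring.\<close>

lemma polys_on_cancel:
  fixes p s :: "('v, 'k::field) mpoly"
  assumes U: "upset V U" and s: "s \<in> polys_on (expvecs V)" "lookup s 0 \<noteq> 0" and sp: "s * p \<in> polys_on U"
  shows "p \<in> polys_on U"
proof (rule ccontr)
  assume "p \<notin> polys_on U"
  then have "\<exists>u. u \<in> keys p \<and> u \<notin> U" by (auto simp: polys_on_def)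
  then obtain u where u: "u \<in> keys p" "u \<notin> U" and min: "\<And>u'. u' \<in> keys p \<Longrightarrow> u' \<notin> U \<Longrightarrow> mdeg u \<le> mdeg u'"
    using ex_has_least_nat[of "\<lambda>u. u \<in> keys p \<and> u \<notin> U" _ mdeg] by blast
  define r where "r = s - single 0 (lookup s 0)"
  have s_eq: "s = single 0 (lookup s 0) + r" by (simp add: r_def)
  have "lookup (r * p) u = 0"
  proof (rule ccontr)
    assume "lookup (r * p) u \<noteq> 0"
    then obtain a b where ab: "a \<in> keys r" "b \<in> keys p" "u = a + b"
      using keys_mult[of r p] by (auto simp: in_keys_iff)
    have "a \<noteq> 0" using ab(1) by (auto simp: r_def in_keys_iff lookup_minus)
    then have "mdeg b < mdeg u" using ab(3) by (simp add: mdeg_add)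
    then have "b \<in> U" using min ab(2) by force
    moreover have "a \<in> expvecs V"
      using ab(1) s(1) by (cases "a = 0") (auto simp: r_def in_keys_iff lookup_minus lookup_single polys_on_def subset_iff)
    ultimately have "u \<in> U" using U ab(3) by (auto simp: upset_def add.commute)
    with u show False by simp
  qed
  then have "lookup (s * p) u = lookup s 0 * lookup p u"
    by (subst (1) s_eq) (simp add: distrib_right lookup_add lookup_const_mult)
  also have "\<dots> \<noteq> 0" using s(2) u(1) by (simp add: in_keys_iff)
  finally have "u \<in> keys (s * p)" by (simp add: in_keys_iff)
  with sp u(2) show False by (auto simp: polys_on_def)
qed

lemma upset_empty [simp]: "upset V {}"
  by (simp add: upset_def)

lemma upset_expvecs [simp]: "upset V (expvecs V)"
  by (simp add: upset_def)

locale local_mpoly =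
  fixes V :: "'v set" and K :: "'k::field itself"
  assumes finite_V: "finite V"
begin

abbreviation R :: "('v, 'k) mpoly ring" where "R \<equiv> mpoly_ring V"

definition den :: "('v, 'k) mpoly set"
  where "den = carrier R - var_ideal V"

definition L :: "(('v, 'k) mpoly \<times> ('v, 'k) mpoly) set ring"
  where "L = localization R den"

abbreviation frac where "frac \<equiv> loc_frac R den"

lemma carrier_R: "carrier R = polys_on (expvecs V)"
  by (auto simp: mpoly_ring_def polys_on_def expvecs_def)

lemma R_simps [simp]:
  "p \<otimes>\<^bsub>R\<^esub> p' = p * p'" "p \<oplus>\<^bsub>R\<^esub> p' = p + p'" "\<one>\<^bsub>R\<^esub> = 1" "\<zero>\<^bsub>R\<^esub> = 0"
  by (simp_all add: mpoly_ring_def)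

lemma R_closed:
  "1 \<in> carrier R" "0 \<in> carrier R"
  "p \<in> carrier R \<Longrightarrow> p' \<in> carrier R \<Longrightarrow> p * p' \<in> carrier R"
  "p \<in> carrier R \<Longrightarrow> p' \<in> carrier R \<Longrightarrow> p + p' \<in> carrier R"
  "p \<in> carrier R \<Longrightarrow> - p \<in> carrier R"
proof -
  show "1 \<in> carrier R" "0 \<in> carrier R" by (simp_all add: carrier_R polys_on_def)
  show "p \<in> carrier R \<Longrightarrow> p' \<in> carrier R \<Longrightarrow> p * p' \<in> carrier R"
    unfolding carrier_R by (erule (1) polys_on_mult) simp
  show "p \<in> carrier R \<Longrightarrow> p' \<in> carrier R \<Longrightarrow> p + p' \<in> carrier R"
    unfolding carrier_R by (rule polys_on_add)
  show "p \<in> carrier R \<Longrightarrow> - p \<in> carrier R"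
    unfolding carrier_R by (rule polys_on_uminus)
qed

lemma cring_R: "cring R"
proof (rule cringI)
  show "abelian_group R"
  proof (rule abelian_groupI)
    show "\<exists>y\<in>carrier R. y \<oplus>\<^bsub>R\<^esub> x = \<zero>\<^bsub>R\<^esub>" if "x \<in> carrier R" for x
      using R_closed(5)[OF that] by (intro bexI[of _ "- x"]) auto
  qed (auto intro: R_closed)
  show "comm_monoid R" by (rule comm_monoidI) (auto intro: R_closed simp: ac_simps)
qed (simp add: algebra_simps)

lemma R_uminus:
  assumes "p \<in> carrier R" shows "\<ominus>\<^bsub>R\<^esub> p = - p"
proof -
  interpret cring R by (rule cring_R)
  show ?thesis using assms by (intro minus_equality) (auto intro: R_closed)
qed

text \<open>Turns membership in \<open>den\<close> into a condition on one coefficient, the constant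
  term.\<close>

lemma var_ideal_eq: "var_ideal V = (polys_on (expvecs V - {0}) :: ('v, 'k) mpoly set)"
proof
  interpret cring R by (rule cring_R)
  have Var_in: "Var ` V \<subseteq> (polys_on (expvecs V - {0}) :: ('v, 'k) mpoly set)"
    by (auto simp: Var_def polys_on_def expvecs_def)
  have nz: "u + w \<in> expvecs V - {0}" if "u \<in> expvecs V - {0}" "w \<in> expvecs V" for u w
  proof -
    have "mdeg (u + w) \<noteq> 0" using that by (simp add: mdeg_add)
    then have "u + w \<noteq> 0" by auto
    then show ?thesis using that by simp
  qed
  let ?J = "polys_on (expvecs V - {0}) :: ('v, 'k) mpoly set"
  have mul: "p * r \<in> ?J" if "p \<in> ?J" "r \<in> carrier R" for p r
    using that unfolding carrier_R by (rule polys_on_mult) (rule nz)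
  have "ideal ?J R"
  proof (rule idealI[OF ring_axioms])
    show "subgroup ?J (add_monoid R)"
    proof (rule add.subgroupI)
      have sub: "?J \<subseteq> carrier R" unfolding carrier_R by (rule polys_on_mono) auto
      then show "?J \<subseteq> carrier R" .
      show "?J \<noteq> {}" using polys_on_zero by blast
      show "\<ominus>\<^bsub>R\<^esub> p \<in> ?J" if "p \<in> ?J" for p
        using that sub polys_on_uminus[OF that] R_uminus[of p] by auto
    qed (auto intro: polys_on_add)
  qed (use mul in \<open>auto simp: mult.commute\<close>)
  then show "var_ideal V \<subseteq> (polys_on (expvecs V - {0}) :: ('v, 'k) mpoly set)"
    unfolding var_ideal_def by (rule genideal_minimal[OF _ Var_in])
  show "(polys_on (expvecs V - {0}) :: ('v, 'k) mpoly set) \<subseteq> var_ideal V"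
  proof
    interpret I: ideal "var_ideal V" R unfolding var_ideal_def
      using Var_in polys_on_mono[of "expvecs V - {0}" "expvecs V"] by (intro genideal_ideal) (auto simp: carrier_R)
    fix p :: "('v, 'k) mpoly" assume "p \<in> polys_on (expvecs V - {0})"
    then show "p \<in> var_ideal V"
    proof (induction rule: polys_on_induct)
      case zero
      then show ?case using I.zero_closed by simp
    next
      case (add p p')
      then show ?case using I.a_closed[of p p'] by simp
    next
      case (single u c)
      then obtain t where "mdeg u = Suc t" by (cases "mdeg u") auto
      with single obtain v w where vw: "v \<in> V" "w \<in> expvecs V" "u = w + single v 1"
        by (auto elim: expvecs_Suc_decomp)
      have "Var ` V \<subseteq> (var_ideal V :: ('v, 'k) mpoly set)" unfolding var_ideal_def
        using Var_in polys_on_mono[of "expvecs V - {0}" "expvecs V"] by (intro genideal_self) (auto simp: carrier_R)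
      then have "single w c \<otimes>\<^bsub>R\<^esub> Var v \<in> var_ideal V"
        using vw by (intro I.I_l_closed) (auto simp: carrier_R intro: polys_on_single)
      then show ?case by (simp add: Var_def mult_single vw(3))
    qed
  qed
qed

lemma den_iff: "s \<in> den \<longleftrightarrow> s \<in> carrier R \<and> lookup s 0 \<noteq> 0"
  by (auto simp: den_def var_ideal_eq carrier_R polys_on_def in_keys_iff)

lemma den_carrier: "s \<in> den \<Longrightarrow> s \<in> carrier R"
  by (simp add: den_iff)

lemma den_mult: "s \<in> den \<Longrightarrow> t \<in> den \<Longrightarrow> s * t \<in> den"
  by (simp add: den_iff R_closed lookup_mult_zero)

lemma den_one: "1 \<in> den"
  by (simp add: den_iff R_closed)

lemma den_cancel:
  assumes "upset V U" "s \<in> den" "s * p \<in> polys_on U"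
  shows "p \<in> polys_on U"
  using polys_on_cancel[OF assms(1) _ _ assms(3)] assms(2) by (simp add: den_iff carrier_R)

lemma den_mult_cancel: "s \<in> den \<Longrightarrow> s * p = s * p' \<Longrightarrow> p = p'"
  using den_cancel[of "{}" s "p - p'"] by (simp add: right_diff_distrib)

text \<open>Denominators can be cancelled, so the auxiliary factor in \<open>loc_rel\<close>
  disappears.\<close>

lemma loc_rel_iff: "((a, s), (b, t)) \<in> loc_rel R den \<longleftrightarrow>
    a \<in> carrier R \<and> b \<in> carrier R \<and> s \<in> den \<and> t \<in> den \<and> a * t = b * s"
proof -
  have "(\<exists>u\<in>den. u * (a * t) = u * (b * s)) \<longleftrightarrow> a * t = b * s"
  proof
    assume "\<exists>u\<in>den. u * (a * t) = u * (b * s)"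
    then obtain u where "u \<in> den" "u * (a * t) = u * (b * s)" by (elim bexE)
    then show "a * t = b * s" by (rule den_mult_cancel)
  next
    assume "a * t = b * s"
    then show "\<exists>u\<in>den. u * (a * t) = u * (b * s)" by (intro bexI[OF _ den_one]) (simp only:)
  qed
  then show ?thesis unfolding loc_rel_def by simp
qed

lemma frac_eq_set: "a \<in> carrier R \<Longrightarrow> s \<in> den \<Longrightarrow> frac a s = {(b, t). b \<in> carrier R \<and> t \<in> den \<and> a * t = b * s}"
  by (auto simp: loc_frac_def loc_rel_iff)

lemma frac_eq_iff:
  assumes "a \<in> carrier R" "s \<in> den" "b \<in> carrier R" "t \<in> den"
  shows "frac a s = frac b t \<longleftrightarrow> a * t = b * s"
proof
  assume "frac a s = frac b t"
  moreover have "(b, t) \<in> frac b t" using assms by (simp add: frac_eq_set)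
  ultimately have "(b, t) \<in> frac a s" by simp
  then show "a * t = b * s" using assms by (simp add: frac_eq_set)
next
  assume eq: "a * t = b * s"
  have "a * r = c * s \<longleftrightarrow> b * r = c * t" if "c \<in> carrier R" "r \<in> den" for c r
  proof
    assume "a * r = c * s"
    then have *: "a * r = c * s" .
    have "s * (b * r) = (b * s) * r" by (simp add: ac_simps)
    also have "\<dots> = (a * r) * t" by (simp add: ac_simps flip: eq)
    also have "\<dots> = s * (c * t)" by (simp add: ac_simps *)
    finally show "b * r = c * t" by (rule den_mult_cancel[OF assms(2)])
  next
    assume "b * r = c * t"
    then have *: "b * r = c * t" .
    have "t * (a * r) = (a * t) * r" by (simp add: ac_simps)
    also have "\<dots> = (b * r) * s" by (simp add: ac_simps eq)
    also have "\<dots> = t * (c * s)" by (simp add: ac_simps *)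
    finally show "a * r = c * s" by (rule den_mult_cancel[OF assms(4)])
  qed
  then show "frac a s = frac b t" using assms by (auto simp: frac_eq_set)
qed

lemma frac_self: "a \<in> carrier R \<Longrightarrow> s \<in> den \<Longrightarrow> (a, s) \<in> frac a s"
  by (simp add: frac_eq_set)

lemma L_carrierE:
  assumes "x \<in> carrier L"
  obtains a s where "a \<in> carrier R" "s \<in> den" "x = frac a s"
  using assms by (auto simp: L_def localization_def quotient_def loc_frac_def)

lemma frac_carrier [simp]: "a \<in> carrier R \<Longrightarrow> s \<in> den \<Longrightarrow> frac a s \<in> carrier L"
  by (auto simp: L_def localization_def quotient_def loc_frac_def)

text \<open>Evaluates the unions over representatives in \<open>localization\<close> once the result
  is known not to depend on them.\<close>

lemma UN_frac_const:
  assumes "a \<in> carrier R" "s \<in> den" "b \<in> carrier R" "t \<in> den"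
    and "\<And>a' s' b' t'. (a', s') \<in> frac a s \<Longrightarrow> (b', t') \<in> frac b t \<Longrightarrow> F a' s' b' t' = F a s b t"
  shows "(\<Union>(a', s')\<in>frac a s. \<Union>(b', t')\<in>frac b t. F a' s' b' t') = F a s b t"
proof -
  have UN: "(\<Union>x\<in>B. G x) = c" if "b \<in> B" "\<And>x. x \<in> B \<Longrightarrow> G x = c" for B b c and G :: "_ \<Rightarrow> _ set"
    using that by auto
  show ?thesis
    by (rule UN[OF frac_self[OF assms(1,2)]], clarify, rule UN[OF frac_self[OF assms(3,4)]], clarify, rule assms(5))
qed

lemma frac_mult:
  assumes "a \<in> carrier R" "s \<in> den" "b \<in> carrier R" "t \<in> den"
  shows "frac a s \<otimes>\<^bsub>L\<^esub> frac b t = frac (a * b) (s * t)"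
proof -
  have "frac a s \<otimes>\<^bsub>L\<^esub> frac b t = (\<Union>(a', s')\<in>frac a s. \<Union>(b', t')\<in>frac b t. frac (a' * b') (s' * t'))"
    by (simp add: L_def localization_def)
  also have "\<dots> = frac (a * b) (s * t)"
  proof (rule UN_frac_const[OF assms])
    fix a' s' b' t' assume *: "(a', s') \<in> frac a s" "(b', t') \<in> frac b t"
    then have e: "a * s' = a' * s" "b * t' = b' * t" using assms by (auto simp: frac_eq_set)
    have "a' * b' * (s * t) = (a' * s) * (b' * t)" by (simp add: algebra_simps)
    also have "\<dots> = a * b * (s' * t')" unfolding e[symmetric] by (simp add: algebra_simps)
    finally show "frac (a' * b') (s' * t') = frac (a * b) (s * t)"
      using * assms by (subst frac_eq_iff) (auto simp: frac_eq_set R_closed den_mult)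
  qed
  finally show ?thesis .
qed

lemma frac_add:
  assumes "a \<in> carrier R" "s \<in> den" "b \<in> carrier R" "t \<in> den"
  shows "frac a s \<oplus>\<^bsub>L\<^esub> frac b t = frac (a * t + b * s) (s * t)"
proof -
  have "frac a s \<oplus>\<^bsub>L\<^esub> frac b t = (\<Union>(a', s')\<in>frac a s. \<Union>(b', t')\<in>frac b t. frac (a' * t' + b' * s') (s' * t'))"
    by (simp add: L_def localization_def)
  also have "\<dots> = frac (a * t + b * s) (s * t)"
  proof (rule UN_frac_const[OF assms])
    fix a' s' b' t' assume *: "(a', s') \<in> frac a s" "(b', t') \<in> frac b t"
    then have e: "a * s' = a' * s" "b * t' = b' * t" using assms by (auto simp: frac_eq_set)
    have "(a' * t' + b' * s') * (s * t) = (a' * s) * (t * t') + (b' * t) * (s * s')" by (simp add: algebra_simps)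
    also have "\<dots> = (a * t + b * s) * (s' * t')" unfolding e[symmetric] by (simp add: algebra_simps)
    finally show "frac (a' * t' + b' * s') (s' * t') = frac (a * t + b * s) (s * t)"
      using * assms by (subst frac_eq_iff) (auto simp: frac_eq_set R_closed den_mult den_carrier)
  qed
  finally show ?thesis .
qed

lemma L_one: "\<one>\<^bsub>L\<^esub> = frac 1 1"
  by (simp add: L_def localization_def)

lemma L_zero: "\<zero>\<^bsub>L\<^esub> = frac 0 1"
  by (simp add: L_def localization_def)

lemma frac_add_same: "a \<in> carrier R \<Longrightarrow> b \<in> carrier R \<Longrightarrow> s \<in> den \<Longrightarrow> frac a s \<oplus>\<^bsub>L\<^esub> frac b s = frac (a + b) s"
  by (simp add: frac_add frac_eq_iff R_closed den_mult den_carrier algebra_simps)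

lemma frac_zero: "s \<in> den \<Longrightarrow> frac 0 s = \<zero>\<^bsub>L\<^esub>"
  by (simp add: L_zero frac_eq_iff R_closed den_one)

lemmas frac_closed = R_closed den_mult den_one den_carrier

lemma cring_L: "cring L"
proof (rule cringI)
  show "abelian_group L"
  proof (rule abelian_groupI)
    fix x y assume "x \<in> carrier L" "y \<in> carrier L"
    then obtain a s b t where x: "a \<in> carrier R" "s \<in> den" "x = frac a s" and y: "b \<in> carrier R" "t \<in> den" "y = frac b t"
      by (metis L_carrierE)
    show "x \<oplus>\<^bsub>L\<^esub> y \<in> carrier L" using x y by (simp add: frac_add frac_closed)
    show "x \<oplus>\<^bsub>L\<^esub> y = y \<oplus>\<^bsub>L\<^esub> x" using x y by (simp add: frac_add ac_simps)
    fix z assume "z \<in> carrier L"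
    then obtain c r where z: "c \<in> carrier R" "r \<in> den" "z = frac c r" by (rule L_carrierE)
    show "x \<oplus>\<^bsub>L\<^esub> y \<oplus>\<^bsub>L\<^esub> z = x \<oplus>\<^bsub>L\<^esub> (y \<oplus>\<^bsub>L\<^esub> z)"
      using x y z by (simp add: frac_add frac_closed) (simp add: algebra_simps)
  next
    fix x assume "x \<in> carrier L"
    then obtain a s where x: "a \<in> carrier R" "s \<in> den" "x = frac a s" by (rule L_carrierE)
    show "\<zero>\<^bsub>L\<^esub> \<oplus>\<^bsub>L\<^esub> x = x" using x by (simp add: L_zero frac_add frac_closed)
    show "\<exists>y\<in>carrier L. y \<oplus>\<^bsub>L\<^esub> x = \<zero>\<^bsub>L\<^esub>"
      using x by (intro bexI[of _ "frac (- a) s"]) (auto simp: frac_add_same frac_closed frac_zero)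
  qed (simp add: L_zero frac_closed)
  show "comm_monoid L"
  proof (rule comm_monoidI)
    fix x y assume "x \<in> carrier L" "y \<in> carrier L"
    then obtain a s b t where x: "a \<in> carrier R" "s \<in> den" "x = frac a s" and y: "b \<in> carrier R" "t \<in> den" "y = frac b t"
      by (metis L_carrierE)
    show "x \<otimes>\<^bsub>L\<^esub> y \<in> carrier L" using x y by (simp add: frac_mult frac_closed)
    show "x \<otimes>\<^bsub>L\<^esub> y = y \<otimes>\<^bsub>L\<^esub> x" using x y by (simp add: frac_mult ac_simps)
    fix z assume "z \<in> carrier L"
    then obtain c r where z: "c \<in> carrier R" "r \<in> den" "z = frac c r" by (rule L_carrierE)
    show "x \<otimes>\<^bsub>L\<^esub> y \<otimes>\<^bsub>L\<^esub> z = x \<otimes>\<^bsub>L\<^esub> (y \<otimes>\<^bsub>L\<^esub> z)"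
      using x y z by (simp add: frac_mult frac_closed ac_simps)
  next
    fix x assume "x \<in> carrier L"
    then obtain a s where x: "a \<in> carrier R" "s \<in> den" "x = frac a s" by (rule L_carrierE)
    show "\<one>\<^bsub>L\<^esub> \<otimes>\<^bsub>L\<^esub> x = x" using x by (simp add: L_one frac_mult frac_closed)
  qed (simp add: L_one frac_closed)
next
  fix x y z assume "x \<in> carrier L" "y \<in> carrier L" "z \<in> carrier L"
  then obtain a s b t c r where x: "a \<in> carrier R" "s \<in> den" "x = frac a s" and y: "b \<in> carrier R" "t \<in> den" "y = frac b t"
    and z: "c \<in> carrier R" "r \<in> den" "z = frac c r"
    by (metis L_carrierE)
  show "(x \<oplus>\<^bsub>L\<^esub> y) \<otimes>\<^bsub>L\<^esub> z = x \<otimes>\<^bsub>L\<^esub> z \<oplus>\<^bsub>L\<^esub> y \<otimes>\<^bsub>L\<^esub> z"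
    using x y z by (simp add: frac_add frac_mult frac_closed frac_eq_iff) (simp add: algebra_simps)
qed

sublocale L: cring L by (rule cring_L)

lemma frac_uminus: "a \<in> carrier R \<Longrightarrow> s \<in> den \<Longrightarrow> \<ominus>\<^bsub>L\<^esub> frac a s = frac (- a) s"
  by (rule L.minus_equality[symmetric, symmetric]) (auto simp: frac_add_same frac_closed frac_zero)

section \<open>Monomial ideals extended to the local ring\<close>

definition Loc :: "('v \<Rightarrow>\<^sub>0 nat) set \<Rightarrow> (('v, 'k) mpoly \<times> ('v, 'k) mpoly) set set"
  where "Loc U = {frac a s | a s. a \<in> polys_on U \<and> s \<in> den}"

lemma upset_carrier: "upset V U \<Longrightarrow> p \<in> polys_on U \<Longrightarrow> p \<in> carrier R"
  using polys_on_mono[of U "expvecs V"] by (auto simp: carrier_R upset_def)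

lemma upset_mult: "upset V U \<Longrightarrow> p \<in> polys_on U \<Longrightarrow> r \<in> carrier R \<Longrightarrow> p * r \<in> polys_on U"
  by (auto simp: carrier_R upset_def intro: polys_on_mult)

lemma frac_in_Loc: "a \<in> polys_on U \<Longrightarrow> s \<in> den \<Longrightarrow> frac a s \<in> Loc U"
  by (auto simp: Loc_def)

lemma LocE:
  assumes "x \<in> Loc U" "upset V U"
  obtains a s where "a \<in> polys_on U" "a \<in> carrier R" "s \<in> den" "x = frac a s"
  using assms upset_carrier by (auto simp: Loc_def)

text \<open>Since denominators are nonzerodivisors modulo monomial ideals, membership can be read
  off the numerator of any representative.\<close>

lemma frac_in_Loc_iff:
  assumes "upset V U" "a \<in> carrier R" "s \<in> den"
  shows "frac a s \<in> Loc U \<longleftrightarrow> a \<in> polys_on U"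
proof
  assume "frac a s \<in> Loc U"
  then obtain b t where b: "b \<in> polys_on U" "b \<in> carrier R" "t \<in> den" "frac a s = frac b t" using assms(1) by (rule LocE)
  then have "t * a = b * s" using assms by (simp add: frac_eq_iff mult.commute)
  then have "t * a \<in> polys_on U" using b assms by (simp add: upset_mult den_carrier)
  then show "a \<in> polys_on U" by (rule den_cancel[OF assms(1) b(3)])
qed (use assms frac_in_Loc in auto)

lemma Loc_mono: "U \<subseteq> U' \<Longrightarrow> Loc U \<subseteq> Loc U'"
  using polys_on_mono[of U U'] unfolding Loc_def by blast

lemma Loc_expvecs: "Loc (expvecs V) = carrier L"
proof
  show "Loc (expvecs V) \<subseteq> carrier L" by (auto simp: Loc_def carrier_R)
  show "carrier L \<subseteq> Loc (expvecs V)"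
    by (rule subsetI, erule L_carrierE) (auto simp: Loc_def carrier_R)
qed

lemma Loc_subset: "upset V U \<Longrightarrow> Loc U \<subseteq> carrier L"
  using Loc_mono[of U "expvecs V"] by (simp add: Loc_expvecs upset_def)

lemma Loc_add: assumes "upset V U" "x \<in> Loc U" "y \<in> Loc U" shows "x \<oplus>\<^bsub>L\<^esub> y \<in> Loc U"
proof -
  from assms obtain a s b t where *: "a \<in> polys_on U" "a \<in> carrier R" "s \<in> den" "x = frac a s"
      "b \<in> polys_on U" "b \<in> carrier R" "t \<in> den" "y = frac b t" by (metis LocE)
  then have "a * t + b * s \<in> polys_on U" using assms(1) by (intro polys_on_add upset_mult) (auto simp: den_carrier)
  with * show ?thesis by (simp add: frac_add frac_in_Loc den_mult)
qed

lemma Loc_smult: assumes "upset V U" "x \<in> Loc U" "y \<in> carrier L" shows "y \<otimes>\<^bsub>L\<^esub> x \<in> Loc U"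
proof -
  from assms(2,1) obtain a s where *: "a \<in> polys_on U" "a \<in> carrier R" "s \<in> den" "x = frac a s" by (rule LocE)
  from assms(3) obtain b t where y: "b \<in> carrier R" "t \<in> den" "y = frac b t" by (rule L_carrierE)
  have "b * a \<in> polys_on U" using upset_mult[OF assms(1) *(1) y(1)] by (simp add: mult.commute)
  with * y show ?thesis by (simp add: frac_mult frac_in_Loc den_mult)
qed

lemma Loc_uminus: assumes "upset V U" "x \<in> Loc U" shows "\<ominus>\<^bsub>L\<^esub> x \<in> Loc U"
proof -
  from assms(2,1) obtain a s where *: "a \<in> polys_on U" "a \<in> carrier R" "s \<in> den" "x = frac a s" by (rule LocE)
  then show ?thesis by (simp add: frac_uminus frac_in_Loc polys_on_uminus)
qed

lemma zero_in_Loc: "\<zero>\<^bsub>L\<^esub> \<in> Loc U"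
  unfolding L_zero by (intro frac_in_Loc) (auto simp: den_one)

lemma Loc_ideal: assumes "upset V U" shows "ideal (Loc U) L"
proof (rule idealI[OF L.ring_axioms])
  show "subgroup (Loc U) (add_monoid L)"
    using Loc_subset[OF assms] zero_in_Loc[of U] Loc_add[OF assms] Loc_uminus[OF assms]
    by (intro L.add.subgroupI) (auto simp: a_inv_def)
  fix a x assume a: "a \<in> Loc U" and x: "x \<in> carrier L"
  show "x \<otimes>\<^bsub>L\<^esub> a \<in> Loc U" using Loc_smult[OF assms a x] .
  moreover have "a \<in> carrier L" using a Loc_subset[OF assms] by (rule subsetD[rotated])
  ultimately show "a \<otimes>\<^bsub>L\<^esub> x \<in> Loc U" using L.m_comm[of a x] x by simp
qed

lemma Loc_prod:
  assumes U: "upset V U" and U': "upset V U'"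
  shows "ideal_prod L (Loc U) (Loc U') = Loc {u + u' | u u'. u \<in> U \<and> u' \<in> U'}" (is "_ = Loc ?W")
proof
  have W: "upset V ?W"
    using U U' unfolding upset_def by (auto simp: subset_iff) (metis add.assoc)
  show "ideal_prod L (Loc U) (Loc U') \<subseteq> Loc ?W"
  proof
    fix x assume "x \<in> ideal_prod L (Loc U) (Loc U')"
    then show "x \<in> Loc ?W"
    proof induction
      case (prod i j)
      from prod(1) U obtain a s where a: "a \<in> polys_on U" "a \<in> carrier R" "s \<in> den" "i = frac a s" by (rule LocE)
      from prod(2) U' obtain b t where b: "b \<in> polys_on U'" "b \<in> carrier R" "t \<in> den" "j = frac b t" by (rule LocE)
      have "a * b \<in> polys_on ?W" by (rule polys_on_mult[OF a(1) b(1)]) auto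
      with a b show ?case by (simp add: frac_mult frac_in_Loc den_mult)
    qed (rule Loc_add[OF W])
  qed
  show "Loc ?W \<subseteq> ideal_prod L (Loc U) (Loc U')"
  proof
    fix x assume "x \<in> Loc ?W"
    then obtain p s where p: "p \<in> polys_on ?W" "p \<in> carrier R" "s \<in> den" "x = frac p s" using W by (rule LocE)
    from p(1) have "frac p s \<in> ideal_prod L (Loc U) (Loc U')"
    proof (induction rule: polys_on_induct)
      case zero
      have "\<zero>\<^bsub>L\<^esub> \<otimes>\<^bsub>L\<^esub> \<zero>\<^bsub>L\<^esub> \<in> ideal_prod L (Loc U) (Loc U')" by (intro ideal_prod.prod zero_in_Loc)
      then show ?case using p(3) by (simp add: frac_zero)
    next
      case (add p p')
      then show ?case using ideal_prod.sum[OF add(3,4)] upset_carrier[OF W] p(3) by (simp add: frac_add_same)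
    next
      case (single u c)
      then obtain w w' where w: "u = w + w'" "w \<in> U" "w' \<in> U'" by blast
      have "frac (single w c) s \<otimes>\<^bsub>L\<^esub> frac (single w' 1) 1 \<in> ideal_prod L (Loc U) (Loc U')"
        by (intro ideal_prod.prod frac_in_Loc polys_on_single w p(3) den_one)
      moreover have "single w c \<in> carrier R" "single w' 1 \<in> carrier R"
        using upset_carrier[OF U polys_on_single[OF w(2)]] upset_carrier[OF U' polys_on_single[OF w(3)]] by auto
      ultimately show ?case using p(3) by (simp add: frac_mult den_one mult_single w(1))
    qed
    with p show "x \<in> ideal_prod L (Loc U) (Loc U')" by simp
  qed
qed

lemma genideal_monomials:
  assumes "M \<subseteq> expvecs V"
  shows "Idl\<^bsub>L\<^esub> ((\<lambda>u. frac (single u 1) 1) ` M) = Loc {w + u | w u. w \<in> expvecs V \<and> u \<in> M}" (is "Idl\<^bsub>L\<^esub> ?G = Loc ?W")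
proof
  have W: "upset V ?W" using assms unfolding upset_def by (auto simp: subset_iff) (metis add.assoc add.commute expvecs_add_iff)
  have MW: "M \<subseteq> ?W"
  proof
    fix u assume "u \<in> M"
    then have "u = 0 + u \<and> 0 \<in> expvecs V \<and> u \<in> M" by simp
    then show "u \<in> ?W" by blast
  qed
  have G: "?G \<subseteq> Loc ?W" using MW by (auto intro!: frac_in_Loc polys_on_single den_one)
  then show "Idl\<^bsub>L\<^esub> ?G \<subseteq> Loc ?W" by (intro L.genideal_minimal Loc_ideal[OF W])
  interpret I: ideal "Idl\<^bsub>L\<^esub> ?G" L using G Loc_subset[OF W] by (intro L.genideal_ideal) auto
  have GI: "?G \<subseteq> Idl\<^bsub>L\<^esub> ?G" using G Loc_subset[OF W] by (intro L.genideal_self) auto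
  show "Loc ?W \<subseteq> Idl\<^bsub>L\<^esub> ?G"
  proof
    fix x assume "x \<in> Loc ?W"
    then obtain p s where p: "p \<in> polys_on ?W" "p \<in> carrier R" "s \<in> den" "x = frac p s" using W by (rule LocE)
    from p(1) have "frac p s \<in> Idl\<^bsub>L\<^esub> ?G"
    proof (induction rule: polys_on_induct)
      case zero
      show ?case using p(3) I.zero_closed by (simp add: frac_zero)
    next
      case (add p p')
      then show ?case using I.a_closed[OF add(3,4)] upset_carrier[OF W] p(3) by (simp add: frac_add_same)
    next
      case (single u c)
      then obtain w w' where w: "u = w + w'" "w \<in> expvecs V" "w' \<in> M" by blast
      have car: "single w c \<in> carrier R" "single w' 1 \<in> carrier R"
        using w assms by (auto simp: carrier_R intro!: polys_on_single)
      have "frac (single w c) s \<otimes>\<^bsub>L\<^esub> frac (single w' 1) 1 \<in> Idl\<^bsub>L\<^esub> ?G"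
        using GI w(3) car p(3) by (intro I.I_l_closed) auto
      then show ?case using p(3) car by (simp add: frac_mult den_one mult_single w(1))
    qed
    with p show "x \<in> Idl\<^bsub>L\<^esub> ?G" by simp
  qed
qed

section \<open>The maximal ideal and its powers\<close>

definition deg_ge :: "nat \<Rightarrow> ('v \<Rightarrow>\<^sub>0 nat) set"
  where "deg_ge k = {u \<in> expvecs V. mdeg u \<ge> k}"

lemma upset_deg_ge [simp]: "upset V (deg_ge k)"
  by (auto simp: upset_def deg_ge_def mdeg_add)

lemma frac_unit:
  assumes "a \<in> carrier R" "s \<in> den" "frac a s \<notin> Loc (deg_ge 1)"
  shows "a \<in> den"
proof -
  have "a \<notin> polys_on (deg_ge 1)" using assms frac_in_Loc_iff[OF upset_deg_ge] by simp
  then obtain u where u: "u \<in> keys a" "u \<notin> deg_ge 1" by (auto simp: polys_on_def)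
  then have "u \<in> expvecs V" using assms(1) by (auto simp: carrier_R polys_on_def)
  with u have "u = 0" by (simp add: deg_ge_def not_le)
  with u assms(1) show ?thesis by (simp add: den_iff in_keys_iff)
qed

lemma ideal_eq_carrier:
  assumes "ideal J L" "x \<in> J" "x \<notin> Loc (deg_ge 1)"
  shows "J = carrier L"
proof -
  interpret J: ideal J L by fact
  have "x \<in> carrier L" using assms(2) by (rule J.Icarr)
  then obtain a s where a: "a \<in> carrier R" "s \<in> den" "x = frac a s" by (rule L_carrierE)
  then have "a \<in> den" using frac_unit assms(3) by simp
  then have "frac s a \<otimes>\<^bsub>L\<^esub> x = \<one>\<^bsub>L\<^esub>"
    using a by (simp add: frac_mult L_one frac_eq_iff frac_closed mult.commute)
  moreover have "frac s a \<otimes>\<^bsub>L\<^esub> x \<in> J" using a \<open>a \<in> den\<close> assms(2) by (intro J.I_l_closed) (auto simp: den_carrier)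
  ultimately show ?thesis using J.one_imp_carrier by simp
qed

lemma one_notin_Loc: "\<one>\<^bsub>L\<^esub> \<notin> Loc (deg_ge 1)"
  unfolding L_one by (subst frac_in_Loc_iff[OF upset_deg_ge]) (auto simp: frac_closed polys_on_def deg_ge_def)

text \<open>The description needs uniqueness: a fraction outside \<open>Loc (deg_ge 1)\<close> has a
  numerator with nonzero constant term and is a unit, so every proper ideal lies in
  \<open>Loc (deg_ge 1)\<close>.\<close>

lemma max_ideal_L: "max_ideal L = Loc (deg_ge 1)"
  unfolding max_ideal_def
proof (rule the_equality)
  have ne: "carrier L \<noteq> Loc (deg_ge 1)" using one_notin_Loc L.one_closed by metis
  show "maximalideal (Loc (deg_ge 1)) L"
  proof (rule maximalidealI)
    fix J assume J: "ideal J L" "Loc (deg_ge 1) \<subseteq> J" "J \<subseteq> carrier L"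
    then show "J = Loc (deg_ge 1) \<or> J = carrier L" using ideal_eq_carrier[OF J(1)] by blast
  qed (use Loc_ideal ne in auto)
  fix M assume "maximalideal M L"
  then interpret M: maximalideal M L .
  have "M \<subseteq> Loc (deg_ge 1)" using ideal_eq_carrier[OF M.is_ideal] M.I_notcarr by blast
  then show "M = Loc (deg_ge 1)"
    using M.I_maximal[OF Loc_ideal[OF upset_deg_ge] _ Loc_subset[OF upset_deg_ge]] ne by metis
qed

lemma ideal_power_0: "ideal_power L I 0 = carrier L"
  by (simp add: ideal_power_def nat_pow_def ideals_set_def)

lemma ideal_power_Suc: "ideal_power L I (Suc t) = ideal_prod L (ideal_power L I t) I"
  by (simp add: ideal_power_def nat_pow_def ideals_set_def)

lemma ideal_power_max: "ideal_power L (max_ideal L) k = Loc (deg_ge k)"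
proof (induction k)
  case 0
  have "deg_ge 0 = expvecs V" by (simp add: deg_ge_def)
  then show ?case by (simp add: ideal_power_0 Loc_expvecs)
next
  case (Suc k)
  have "{u + u' | u u'. u \<in> deg_ge k \<and> u' \<in> deg_ge 1} = deg_ge (Suc k)"
  proof (intro equalityI subsetI)
    fix u assume u: "u \<in> deg_ge (Suc k)"
    then obtain t where "mdeg u = Suc t" by (cases "mdeg u") (auto simp: deg_ge_def)
    with u obtain v b where b: "v \<in> V" "b \<in> expvecs V" "mdeg b = t" "u = b + single v 1"
      by (auto simp: deg_ge_def elim: expvecs_Suc_decomp)
    with u \<open>mdeg u = Suc t\<close> have "b \<in> deg_ge k" "single v 1 \<in> deg_ge 1" by (auto simp: deg_ge_def)
    with b(4) show "u \<in> {u + u' | u u'. u \<in> deg_ge k \<and> u' \<in> deg_ge 1}" by blast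
  qed (auto simp: deg_ge_def mdeg_add)
  with Suc show ?case by (simp only: ideal_power_Suc max_ideal_L Loc_prod[OF upset_deg_ge upset_deg_ge])
qed

end

section \<open>Length of the zeroth local cohomology\<close>

definition poly_scale :: "'k::field \<Rightarrow> ('v, 'k) mpoly \<Rightarrow> ('v, 'k) mpoly"
  where "poly_scale c p = single 0 c * p"

lemma lookup_poly_scale [simp]: "lookup (poly_scale c p) u = c * lookup p u"
  by (simp add: poly_scale_def lookup_const_mult)

interpretation pv: vector_space poly_scale
  by unfold_locales (auto intro!: poly_mapping_eqI simp: lookup_add algebra_simps)

lemma poly_scale_single: "poly_scale c (single u d) = single u (c * d)"
  by (simp add: poly_scale_def mult_single)

lemma polys_on_span:
  "(polys_on U :: ('v, 'k::field) mpoly set) \<subseteq> pv.span ((\<lambda>u. single u 1) ` U)"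
proof
  fix p :: "('v, 'k) mpoly" assume "p \<in> polys_on U"
  then show "p \<in> pv.span ((\<lambda>u. single u 1) ` U)"
  proof (induction rule: polys_on_induct)
    case (single u c)
    have "poly_scale c (single u 1) \<in> pv.span ((\<lambda>u. single u 1) ` U)"
      using single by (intro pv.span_scale pv.span_base) auto
    then show ?case by (simp add: poly_scale_single)
  qed (auto intro: pv.span_add pv.span_zero)
qed

text \<open>Each strict step supplies a vector outside the previous subspace; together they are
  \<open>k\<close> independent vectors.\<close>

lemma (in vector_space) subspace_chain_length:
  assumes "\<And>i. i \<le> k \<Longrightarrow> subspace (T i)" "\<And>i. i < k \<Longrightarrow> T i \<subset> T (Suc i)" "T k \<subseteq> span B" "finite B"
  shows "k \<le> card B"
proof -
  have "\<exists>P. finite P \<and> independent P \<and> card P = j \<and> P \<subseteq> T j" if "j \<le> k" for j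
    using that
  proof (induction j)
    case 0
    then show ?case by (intro exI[of _ "{}"]) (simp add: independent_empty)
  next
    case (Suc j)
    then obtain P where P: "finite P" "independent P" "card P = j" "P \<subseteq> T j" by auto
    from assms(2)[of j] Suc.prems obtain x where x: "x \<in> T (Suc j)" "x \<notin> T j" by auto
    have "span P \<subseteq> T j" using P(4) assms(1) Suc.prems by (intro span_minimal) auto
    then have "x \<notin> span P" using x(2) by blast
    then have "independent (insert x P)" "x \<notin> P" using P(2) by (auto simp: independent_insert span_base)
    moreover have "insert x P \<subseteq> T (Suc j)" using x(1) P(4) assms(2)[of j] Suc.prems by auto
    ultimately show ?case using P by (intro exI[of _ "insert x P"]) auto
  qed
  from this[of k] obtain P where P: "independent P" "card P = k" "P \<subseteq> T k" by auto
  then show ?thesis using independent_span_bound[OF assms(4) P(1)] assms(3) by auto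
qed

text \<open>A proper multiple of \<open>u\<close> stays in \<open>B\<close> but has larger degree
  than anything in \<open>B - A\<close>, so it lies in \<open>A\<close>.\<close>

lemma upset_insert_max:
  assumes "upset V A" "upset V B" "A \<subseteq> B" "u \<in> B - A" "\<And>u'. u' \<in> B - A \<Longrightarrow> mdeg u' \<le> mdeg u"
  shows "upset V (insert u A)"
proof -
  have "u + w \<in> insert u A" if "w \<in> expvecs V" for w
  proof (cases "w = 0")
    case False
    then have "mdeg (u + w) > mdeg u" by (simp add: mdeg_add)
    then have "u + w \<notin> B - A" using assms(5) by fastforce
    moreover have "u + w \<in> B" using assms(2,4) that by (auto simp: upset_def)
    ultimately show ?thesis by simp
  qed simp
  moreover have "a + w \<in> A" if "a \<in> A" "w \<in> expvecs V" for a w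
    using assms(1) that by (simp add: upset_def)
  moreover have "insert u A \<subseteq> expvecs V" using assms(1,2,4) by (auto simp: upset_def)
  ultimately show ?thesis unfolding upset_def by blast
qed

lemma upset_chain:
  assumes "upset V A" "upset V B" "A \<subseteq> B" "finite (B - A)" "card (B - A) = f"
  shows "\<exists>J::nat \<Rightarrow> _. (\<forall>i\<le>f. upset V (J i) \<and> A \<subseteq> J i \<and> J i \<subseteq> B) \<and> (\<forall>i<f. J i \<subset> J (Suc i))"
proof -
  \<comment> \<open>The start of the chain is fixed in the induction so that the smaller set can be
    put strictly in front.\<close>
  have "\<exists>J::nat \<Rightarrow> _. J 0 = A \<and> (\<forall>i\<le>f. upset V (J i) \<and> A \<subseteq> J i \<and> J i \<subseteq> B) \<and> (\<forall>i<f. J i \<subset> J (Suc i))"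
    using assms(1,3-5)
  proof (induction f arbitrary: A)
    case 0
    then show ?case by (intro exI[of _ "\<lambda>_. A"]) auto
  next
    case (Suc f)
    have "B - A \<noteq> {}"
    proof
      assume "B - A = {}"
      then have "card (B - A) = 0" by (simp only: card.empty)
      with Suc.prems(4) show False by simp
    qed
    then have "Max (mdeg ` (B - A)) \<in> mdeg ` (B - A)" using Suc.prems(3) by (intro Max_in) auto
    then obtain u where u: "u \<in> B - A" "mdeg u = Max (mdeg ` (B - A))" by force
    have max: "mdeg u' \<le> mdeg u" if "u' \<in> B - A" for u' using that Suc.prems(3) u(2) by simp
    let ?A = "insert u A"
    have up: "upset V ?A" by (rule upset_insert_max[OF Suc.prems(1) assms(2) Suc.prems(2) u(1) max])
    have "B - ?A = (B - A) - {u}" by auto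
    then have "finite (B - ?A)" "card (B - ?A) = f" using Suc.prems u(1) by auto
    moreover have "?A \<subseteq> B" using u(1) Suc.prems(2) by auto
    ultimately obtain J where J: "J 0 = ?A" "\<And>i. i \<le> f \<Longrightarrow> upset V (J i) \<and> ?A \<subseteq> J i \<and> J i \<subseteq> B"
      "\<And>i. i < f \<Longrightarrow> J i \<subset> J (Suc i)" using Suc.IH[OF up] by blast
    define J' where "J' i = (case i of 0 \<Rightarrow> A | Suc i \<Rightarrow> J i)" for i
    show ?case
    proof (intro exI[of _ J'] conjI allI impI)
      fix i
      show "upset V (J' i)" "A \<subseteq> J' i" "J' i \<subseteq> B" if "i \<le> Suc f"
        using that J(2) Suc.prems(1,2) by (auto simp: J'_def split: nat.splits)
      show "J' i \<subset> J' (Suc i)" if "i < Suc f"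
        using that J(1,3) u(1) by (auto simp: J'_def split: nat.splits)
    qed (simp add: J'_def)
  qed
  then show ?thesis by blast
qed

lemma chain_height_eqI:
  assumes "\<exists>C. (\<forall>i\<le>n. C i \<in> F) \<and> (\<forall>i<n. C i \<subset> C (Suc i))"
    and "\<And>C k. (\<And>i. i \<le> k \<Longrightarrow> C i \<in> F) \<Longrightarrow> (\<And>i. i < k \<Longrightarrow> C i \<subset> C (Suc i)) \<Longrightarrow> k \<le> n"
  shows "chain_height F = enat n"
  unfolding chain_height_def
proof (rule antisym)
  show "(SUP k \<in> {k. \<exists>C. (\<forall>i \<le> k. C i \<in> F) \<and> (\<forall>i < k. C i \<subset> C (Suc i))}. enat k) \<le> enat n"
    by (rule SUP_least) (use assms(2) in auto)
  show "enat n \<le> (SUP k \<in> {k. \<exists>C. (\<forall>i \<le> k. C i \<in> F) \<and> (\<forall>i < k. C i \<subset> C (Suc i))}. enat k)"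
    by (rule SUP_upper) (use assms(1) in simp)
qed

context local_mpoly
begin

context
  fixes U0 U1 :: "('v \<Rightarrow>\<^sub>0 nat) set"
  assumes U0: "upset V U0" and U1: "upset V U1" and U1_U0: "U1 \<subseteq> U0"
begin

definition coset :: "(('v, 'k) mpoly \<times> ('v, 'k) mpoly) set \<Rightarrow> (('v, 'k) mpoly \<times> ('v, 'k) mpoly) set set"
  where "coset x = Loc U1 +>\<^bsub>L\<^esub> x"

definition local_coh where
  "local_coh = local_cohomology_0 L (max_ideal L) (quot_module (ideal_module L (Loc U0)) (Loc U1))"

text \<open>For \<open>U0 = Pw t\<close> and \<open>U1 = Pw (Suc t)\<close> this is
  \<open>sat t\<close>.\<close>

definition sat_exps :: "('v \<Rightarrow>\<^sub>0 nat) set"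
  where "sat_exps = {u \<in> U0. \<exists>k. \<forall>w\<in>expvecs V. mdeg w = k \<longrightarrow> u + w \<in> U1}"

lemma coset_eq_iff: "x \<in> carrier L \<Longrightarrow> y \<in> carrier L \<Longrightarrow> coset x = coset y \<longleftrightarrow> x \<ominus>\<^bsub>L\<^esub> y \<in> Loc U1"
  unfolding coset_def using L.quotient_eq_iff_same_a_r_cos[OF Loc_ideal[OF U1]] by simp

lemma coset_zero: "coset \<zero>\<^bsub>L\<^esub> = Loc U1"
  unfolding coset_def by (rule L.a_coset_add_zero[OF Loc_subset[OF U1]])

lemma coset_eq_zero_iff: "x \<in> carrier L \<Longrightarrow> coset x = Loc U1 \<longleftrightarrow> x \<in> Loc U1"
  using coset_eq_iff[of x "\<zero>\<^bsub>L\<^esub>"] by (simp add: coset_zero a_minus_def)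

lemma set_add_cosets: "x \<in> carrier L \<Longrightarrow> y \<in> carrier L \<Longrightarrow> set_add L (coset x) (coset y) = coset (x \<oplus>\<^bsub>L\<^esub> y)"
proof -
  interpret I: ideal "Loc U1" L by (rule Loc_ideal[OF U1])
  show "x \<in> carrier L \<Longrightarrow> y \<in> carrier L \<Longrightarrow> set_add L (coset x) (coset y) = coset (x \<oplus>\<^bsub>L\<^esub> y)"
    unfolding coset_def by (rule I.a_rcos_sum)
qed

lemma ideal_module_simps:
  "set_add (ideal_module L I) = set_add L" "a_r_coset (ideal_module L I) = a_r_coset L"
  "carrier (ideal_module L I) = I" "a \<odot>\<^bsub>ideal_module L I\<^esub> x = a \<otimes>\<^bsub>L\<^esub> x"
  by (auto simp: ideal_module_def set_add_def' a_r_coset_def' fun_eq_iff)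

lemma smult_coset:
  assumes "a \<in> carrier L" "x \<in> carrier L"
  shows "(\<Union>y\<in>coset x. Loc U1 +>\<^bsub>L\<^esub> (a \<otimes>\<^bsub>L\<^esub> y)) = coset (a \<otimes>\<^bsub>L\<^esub> x)"
proof -
  have "Loc U1 +>\<^bsub>L\<^esub> (a \<otimes>\<^bsub>L\<^esub> y) = coset (a \<otimes>\<^bsub>L\<^esub> x)" if "y \<in> coset x" for y
  proof -
    from that obtain h where h: "h \<in> Loc U1" "y = h \<oplus>\<^bsub>L\<^esub> x" by (auto simp: coset_def a_r_coset_def')
    have hL: "h \<in> carrier L" using h(1) Loc_subset[OF U1] by blast
    have "a \<otimes>\<^bsub>L\<^esub> y \<ominus>\<^bsub>L\<^esub> a \<otimes>\<^bsub>L\<^esub> x = a \<otimes>\<^bsub>L\<^esub> h"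
      using assms hL by (simp add: h(2) L.r_distr a_minus_def L.a_assoc L.r_neg)
    then have "a \<otimes>\<^bsub>L\<^esub> y \<ominus>\<^bsub>L\<^esub> a \<otimes>\<^bsub>L\<^esub> x \<in> Loc U1" using Loc_smult[OF U1 h(1) assms(1)] by simp
    then have "coset (a \<otimes>\<^bsub>L\<^esub> y) = coset (a \<otimes>\<^bsub>L\<^esub> x)" using assms hL h(2) by (subst coset_eq_iff) auto
    then show ?thesis by (simp add: coset_def)
  qed
  moreover have "coset x \<noteq> {}" using zero_in_Loc[of U1] by (auto simp: coset_def a_r_coset_def')
  ultimately show ?thesis by auto
qed

lemma local_coh_simps:
  "carrier (add_monoid local_coh) = carrier local_coh" "monoid.mult (add_monoid local_coh) = set_add L"
  "one (add_monoid local_coh) = Loc U1" "add local_coh = set_add L" "ring.zero local_coh = Loc U1"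
  "a \<in> carrier L \<Longrightarrow> x \<in> carrier L \<Longrightarrow> a \<odot>\<^bsub>local_coh\<^esub> coset x = coset (a \<otimes>\<^bsub>L\<^esub> x)"
  by (simp_all add: local_coh_def local_cohomology_0_def quot_module_def ideal_module_simps smult_coset)

lemma single_mult_in_iff:
  fixes p :: "('v, 'k) mpoly"
  shows "single w 1 * p \<in> polys_on U \<longleftrightarrow> (\<forall>u\<in>keys p. w + u \<in> U)"
proof
  assume *: "single w 1 * p \<in> polys_on U"
  show "\<forall>u\<in>keys p. w + u \<in> U"
  proof
    fix u assume "u \<in> keys p"
    then have "lookup (single w 1 * p) (w + u) \<noteq> 0" by (simp add: lookup_single_mult in_keys_iff)
    then show "w + u \<in> U" using * by (auto simp: polys_on_def in_keys_iff)
  qed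
next
  assume "\<forall>u\<in>keys p. w + u \<in> U"
  then show "single w 1 * p \<in> polys_on U"
    by (intro polys_on_mult[of _ "{w}" _ "keys p"]) (auto simp: polys_on_def)
qed

lemma upset_sat_exps: "upset V sat_exps"
proof -
  have "u + v \<in> sat_exps" if u: "u \<in> sat_exps" and v: "v \<in> expvecs V" for u v
  proof -
    from u obtain k where k: "u \<in> U0" "\<And>w. w \<in> expvecs V \<Longrightarrow> mdeg w = k \<Longrightarrow> u + w \<in> U1"
      by (auto simp: sat_exps_def)
    have "u + v + w \<in> U1" if "w \<in> expvecs V" "mdeg w = k" for w
    proof -
      have "u + w + v \<in> U1" using k(2)[OF that] U1 v unfolding upset_def by blast
      then show ?thesis by (simp only: ac_simps)
    qed
    then show ?thesis using k(1) U0 v by (auto simp: sat_exps_def upset_def)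
  qed
  then show ?thesis using U0 by (auto simp: upset_def sat_exps_def)
qed

lemma sat_exps_U0: "sat_exps \<subseteq> U0" and U1_sat_exps: "U1 \<subseteq> sat_exps"
  using U1_U0 U1 by (auto simp: sat_exps_def upset_def)

text \<open>Multiplication by a monomial translates the exponents, so no terms cancel and torsion
  can be tested on each monomial of the numerator separately.\<close>

lemma torsion_iff:
  assumes "p \<in> polys_on U0" "s \<in> den"
  shows "(\<exists>k. \<forall>a\<in>Loc (deg_ge k). a \<otimes>\<^bsub>L\<^esub> frac p s \<in> Loc U1) \<longleftrightarrow> p \<in> polys_on sat_exps"
proof
  have pR: "p \<in> carrier R" using upset_carrier[OF U0 assms(1)] .
  assume "\<exists>k. \<forall>a\<in>Loc (deg_ge k). a \<otimes>\<^bsub>L\<^esub> frac p s \<in> Loc U1"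
  then obtain k where k: "\<And>a. a \<in> Loc (deg_ge k) \<Longrightarrow> a \<otimes>\<^bsub>L\<^esub> frac p s \<in> Loc U1" by blast
  have "u + w \<in> U1" if "u \<in> keys p" "w \<in> expvecs V" "mdeg w = k" for u w
  proof -
    have wR: "single w 1 \<in> carrier R" using that by (simp add: carrier_R polys_on_single)
    have "frac (single w 1) 1 \<in> Loc (deg_ge k)" using that by (intro frac_in_Loc polys_on_single den_one) (auto simp: deg_ge_def)
    from k[OF this] have "frac (single w 1 * p) s \<in> Loc U1" using wR pR assms(2) by (simp add: frac_mult den_one)
    then have "single w 1 * p \<in> polys_on U1" using wR pR assms(2) by (simp add: frac_in_Loc_iff[OF U1] R_closed)
    then show ?thesis using that(1) by (auto simp: single_mult_in_iff add.commute)
  qed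
  then show "p \<in> polys_on sat_exps" using assms(1) by (auto simp: polys_on_def sat_exps_def)
next
  assume p: "p \<in> polys_on sat_exps"
  have pR: "p \<in> carrier R" using upset_carrier[OF U0 assms(1)] .
  have "\<forall>u\<in>keys p. \<exists>k. \<forall>w\<in>expvecs V. mdeg w = k \<longrightarrow> u + w \<in> U1"
    using p by (auto simp: polys_on_def sat_exps_def)
  then obtain k where k: "\<And>u w. u \<in> keys p \<Longrightarrow> w \<in> expvecs V \<Longrightarrow> mdeg w = k u \<Longrightarrow> u + w \<in> U1" by metis
  \<comment> \<open>The sum is a common upper bound of the degrees \<open>k u\<close>, and
    \<open>upset_add_multiple\<close> extends each \<open>k u\<close> to all larger degrees.\<close>
  define k0 where "k0 = (\<Sum>u\<in>keys p. k u)"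
  have "a \<otimes>\<^bsub>L\<^esub> frac p s \<in> Loc U1" if a: "a \<in> Loc (deg_ge k0)" for a
  proof -
    from a upset_deg_ge obtain b t where b: "b \<in> polys_on (deg_ge k0)" "b \<in> carrier R" "t \<in> den" "a = frac b t" by (rule LocE)
    have "b * p \<in> polys_on U1"
    proof (rule polys_on_mult[OF b(1), of p "keys p"])
      fix w u assume w: "w \<in> deg_ge k0" and u: "u \<in> keys p"
      have "k u \<le> k0" unfolding k0_def using u by (intro member_le_sum) auto
      then have "u + w \<in> U1" 
        using w by (intro upset_add_multiple[OF U1 k[OF u]]) (auto simp: deg_ge_def)
      then show "w + u \<in> U1" by (simp add: add.commute)
    qed (simp add: polys_on_def)
    then show ?thesis using b pR assms(2) by (simp add: frac_mult frac_in_Loc den_mult)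
  qed
  then show "\<exists>k. \<forall>a\<in>Loc (deg_ge k). a \<otimes>\<^bsub>L\<^esub> frac p s \<in> Loc U1" by blast
qed

lemma carrier_local_coh: "carrier local_coh = coset ` Loc sat_exps"
proof -
  let ?Q = "quot_module (ideal_module L (Loc U0)) (Loc U1)"
  have "carrier local_coh = {x \<in> coset ` Loc U0. \<exists>k. \<forall>a\<in>Loc (deg_ge k). a \<odot>\<^bsub>?Q\<^esub> x = Loc U1}"
    unfolding local_coh_def local_cohomology_0_def ideal_power_max
    by (simp add: quot_module_def A_RCOSETS_def' ideal_module_simps coset_def image_def Bex_def) blast
  also have "\<dots> = coset ` {x \<in> Loc U0. \<exists>k. \<forall>a\<in>Loc (deg_ge k). a \<otimes>\<^bsub>L\<^esub> x \<in> Loc U1}"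
  proof -
    have "a \<odot>\<^bsub>?Q\<^esub> coset x = Loc U1 \<longleftrightarrow> a \<otimes>\<^bsub>L\<^esub> x \<in> Loc U1" if "x \<in> Loc U0" "a \<in> Loc (deg_ge k)" for a x k
    proof -
      have *: "x \<in> carrier L" "a \<in> carrier L" using that Loc_subset[OF U0] Loc_subset[OF upset_deg_ge] by auto
      then have "a \<odot>\<^bsub>?Q\<^esub> coset x = coset (a \<otimes>\<^bsub>L\<^esub> x)"
        by (simp add: quot_module_def ideal_module_simps smult_coset)
      then show ?thesis using * by (simp add: coset_eq_zero_iff)
    qed
    then show ?thesis by blast
  qed
  also have "{x \<in> Loc U0. \<exists>k. \<forall>a\<in>Loc (deg_ge k). a \<otimes>\<^bsub>L\<^esub> x \<in> Loc U1} = Loc sat_exps"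
  proof (intro equalityI subsetI)
    fix x assume x: "x \<in> {x \<in> Loc U0. \<exists>k. \<forall>a\<in>Loc (deg_ge k). a \<otimes>\<^bsub>L\<^esub> x \<in> Loc U1}"
    then obtain p s where p: "p \<in> polys_on U0" "s \<in> den" "x = frac p s" by (auto simp: Loc_def)
    then have "p \<in> polys_on sat_exps" using torsion_iff x by blast
    then show "x \<in> Loc sat_exps" using p by (simp add: frac_in_Loc)
  next
    fix x assume "x \<in> Loc sat_exps"
    then obtain p s where p: "p \<in> polys_on sat_exps" "s \<in> den" "x = frac p s" by (auto simp: Loc_def)
    moreover have "p \<in> polys_on U0" using p(1) polys_on_mono[OF sat_exps_U0] by blast
    ultimately show "x \<in> {x \<in> Loc U0. \<exists>k. \<forall>a\<in>Loc (deg_ge k). a \<otimes>\<^bsub>L\<^esub> x \<in> Loc U1}"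
      using torsion_iff frac_in_Loc by blast
  qed
  finally show ?thesis .
qed

lemma coset_Loc_submodule:
  assumes J: "upset V J" "U1 \<subseteq> J" "J \<subseteq> sat_exps"
  shows "submodule (coset ` Loc J) L local_coh"
proof (intro submodule.intro subgroup.intro submodule_axioms.intro)
  have JL: "x \<in> carrier L" if "x \<in> Loc J" for x using that Loc_subset[OF J(1)] by blast
  have sL: "x \<in> carrier L" if "x \<in> Loc sat_exps" for x using that Loc_subset[OF upset_sat_exps] by blast
  show "coset ` Loc J \<subseteq> carrier (add_monoid local_coh)"
    unfolding local_coh_simps carrier_local_coh using Loc_mono[OF J(3)] by auto
  show "x \<otimes>\<^bsub>add_monoid local_coh\<^esub> y \<in> coset ` Loc J" if "x \<in> coset ` Loc J" "y \<in> coset ` Loc J" for x y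
    using that JL Loc_add[OF J(1)] unfolding local_coh_simps by (auto simp: set_add_cosets)
  show "\<one>\<^bsub>add_monoid local_coh\<^esub> \<in> coset ` Loc J"
    unfolding local_coh_simps using zero_in_Loc[of J] by (auto simp flip: coset_zero)
  show "a \<odot>\<^bsub>local_coh\<^esub> x \<in> coset ` Loc J" if "a \<in> carrier L" "x \<in> coset ` Loc J" for a x
    using that JL Loc_smult[OF J(1)] by (auto simp: local_coh_simps)
  fix c assume "c \<in> coset ` Loc J"
  then obtain x where x: "x \<in> Loc J" "c = coset x" by blast
  \<comment> \<open>No group structure on \<open>local_coh\<close> has been established, so the
    inverse is obtained from its description, with uniqueness checked in the local ring.\<close>
  have "inv\<^bsub>add_monoid local_coh\<^esub> c = coset (\<ominus>\<^bsub>L\<^esub> x)"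
    unfolding m_inv_def
  proof (rule the_equality)
    have "\<ominus>\<^bsub>L\<^esub> x \<in> Loc sat_exps" using Loc_uminus[OF J(1) x(1)] Loc_mono[OF J(3)] by blast
    then show "coset (\<ominus>\<^bsub>L\<^esub> x) \<in> carrier (add_monoid local_coh) \<and>
        c \<otimes>\<^bsub>add_monoid local_coh\<^esub> coset (\<ominus>\<^bsub>L\<^esub> x) = \<one>\<^bsub>add_monoid local_coh\<^esub> \<and>
        coset (\<ominus>\<^bsub>L\<^esub> x) \<otimes>\<^bsub>add_monoid local_coh\<^esub> c = \<one>\<^bsub>add_monoid local_coh\<^esub>"
      using JL[OF x(1)] unfolding x(2)
      by (simp add: local_coh_simps carrier_local_coh set_add_cosets L.r_neg L.l_neg coset_zero)
    fix d assume d: "d \<in> carrier (add_monoid local_coh) \<and>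
        c \<otimes>\<^bsub>add_monoid local_coh\<^esub> d = \<one>\<^bsub>add_monoid local_coh\<^esub> \<and>
        d \<otimes>\<^bsub>add_monoid local_coh\<^esub> c = \<one>\<^bsub>add_monoid local_coh\<^esub>"
    then obtain y where y: "y \<in> Loc sat_exps" "d = coset y" unfolding local_coh_simps carrier_local_coh by auto
    have "coset (y \<oplus>\<^bsub>L\<^esub> x) = Loc U1" using d JL[OF x(1)] sL[OF y(1)] unfolding local_coh_simps by (simp add: x(2) y(2) set_add_cosets)
    then have "y \<oplus>\<^bsub>L\<^esub> x \<in> Loc U1" using JL[OF x(1)] sL[OF y(1)] by (simp add: coset_eq_zero_iff)
    then show "d = coset (\<ominus>\<^bsub>L\<^esub> x)" using JL[OF x(1)] sL[OF y(1)] by (simp add: y(2) coset_eq_iff a_minus_def)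
  qed
  then show "inv\<^bsub>add_monoid local_coh\<^esub> c \<in> coset ` Loc J" using Loc_uminus[OF J(1) x(1)] by auto
qed

text \<open>A monomial of \<open>J' - J\<close> has a new class: as \<open>U1 \<subseteq> J\<close>,
  sharing a class with an element of \<open>Loc J\<close> would put it into
  \<open>Loc J\<close>.\<close>

lemma coset_Loc_strict:
  assumes "upset V J" "upset V J'" "U1 \<subseteq> J" "J \<subset> J'"
  shows "coset ` Loc J \<subset> coset ` Loc J'"
proof
  show "coset ` Loc J \<subseteq> coset ` Loc J'" using Loc_mono[of J J'] assms(4) by auto
  from assms(4) obtain u where u: "u \<in> J'" "u \<notin> J" by blast
  let ?x = "frac (single u 1) 1"
  have uR: "single u 1 \<in> carrier R" using u(1) assms(2) by (auto intro!: upset_carrier polys_on_single)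
  have xL: "?x \<in> carrier L" using uR den_one by simp
  have "coset ?x \<notin> coset ` Loc J"
  proof
    assume "coset ?x \<in> coset ` Loc J"
    then obtain y where y: "y \<in> Loc J" "coset ?x = coset y" by blast
    have yL: "y \<in> carrier L" using y(1) Loc_subset[OF assms(1)] by blast
    have "?x \<ominus>\<^bsub>L\<^esub> y \<in> Loc U1" using y(2) xL yL by (simp add: coset_eq_iff)
    then have "?x \<ominus>\<^bsub>L\<^esub> y \<in> Loc J" using Loc_mono[OF assms(3)] by blast
    then have "(?x \<ominus>\<^bsub>L\<^esub> y) \<oplus>\<^bsub>L\<^esub> y \<in> Loc J" by (rule Loc_add[OF assms(1) _ y(1)])
    then have "?x \<in> Loc J" using xL yL by (simp add: a_minus_def L.a_assoc L.l_neg)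
    then have "single u (1::'k) \<in> polys_on J" using uR den_one by (simp add: frac_in_Loc_iff[OF assms(1)])
    with u(2) show False by (simp add: polys_on_def)
  qed
  moreover have "coset ?x \<in> coset ` Loc J'" using u(1) by (intro imageI frac_in_Loc polys_on_single den_one)
  ultimately show "coset ` Loc J \<noteq> coset ` Loc J'" by blast
qed

lemma polys_on_sat_reduce:
  assumes "p \<in> (polys_on sat_exps :: ('v, 'k) mpoly set)"
  shows "\<exists>p'\<in>polys_on (sat_exps - U1). p - p' \<in> polys_on U1"
  using assms
proof (induction rule: polys_on_induct)
  case zero
  show ?case by (intro bexI[of _ 0]) auto
next
  case (add p r)
  then obtain p' r' where "p' \<in> polys_on (sat_exps - U1)" "p - p' \<in> polys_on U1"
    "r' \<in> polys_on (sat_exps - U1)" "r - r' \<in> polys_on U1" by blast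
  then show ?case using polys_on_add[of "p - p'" U1 "r - r'"]
    by (intro bexI[of _ "p' + r'"]) (auto intro: polys_on_add simp: algebra_simps)
next
  case (single u c)
  show ?case
  proof (cases "u \<in> U1")
    case True
    then show ?thesis by (intro bexI[of _ 0]) (auto intro: polys_on_single)
  next
    case False
    then show ?thesis using single by (intro bexI[of _ "single u c"]) (auto intro: polys_on_single)
  qed
qed

text \<open>Up-sets between \<open>U1\<close> and \<open>sat_exps\<close>, growing by one monomial
  at a time, give a chain of submodules of the claimed length. Conversely, a chain of submodules
  yields a strict chain of subspaces in the polynomials on \<open>sat_exps - U1\<close>, whose
  dimension bounds it.\<close>

theorem module_length_local_coh:
  assumes fin: "finite (sat_exps - U1)"
  shows "module_length L local_coh = enat (card (sat_exps - U1))"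
  unfolding module_length_def
proof (rule chain_height_eqI)
  obtain J :: "nat \<Rightarrow> ('v \<Rightarrow>\<^sub>0 nat) set" where
    J: "\<And>i. i \<le> card (sat_exps - U1) \<Longrightarrow> upset V (J i) \<and> U1 \<subseteq> J i \<and> J i \<subseteq> sat_exps"
      "\<And>i. i < card (sat_exps - U1) \<Longrightarrow> J i \<subset> J (Suc i)"
    using upset_chain[OF U1 upset_sat_exps U1_sat_exps fin refl] by blast
  show "\<exists>C. (\<forall>i\<le>card (sat_exps - U1). C i \<in> {N. submodule N L local_coh}) \<and>
      (\<forall>i<card (sat_exps - U1). C i \<subset> C (Suc i))"
  proof (intro exI[of _ "\<lambda>i. coset ` Loc (J i)"] conjI allI impI)
    show "coset ` Loc (J i) \<in> {N. submodule N L local_coh}" if "i \<le> card (sat_exps - U1)" for i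
      using J(1)[OF that] coset_Loc_submodule by simp
    show "coset ` Loc (J i) \<subset> coset ` Loc (J (Suc i))" if "i < card (sat_exps - U1)" for i
      using J(1)[of i] J(1)[of "Suc i"] J(2)[OF that] that by (intro coset_Loc_strict) auto
  qed
next
  fix C :: "nat \<Rightarrow> _" and k
  assume "\<And>i. i \<le> k \<Longrightarrow> C i \<in> {N. submodule N L local_coh}" and strict: "\<And>i. i < k \<Longrightarrow> C i \<subset> C (Suc i)"
  then have sub: "submodule (C i) L local_coh" if "i \<le> k" for i using that by blast
  let ?J = "sat_exps - U1"
  \<comment> \<open>Pulls a submodule back to polynomials in normal form modulo \<open>U1\<close>;
    constants act through the local ring, so this is a subspace over the field.\<close>
  define T where "T i = {p \<in> (polys_on ?J :: ('v, 'k) mpoly set). coset (frac p 1) \<in> C i}" for i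
  have PR: "p \<in> carrier R" if "p \<in> polys_on sat_exps" for p using upset_carrier[OF upset_sat_exps that] .
  have JR: "p \<in> carrier R" if "p \<in> polys_on ?J" for p using PR that polys_on_mono[of ?J sat_exps] by blast
  have smult: "coset (a \<otimes>\<^bsub>L\<^esub> x) \<in> C i" if "i \<le> k" "a \<in> carrier L" "x \<in> carrier L" "coset x \<in> C i" for a x i
    using submodule.smult_closed[OF sub[OF that(1)] that(2,4)] that(2,3) by (simp add: local_coh_simps)
  have addc: "coset (x \<oplus>\<^bsub>L\<^esub> y) \<in> C i" if "i \<le> k" "x \<in> carrier L" "y \<in> carrier L" "coset x \<in> C i" "coset y \<in> C i" for x y i
    using subgroup.m_closed[OF submodule.axioms(1)[OF sub[OF that(1)]] that(4,5)] that(2,3)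
    unfolding local_coh_simps by (simp add: set_add_cosets)
  have subspace: "pv.subspace (T i)" if i: "i \<le> k" for i
  proof (rule pv.subspaceI)
    have "Loc U1 \<in> C i"
      using subgroup.one_closed[OF submodule.axioms(1)[OF sub[OF i]]] unfolding local_coh_simps by simp
    then show "0 \<in> T i" by (simp add: T_def frac_zero den_one coset_zero)
  next
    fix p r assume "p \<in> T i" "r \<in> T i"
    then show "p + r \<in> T i"
      using addc[OF i, of "frac p 1" "frac r 1"] by (auto simp: T_def JR frac_add_same den_one intro: polys_on_add)
  next
    fix c p assume p: "p \<in> T i"
    have "single 0 c \<in> carrier R" by (simp add: carrier_R polys_on_single)
    then have "frac (single 0 c) 1 \<otimes>\<^bsub>L\<^esub> frac p 1 = frac (poly_scale c p) 1"
      using p by (simp add: T_def JR frac_mult den_one poly_scale_def)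
    moreover have "poly_scale c p \<in> polys_on ?J"
      unfolding poly_scale_def using p by (intro polys_on_mult[of _ "{0}" _ ?J]) (auto simp: T_def polys_on_def)
    ultimately show "poly_scale c p \<in> T i"
      using smult[OF i, of "frac (single 0 c) 1" "frac p 1"] p \<open>single 0 c \<in> carrier R\<close> by (simp add: T_def JR den_one)
  qed
  have strictT: "T i \<subset> T (Suc i)" if i: "i < k" for i
  proof
    show "T i \<subseteq> T (Suc i)" using strict[OF i] by (auto simp: T_def)
    from strict[OF i] obtain c where c: "c \<in> C (Suc i)" "c \<notin> C i" by blast
    then have "c \<in> carrier local_coh"
      using subgroup.subset[OF submodule.axioms(1)[OF sub[of "Suc i"]]] i unfolding local_coh_simps by auto
    then obtain p s where p: "p \<in> polys_on sat_exps" "s \<in> den" "c = coset (frac p s)"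
      unfolding carrier_local_coh by (auto simp: Loc_def)
    \<comment> \<open>As \<open>s\<close> is a unit, the class of \<open>frac p s\<close> lies in
      the same submodules as that of \<open>frac p 1\<close>, so strictness is already visible on
      polynomials.\<close>
    have e: "frac s 1 \<otimes>\<^bsub>L\<^esub> frac p s = frac p 1" "frac 1 s \<otimes>\<^bsub>L\<^esub> frac p 1 = frac p s"
      using p PR[OF p(1)] by (simp_all add: frac_mult frac_closed frac_eq_iff mult.commute)
    have in1: "coset (frac p 1) \<in> C (Suc i)"
      using smult[of "Suc i" "frac s 1" "frac p s"] c(1) p PR[OF p(1)] i e by (simp add: den_carrier den_one)
    have out: "coset (frac p 1) \<notin> C i"
      using smult[of i "frac 1 s" "frac p 1"] c(2) p PR[OF p(1)] i e by (auto simp: den_one R_closed)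
    from polys_on_sat_reduce[OF p(1)] obtain p' where p': "p' \<in> polys_on ?J" "p - p' \<in> polys_on U1" by blast
    have "frac p 1 \<ominus>\<^bsub>L\<^esub> frac p' 1 = frac (p - p') 1"
      using PR[OF p(1)] JR[OF p'(1)] by (simp add: a_minus_def frac_uminus frac_add_same den_one R_closed)
    then have "frac p 1 \<ominus>\<^bsub>L\<^esub> frac p' 1 \<in> Loc U1" using p'(2) den_one by (simp add: frac_in_Loc)
    then have "coset (frac p 1) = coset (frac p' 1)"
      using PR[OF p(1)] JR[OF p'(1)] by (subst coset_eq_iff) (auto simp: den_one)
    then have "p' \<in> T (Suc i)" "p' \<notin> T i" using p'(1) in1 out by (auto simp: T_def)
    then show "T i \<noteq> T (Suc i)" by blast
  qed
  have "T k \<subseteq> pv.span ((\<lambda>u. single u 1) ` ?J)" using polys_on_span[of ?J] by (auto simp: T_def)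
  then have "k \<le> card ((\<lambda>u. single u (1::'k)) ` ?J)"
    using pv.subspace_chain_length[of k T] subspace strictT fin by blast
  also have "\<dots> \<le> card ?J" using fin by (rule card_image_le)
  finally show "k \<le> card ?J" .
qed

end

end

section \<open>Krull dimension\<close>

text \<open>A substitute for leading monomials on an unordered node type: both sets are cut down to
  the largest value of one coordinate after another, and a sum attaining both maxima can only come
  from such elements.\<close>

lemma unique_product:
  fixes A B :: "('v \<Rightarrow>\<^sub>0 nat) set"
  assumes "finite Z" "finite A" "A \<noteq> {}" "finite B" "B \<noteq> {}"
    and "\<And>a a' x. a \<in> A \<Longrightarrow> a' \<in> A \<Longrightarrow> x \<notin> Z \<Longrightarrow> lookup a x = lookup a' x"
    and "\<And>b b' x. b \<in> B \<Longrightarrow> b' \<in> B \<Longrightarrow> x \<notin> Z \<Longrightarrow> lookup b x = lookup b' x"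
  shows "\<exists>a\<in>A. \<exists>b\<in>B. \<forall>a'\<in>A. \<forall>b'\<in>B. a' + b' = a + b \<longrightarrow> a' = a \<and> b' = b"
  using assms
proof (induction Z arbitrary: A B rule: finite_induct)
  case empty
  then obtain a b where ab: "a \<in> A" "b \<in> B" by blast
  have "a' = a" if "a' \<in> A" for a' using empty(5)[OF that ab(1)] by (intro poly_mapping_eqI) auto
  moreover have "b' = b" if "b' \<in> B" for b' using empty(6)[OF that ab(2)] by (intro poly_mapping_eqI) auto
  ultimately show ?case using ab by blast
next
  case (insert z Z)
  define ma where "ma = Max ((\<lambda>a. lookup a z) ` A)"
  define mb where "mb = Max ((\<lambda>b. lookup b z) ` B)"
  define A' where "A' = {a \<in> A. lookup a z = ma}"
  define B' where "B' = {b \<in> B. lookup b z = mb}"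
  have "ma \<in> (\<lambda>a. lookup a z) ` A" unfolding ma_def using insert.prems by (intro Max_in) auto
  then have A': "A' \<noteq> {}" by (auto simp: A'_def)
  have "mb \<in> (\<lambda>b. lookup b z) ` B" unfolding mb_def using insert.prems by (intro Max_in) auto
  then have B': "B' \<noteq> {}" by (auto simp: B'_def)
  have leA: "lookup a z \<le> ma" if "a \<in> A" for a unfolding ma_def using insert.prems that by (intro Max_ge) auto
  have leB: "lookup b z \<le> mb" if "b \<in> B" for b unfolding mb_def using insert.prems that by (intro Max_ge) auto
  have "\<exists>a\<in>A'. \<exists>b\<in>B'. \<forall>a'\<in>A'. \<forall>b'\<in>B'. a' + b' = a + b \<longrightarrow> a' = a \<and> b' = b"
  proof (rule insert.IH[OF _ A' _ B'])
    show "lookup a x = lookup a' x" if "a \<in> A'" "a' \<in> A'" "x \<notin> Z" for a a' x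
      using that insert.prems(5)[of a a' x] by (cases "x = z") (auto simp: A'_def)
    show "lookup b x = lookup b' x" if "b \<in> B'" "b' \<in> B'" "x \<notin> Z" for b b' x
      using that insert.prems(6)[of b b' x] by (cases "x = z") (auto simp: B'_def)
  qed (use insert.prems in \<open>auto simp: A'_def B'_def\<close>)
  then obtain a b where ab: "a \<in> A'" "b \<in> B'"
    "\<And>a' b'. a' \<in> A' \<Longrightarrow> b' \<in> B' \<Longrightarrow> a' + b' = a + b \<Longrightarrow> a' = a \<and> b' = b" by blast
  have "a' = a \<and> b' = b" if "a' \<in> A" "b' \<in> B" "a' + b' = a + b" for a' b'
  proof (rule ab(3)[OF _ _ that(3)])
    have "lookup a' z + lookup b' z = ma + mb"
      using ab(1,2) arg_cong[OF that(3), of "\<lambda>u. lookup u z"] by (simp add: lookup_add A'_def B'_def)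
    with leA[OF that(1)] leB[OF that(2)] have "lookup a' z = ma" "lookup b' z = mb" by auto
    then show "a' \<in> A'" "b' \<in> B'" using that by (auto simp: A'_def B'_def)
  qed
  moreover have "a \<in> A" "b \<in> B" using ab by (auto simp: A'_def B'_def)
  ultimately show ?case by blast
qed

lemma lookup_mult_unique:
  fixes p r :: "('v, 'k::field) mpoly"
  assumes "\<And>a' b'. a' \<in> keys p \<Longrightarrow> b' \<in> keys r \<Longrightarrow> a' + b' = a + b \<Longrightarrow> a' = a"
  shows "lookup (p * r) (a + b) = lookup p a * lookup r b"
proof -
  define p' where "p' = p - single a (lookup p a)"
  have p: "p = single a (lookup p a) + p'" by (simp add: p'_def)
  have "lookup (p' * r) (a + b) = 0"
  proof (rule ccontr)
    assume "lookup (p' * r) (a + b) \<noteq> 0"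
    then obtain a' b' where *: "a' \<in> keys p'" "b' \<in> keys r" "a + b = a' + b'"
      using keys_mult[of p' r] by (auto simp: in_keys_iff)
    then have "a' \<noteq> a" "a' \<in> keys p" by (auto simp: p'_def in_keys_iff lookup_minus lookup_single when_def split: if_splits)
    with assms[of a' b'] * show False by simp
  qed
  then show ?thesis by (subst (1) p) (simp add: distrib_right lookup_add lookup_single_mult)
qed

text \<open>A relation for the family, not for its image as a set; two equal members give one
  directly.\<close>

lemma (in vector_space) exists_relation:
  assumes "finite A" "finite B" "f ` A \<subseteq> span B" "card B < card A"
  shows "\<exists>c. (\<exists>a\<in>A. c a \<noteq> 0) \<and> (\<Sum>a\<in>A. scale (c a) (f a)) = 0"
proof (cases "inj_on f A")
  case True
  have "dependent (f ` A)"
  proof (rule ccontr)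
    assume "\<not> dependent (f ` A)"
    from independent_span_bound[OF assms(2) this assms(3)] assms(4) show False by (simp add: card_image[OF True])
  qed
  then obtain c v where c: "v \<in> f ` A" "c v \<noteq> 0" "(\<Sum>v\<in>f ` A. scale (c v) v) = 0"
    using assms(1) by (auto simp: dependent_finite)
  then show ?thesis by (intro exI[of _ "c \<circ> f"]) (auto simp: sum.reindex[OF True])
next
  case False
  then obtain a b where ab: "a \<in> A" "b \<in> A" "a \<noteq> b" "f a = f b" by (auto simp: inj_on_def)
  define c where "c = (\<lambda>x. if x = a then 1 else if x = b then - 1 else 0 :: 'a)"
  have "(\<Sum>x\<in>A. scale (c x) (f x)) = (\<Sum>x\<in>{a, b}. scale (c x) (f x))"
    by (rule sum.mono_neutral_right) (use assms(1) ab in \<open>auto simp: c_def\<close>)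
  also have "\<dots> = 0" using ab by (simp add: c_def)
  finally show ?thesis using ab(1) by (intro exI[of _ c]) (auto simp: c_def)
qed

context local_mpoly
begin

text \<open>After the terms inside \<open>U\<close> are discarded from both factors, a uniquely
  represented sum \<open>a + b\<close> of remaining exponents has nonzero coefficient in the product
  and lies outside \<open>U\<close>.\<close>

lemma polys_on_prime:
  assumes U: "upset V U" "\<And>u w. u \<in> expvecs V \<Longrightarrow> w \<in> expvecs V \<Longrightarrow> u + w \<in> U \<Longrightarrow> u \<in> U \<or> w \<in> U"
    and p: "p \<in> carrier R" "r \<in> carrier R" "p * r \<in> polys_on U"
  shows "p \<in> polys_on U \<or> r \<in> polys_on U"
proof (rule ccontr)
  assume "\<not> ?thesis"
  then have ne: "keys p - U \<noteq> {}" "keys r - U \<noteq> {}" by (auto simp: polys_on_def)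
  have eV: "keys p \<subseteq> expvecs V" "keys r \<subseteq> expvecs V" using p by (auto simp: carrier_R polys_on_def)
  have out: "lookup u x = 0" if "u \<in> expvecs V" "x \<notin> V" for u :: "'v \<Rightarrow>\<^sub>0 nat" and x
    using that by (auto simp: expvecs_def in_keys_iff)
  have "\<exists>a\<in>keys p - U. \<exists>b\<in>keys r - U. \<forall>a'\<in>keys p - U. \<forall>b'\<in>keys r - U. a' + b' = a + b \<longrightarrow> a' = a \<and> b' = b"
    by (rule unique_product[OF finite_V _ ne(1) _ ne(2)]) (use eV out in \<open>auto simp: subset_iff\<close>)
  then obtain a b where ab: "a \<in> keys p - U" "b \<in> keys r - U"
    "\<And>a' b'. a' \<in> keys p - U \<Longrightarrow> b' \<in> keys r - U \<Longrightarrow> a' + b' = a + b \<Longrightarrow> a' = a" by blast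
  have nU: "a + b \<notin> U" using ab(1,2) U(2)[of a b] eV by blast
  have "lookup (p * r) (a + b) = lookup p a * lookup r b"
  proof (rule lookup_mult_unique)
    fix a' b' assume *: "a' \<in> keys p" "b' \<in> keys r" "a' + b' = a + b"
    \<comment> \<open>Discarded terms cannot interfere: an exponent inside \<open>U\<close> would
      put \<open>a + b\<close> into \<open>U\<close>.\<close>
    then have "a' \<notin> U" "b' \<notin> U" using nU U(1) eV unfolding upset_def by (metis subsetD, metis add.commute subsetD)
    with * show "a' = a" using ab(3) by blast
  qed
  also have "\<dots> \<noteq> 0" using ab(1,2) by (simp add: in_keys_iff)
  finally have "a + b \<in> keys (p * r)" by (simp add: in_keys_iff)
  with p(3) nU show False by (auto simp: polys_on_def)
qed

lemma Loc_primeideal: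
  assumes U: "upset V U" "\<And>u w. u \<in> expvecs V \<Longrightarrow> w \<in> expvecs V \<Longrightarrow> u + w \<in> U \<Longrightarrow> u \<in> U \<or> w \<in> U" "0 \<notin> U"
  shows "primeideal (Loc U) L"
proof (rule primeidealI[OF Loc_ideal[OF U(1)] cring_L])
  have "\<one>\<^bsub>L\<^esub> \<notin> Loc U" unfolding L_one using U(3) by (subst frac_in_Loc_iff[OF U(1)]) (auto simp: frac_closed polys_on_def)
  then show "carrier L \<noteq> Loc U" using L.one_closed by blast
  fix x y assume "x \<in> carrier L" "y \<in> carrier L" and xy: "x \<otimes>\<^bsub>L\<^esub> y \<in> Loc U"
  then obtain a s b t where x: "a \<in> carrier R" "s \<in> den" "x = frac a s" and y: "b \<in> carrier R" "t \<in> den" "y = frac b t"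
    by (elim L_carrierE)
  have "a * b \<in> polys_on U" using xy x y by (simp add: frac_mult frac_in_Loc_iff[OF U(1)] R_closed den_mult)
  then have "a \<in> polys_on U \<or> b \<in> polys_on U" using U(2) by (intro polys_on_prime[OF U(1) _ x(1) y(1)]) auto
  then show "x \<in> Loc U \<or> y \<in> Loc U" using x y by (auto intro: frac_in_Loc)
qed

text \<open>The primes generated by the first \<open>i\<close> variables, with exponent set
  \<open>U i\<close>; the next variable witnesses strictness.\<close>

lemma prime_chain_exists:
  "\<exists>C. (\<forall>i\<le>card V. C i \<in> {P. primeideal P L}) \<and> (\<forall>i<card V. C i \<subset> C (Suc i))"
proof -
  obtain v where v: "bij_betw v {..<card V} V" using ex_bij_betw_nat_finite[OF finite_V] by (auto simp: atLeast0LessThan)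
  define U where "U i = {u \<in> expvecs V. \<exists>j<i. lookup u (v j) \<noteq> 0}" for i
  have up: "upset V (U i)" for i by (auto simp: upset_def U_def lookup_add)
  show ?thesis
  proof (intro exI[of _ "\<lambda>i. Loc (U i)"] conjI allI impI)
    fix i
    show "Loc (U i) \<in> {P. primeideal P L}"
      by (simp, rule Loc_primeideal[OF up]) (auto simp: U_def lookup_add)
    assume i: "i < card V"
    have vi: "v i \<in> V" using v i by (auto simp: bij_betw_def)
    have "lookup (single (v i) (1::nat)) (v j) = 0" if "j < i" for j
    proof -
      have "v j \<noteq> v i" using v that i by (auto simp: bij_betw_def inj_on_def)
      then show ?thesis by (simp add: lookup_single)
    qed
    then have u: "single (v i) 1 \<in> U (Suc i)" "single (v i) 1 \<notin> U i" using vi by (auto simp: U_def)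
    have "U i \<subseteq> U (Suc i)" by (auto simp: U_def less_Suc_eq)
    then have "Loc (U i) \<subseteq> Loc (U (Suc i))" by (rule Loc_mono)
    moreover have "frac (single (single (v i) 1) 1) 1 \<in> Loc (U (Suc i))"
      by (intro frac_in_Loc polys_on_single u(1) den_one)
    moreover have "frac (single (single (v i) 1) 1) 1 \<notin> Loc (U i)"
      using u(2) vi by (subst frac_in_Loc_iff[OF up]) (auto simp: den_one polys_on_def carrier_R)
    ultimately show "Loc (U i) \<subset> Loc (U (Suc i))" by blast
  qed
qed

section \<open>The number of variables bounds chains of primes\<close>

definition prime_in_R :: "('v, 'k) mpoly set \<Rightarrow> bool"
  where "prime_in_R Q \<longleftrightarrow> Q \<subseteq> carrier R \<and> 0 \<in> Q \<and> 1 \<notin> Q \<and> (\<forall>p\<in>Q. \<forall>r\<in>Q. p + r \<in> Q) \<and>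
    (\<forall>p\<in>Q. \<forall>r\<in>carrier R. r * p \<in> Q) \<and> (\<forall>p\<in>carrier R. \<forall>r\<in>carrier R. p * r \<in> Q \<longrightarrow> p \<in> Q \<or> r \<in> Q)"

text \<open>Contraction moves the chain into the polynomial ring, where degrees bound the dimension
  of the space containing the products of the \<open>x i\<close>.\<close>

lemma prime_in_R_contraction:
  assumes "primeideal P L"
  shows "prime_in_R {p \<in> carrier R. frac p 1 \<in> P}"
proof -
  interpret P: primeideal P L by fact
  have "frac 1 1 \<notin> P" using P.one_imp_carrier P.I_notcarr by (auto simp: L_one)
  moreover have "frac 0 1 \<in> P" using P.zero_closed by (simp add: frac_zero den_one)
  moreover have "frac (p + r) 1 \<in> P" if "p \<in> carrier R" "r \<in> carrier R" "frac p 1 \<in> P" "frac r 1 \<in> P" for p r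
    using P.a_closed[OF that(3,4)] that by (simp add: frac_add_same den_one)
  moreover have "frac (r * p) 1 \<in> P" if "p \<in> carrier R" "r \<in> carrier R" "frac p 1 \<in> P" for p r
    using P.I_l_closed[OF that(3), of "frac r 1"] that by (simp add: frac_mult den_one)
  moreover have "frac p 1 \<in> P \<or> frac r 1 \<in> P" if "p \<in> carrier R" "r \<in> carrier R" "frac (p * r) 1 \<in> P" for p r
    using P.I_prime[of "frac p 1" "frac r 1"] that by (simp add: frac_mult den_one)
  ultimately show ?thesis unfolding prime_in_R_def by (auto simp: R_closed)
qed

context
  fixes N :: nat and Q :: "nat \<Rightarrow> ('v, 'k) mpoly set" and x :: "nat \<Rightarrow> ('v, 'k) mpoly"
  assumes Q: "\<And>i. i \<le> N \<Longrightarrow> prime_in_R (Q i)" and Q_mono: "\<And>i. i < N \<Longrightarrow> Q i \<subseteq> Q (Suc i)"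
    and x_in: "\<And>i. i < N \<Longrightarrow> x i \<in> Q (Suc i)" and x_notin: "\<And>i. i < N \<Longrightarrow> x i \<notin> Q i"
begin

definition xpow :: "(nat \<Rightarrow>\<^sub>0 nat) \<Rightarrow> ('v, 'k) mpoly"
  where "xpow \<alpha> = (\<Prod>i<N. x i ^ lookup \<alpha> i)"

lemma x_carrier: "i < N \<Longrightarrow> x i \<in> carrier R"
  using Q[of "Suc i"] x_in[of i] by (auto simp: prime_in_R_def)

lemma power_carrier: "p \<in> carrier R \<Longrightarrow> p ^ k \<in> carrier R"
  by (induction k) (auto intro: R_closed)

lemma prod_carrier: "(\<And>i. i \<in> A \<Longrightarrow> f i \<in> carrier R) \<Longrightarrow> (\<Prod>i\<in>A. f i) \<in> carrier R"
  by (induction A rule: infinite_finite_induct) (auto intro: R_closed)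

lemma xpow_carrier: "xpow \<alpha> \<in> carrier R"
  unfolding xpow_def by (intro prod_carrier power_carrier x_carrier) auto

lemma xpow_add: "xpow (\<alpha> + \<beta>) = xpow \<alpha> * xpow \<beta>"
  by (simp add: xpow_def lookup_add power_add prod.distrib)

lemma xpow_single: "j < N \<Longrightarrow> xpow (single j a) = x j ^ a"
  by (simp add: xpow_def lookup_single when_def if_distrib[of "\<lambda>n. _ ^ n"] prod.delta cong: if_cong)

lemma Q_sum: "i \<le> N \<Longrightarrow> (\<And>\<alpha>. \<alpha> \<in> A \<Longrightarrow> f \<alpha> \<in> Q i) \<Longrightarrow> (\<Sum>\<alpha>\<in>A. f \<alpha>) \<in> Q i"
  using Q[of i] by (induction A rule: infinite_finite_induct) (auto simp: prime_in_R_def)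

lemma Q_mult: "i \<le> N \<Longrightarrow> p \<in> Q i \<Longrightarrow> r \<in> carrier R \<Longrightarrow> r * p \<in> Q i"
  using Q[of i] by (auto simp: prime_in_R_def)

lemma Q_diff:
  assumes "i \<le> N" "p \<in> Q i" "r \<in> Q i"
  shows "p - r \<in> Q i"
proof -
  have "(- 1) * r \<in> Q i" by (rule Q_mult[OF assms(1,3)]) (intro R_closed)
  then have "p + (- 1) * r \<in> Q i" using Q[OF assms(1)] assms(2) unfolding prime_in_R_def by blast
  then show ?thesis by simp
qed

lemma const_carrier: "single 0 c \<in> carrier R"
  by (simp add: carrier_R polys_on_single)

lemma x_power_notin: "j < N \<Longrightarrow> x j ^ a \<notin> Q j"
proof (induction a)
  case 0
  then show ?case using Q[of j] by (simp add: prime_in_R_def)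
next
  case (Suc a)
  then show ?case using Q[of j] x_notin[of j] x_carrier[of j] power_carrier[of "x j" a]
    unfolding prime_in_R_def by auto
qed

text \<open>Divide by the lowest power of \<^term>\<open>x j\<close> and reduce modulo \<^term>\<open>x j \<in> Q (Suc j)\<close>: what remains
  is a relation of the same kind in fewer elements.\<close>

lemma combination_notin:
  assumes "j \<le> N" "finite A" "A \<noteq> {}" "A \<subseteq> expvecs {j..<N}" "\<And>\<alpha>. \<alpha> \<in> A \<Longrightarrow> c \<alpha> \<noteq> 0"
  shows "(\<Sum>\<alpha>\<in>A. poly_scale (c \<alpha>) (xpow \<alpha>)) \<notin> Q j"
  using assms
proof (induction "N - j" arbitrary: j A c)
  case 0
  then have j: "j = N" by simp
  \<comment> \<open>No index remains, so the combination is a nonzero constant and would put 1 into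
    \<open>Q N\<close>.\<close>
  then have "A = {0}" using 0 by (auto simp: expvecs_def)
  then have sum: "(\<Sum>\<alpha>\<in>A. poly_scale (c \<alpha>) (xpow \<alpha>)) = single 0 (c 0)"
    by (simp add: xpow_def poly_scale_def)
  show ?case
  proof
    assume "(\<Sum>\<alpha>\<in>A. poly_scale (c \<alpha>) (xpow \<alpha>)) \<in> Q j"
    then have "single 0 (1 / c 0) * single 0 (c 0) \<in> Q N" unfolding sum j by (intro Q_mult const_carrier) auto
    moreover have "single 0 (1 / c 0) * single 0 (c 0) = (1 :: ('v, 'k) mpoly)"
      using 0 \<open>A = {0}\<close> by (simp add: mult_single)
    ultimately show False using Q[of N] by (simp add: prime_in_R_def)
  qed
next
  case (Suc d)
  then have j: "j < N" by simp
  define a where "a = Min ((\<lambda>\<alpha>. lookup \<alpha> j) ` A)"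
  have "a \<in> (\<lambda>\<alpha>. lookup \<alpha> j) ` A" unfolding a_def using Suc.prems by (intro Min_in) auto
  then obtain \<alpha>0 where \<alpha>0: "\<alpha>0 \<in> A" "lookup \<alpha>0 j = a" by blast
  have a_le: "a \<le> lookup \<alpha> j" if "\<alpha> \<in> A" for \<alpha> unfolding a_def using that Suc.prems by (intro Min_le) auto
  define \<beta> where "\<beta> \<alpha> = \<alpha> - single j a" for \<alpha> :: "nat \<Rightarrow>\<^sub>0 nat"
  have \<beta>: "\<alpha> = single j a + \<beta> \<alpha>" if "\<alpha> \<in> A" for \<alpha>
    unfolding \<beta>_def by (rule pointwise_le_imp_add[symmetric]) (use a_le[OF that] in \<open>auto simp: lookup_single when_def\<close>)
  define f where "f \<alpha> = poly_scale (c \<alpha>) (xpow (\<beta> \<alpha>))" for \<alpha>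
  have fR: "f \<alpha> \<in> carrier R" for \<alpha>
    unfolding f_def poly_scale_def by (intro R_closed const_carrier xpow_carrier)
  have "(\<Sum>\<alpha>\<in>A. poly_scale (c \<alpha>) (xpow \<alpha>)) = (\<Sum>\<alpha>\<in>A. x j ^ a * f \<alpha>)"
  proof (rule sum.cong[OF refl])
    fix \<alpha> assume "\<alpha> \<in> A"
    then have "xpow \<alpha> = x j ^ a * xpow (\<beta> \<alpha>)" by (metis \<beta> xpow_add xpow_single j)
    then show "poly_scale (c \<alpha>) (xpow \<alpha>) = x j ^ a * f \<alpha>" by (simp add: f_def poly_scale_def mult.left_commute)
  qed
  then have eq: "(\<Sum>\<alpha>\<in>A. poly_scale (c \<alpha>) (xpow \<alpha>)) = x j ^ a * (\<Sum>\<alpha>\<in>A. f \<alpha>)" by (simp add: sum_distrib_left)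
  define A0 where "A0 = {\<alpha> \<in> A. lookup \<alpha> j = a}"
  show ?case
  proof
    assume "(\<Sum>\<alpha>\<in>A. poly_scale (c \<alpha>) (xpow \<alpha>)) \<in> Q j"
    moreover have "(\<Sum>\<alpha>\<in>A. f \<alpha>) \<in> carrier R" using polys_on_sum[of A f "expvecs V"] fR by (simp add: carrier_R)
    \<comment> \<open>\<open>Q j\<close> is prime and misses the power of \<open>x j\<close>, so it
      contains the cofactor.\<close>
    ultimately have "(\<Sum>\<alpha>\<in>A. f \<alpha>) \<in> Q j"
      using Q[of j] x_power_notin[OF j, of a] power_carrier[OF x_carrier[OF j], of a] j unfolding eq prime_in_R_def by auto
    then have "(\<Sum>\<alpha>\<in>A. f \<alpha>) \<in> Q (Suc j)" using Q_mono[OF j] by blast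
    \<comment> \<open>The terms above the lowest power retain a factor \<open>x j\<close>; those in
      \<open>A0\<close> involve only later indices.\<close>
    moreover have "(\<Sum>\<alpha>\<in>A - A0. f \<alpha>) \<in> Q (Suc j)"
    proof (rule Q_sum)
      fix \<alpha> assume "\<alpha> \<in> A - A0"
      then have "a < lookup \<alpha> j" using a_le[of \<alpha>] by (auto simp: A0_def)
      then have "single j 1 + (\<beta> \<alpha> - single j 1) = \<beta> \<alpha>"
        by (intro pointwise_le_imp_add) (auto simp: \<beta>_def lookup_single lookup_minus when_def)
      then have "xpow (\<beta> \<alpha>) = x j * xpow (\<beta> \<alpha> - single j 1)" by (metis xpow_add xpow_single j power_one_right)
      then have "f \<alpha> = (single 0 (c \<alpha>) * xpow (\<beta> \<alpha> - single j 1)) * x j"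
        by (simp add: f_def poly_scale_def ac_simps)
      moreover have "single 0 (c \<alpha>) * xpow (\<beta> \<alpha> - single j 1) \<in> carrier R"
        by (intro R_closed const_carrier xpow_carrier)
      ultimately show "f \<alpha> \<in> Q (Suc j)" using Q_mult[OF _ x_in[OF j]] j by simp
    qed (use j in simp)
    moreover have "(\<Sum>\<alpha>\<in>A. f \<alpha>) = (\<Sum>\<alpha>\<in>A - A0. f \<alpha>) + (\<Sum>\<alpha>\<in>A0. f \<alpha>)"
      by (rule sum.subset_diff) (use Suc.prems in \<open>auto simp: A0_def\<close>)
    ultimately have inQ: "(\<Sum>\<alpha>\<in>A0. f \<alpha>) \<in> Q (Suc j)"
      using Q_diff[of "Suc j" "\<Sum>\<alpha>\<in>A. f \<alpha>" "\<Sum>\<alpha>\<in>A - A0. f \<alpha>"] j by simp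
    have inj: "inj_on \<beta> A0"
    proof (rule inj_onI)
      fix \<alpha> \<alpha>' assume "\<alpha> \<in> A0" "\<alpha>' \<in> A0" "\<beta> \<alpha> = \<beta> \<alpha>'"
      then show "\<alpha> = \<alpha>'" using \<beta>[of \<alpha>] \<beta>[of \<alpha>'] by (simp add: A0_def)
    qed
    have "(\<Sum>\<alpha>\<in>A0. f \<alpha>) = (\<Sum>\<gamma>\<in>\<beta> ` A0. poly_scale (c (single j a + \<gamma>)) (xpow \<gamma>))"
      unfolding sum.reindex[OF inj] o_def f_def
      by (rule sum.cong) (auto simp: A0_def simp flip: \<beta>)
    moreover have "(\<Sum>\<gamma>\<in>\<beta> ` A0. poly_scale (c (single j a + \<gamma>)) (xpow \<gamma>)) \<notin> Q (Suc j)"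
    proof (rule Suc.hyps(1))
      show "\<beta> ` A0 \<subseteq> expvecs {Suc j..<N}"
      proof
        fix \<gamma> assume "\<gamma> \<in> \<beta> ` A0"
        then obtain \<alpha> where \<alpha>: "\<alpha> \<in> A" "lookup \<alpha> j = a" "\<gamma> = \<beta> \<alpha>" by (auto simp: A0_def)
        have "i \<in> {Suc j..<N}" if "i \<in> keys \<gamma>" for i
        proof -
          have "lookup \<gamma> j = 0" using \<alpha> by (simp add: \<beta>_def lookup_minus)
          then have "i \<noteq> j" using that by (auto simp: in_keys_iff)
          moreover have "\<gamma> \<in> expvecs {j..<N}" using \<beta>[OF \<alpha>(1)] Suc.prems(4) \<alpha>(1,3) by (metis expvecs_add_iff subsetD)
          then have "i \<in> {j..<N}" using that by (auto simp: expvecs_def)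
          ultimately show ?thesis by auto
        qed
        then show "\<gamma> \<in> expvecs {Suc j..<N}" by (auto simp: expvecs_def)
      qed
      show "c (single j a + \<gamma>) \<noteq> 0" if "\<gamma> \<in> \<beta> ` A0" for \<gamma>
      proof -
        from that obtain \<alpha> where "\<alpha> \<in> A" "lookup \<alpha> j = a" "\<gamma> = \<beta> \<alpha>" by (auto simp: A0_def)
        then show ?thesis using Suc.prems(5)[of \<alpha>] \<beta>[of \<alpha>] by simp
      qed
    qed (use Suc j \<alpha>0 in \<open>auto simp: A0_def\<close>)
    ultimately show False using inQ by simp
  qed
qed

definition deg_le :: "nat \<Rightarrow> ('v \<Rightarrow>\<^sub>0 nat) set"
  where "deg_le k = {u \<in> expvecs V. mdeg u \<le> k}"

lemma polys_deg_le_mult: "p \<in> polys_on (deg_le a) \<Longrightarrow> r \<in> polys_on (deg_le b) \<Longrightarrow> p * r \<in> polys_on (deg_le (a + b))"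
  by (erule (1) polys_on_mult) (auto simp: deg_le_def mdeg_add)

lemma polys_deg_le_one: "1 \<in> polys_on (deg_le k)"
  by (simp add: polys_on_def deg_le_def)

lemma polys_deg_le_power: "p \<in> polys_on (deg_le a) \<Longrightarrow> p ^ k \<in> polys_on (deg_le (a * k))"
  by (induction k) (auto intro: polys_deg_le_one polys_deg_le_mult)

lemma polys_deg_le_prod:
  "(\<And>i. i \<in> A \<Longrightarrow> f i \<in> polys_on (deg_le (e i))) \<Longrightarrow> finite A \<Longrightarrow> (\<Prod>i\<in>A. f i) \<in> polys_on (deg_le (\<Sum>i\<in>A. e i))"
  by (induction A rule: infinite_finite_induct) (auto intro: polys_deg_le_one polys_deg_le_mult)

lemma ex_deg_le: "\<exists>d. \<forall>i<N. x i \<in> polys_on (deg_le d)"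
proof -
  define d where "d = (\<Sum>i<N. \<Sum>u\<in>keys (x i). mdeg u)"
  have "mdeg u \<le> d" if "i < N" "u \<in> keys (x i)" for i u
  proof -
    have "mdeg u \<le> (\<Sum>u\<in>keys (x i). mdeg u)" using that by (intro member_le_sum) auto
    also have "\<dots> \<le> d" unfolding d_def using that by (intro member_le_sum) auto
    finally show ?thesis .
  qed
  then have "\<forall>i<N. x i \<in> polys_on (deg_le d)"
    using x_carrier by (auto simp: carrier_R polys_on_def deg_le_def)
  then show ?thesis by blast
qed

text \<open>By \<open>combination_notin\<close> for \<open>j = 0\<close>, the products
  \<open>xpow \<alpha>\<close> are linearly independent. Those with exponents at most
  \<open>t\<close> number \<open>Suc t ^ N\<close> but live in degrees O(t), a space of dimension
  O(t^n) with \<open>n = card V\<close>; for \<open>N > n\<close> this is impossible for large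
  \<open>t\<close>.\<close>

lemma prime_chain_length: "N \<le> card V"
proof (rule ccontr)
  assume "\<not> N \<le> card V"
  then have N: "Suc (card V) \<le> N" by simp
  let ?n = "card V"
  obtain d where d: "\<And>i. i < N \<Longrightarrow> x i \<in> polys_on (deg_le d)" using ex_deg_le by blast
  define D where "D = Suc (d * N)"
  \<comment> \<open>Large enough that the dimension bound
    \<open>(D * Suc t) ^ n = t * Suc t ^ n\<close> stays below \<open>Suc t ^ Suc n\<close>, where
    \<open>n\<close> is \<open>card V\<close>.\<close>
  define t where "t = D ^ ?n"
  define g where "g h = (\<Sum>i<N. single i (h i))" for h :: "nat \<Rightarrow> nat"
  define A where "A = g ` ({..<N} \<rightarrow>\<^sub>E {..t})"
  have lookup_g: "lookup (g h) i = h i" if "i < N" for h i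
    using that by (simp add: g_def lookup_sum lookup_single when_def)
  have g_exp: "g h \<in> expvecs {..<N}" for h unfolding g_def by (intro sum_in_expvecs) auto
  have "inj_on g ({..<N} \<rightarrow>\<^sub>E {..t})"
  proof (rule inj_onI)
    fix h h' assume *: "h \<in> {..<N} \<rightarrow>\<^sub>E {..t}" "h' \<in> {..<N} \<rightarrow>\<^sub>E {..t}" "g h = g h'"
    show "h = h'"
    proof (rule PiE_ext[OF *(1,2)])
      fix i assume "i \<in> {..<N}"
      then show "h i = h' i" using lookup_g[of i h] lookup_g[of i h'] *(3) by simp
    qed
  qed
  then have cardA: "card A = Suc t ^ N" by (simp add: A_def card_image card_PiE)
  have finA: "finite A" by (simp add: A_def finite_PiE)
  let ?B = "(\<lambda>u. single u (1::'k)) ` deg_le (d * (N * t))"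
  have finB: "finite (deg_le (d * (N * t)))" unfolding deg_le_def by (rule finite_expvecs_le(1)[OF finite_V])
  have span: "xpow \<alpha> \<in> pv.span ?B" if "\<alpha> \<in> A" for \<alpha>
  proof -
    from that obtain h where h: "\<alpha> = g h" "h \<in> {..<N} \<rightarrow>\<^sub>E {..t}" by (auto simp: A_def)
    have "xpow \<alpha> \<in> polys_on (deg_le (\<Sum>i<N. d * lookup \<alpha> i))"
      unfolding xpow_def by (intro polys_deg_le_prod polys_deg_le_power d) auto
    moreover have "(\<Sum>i<N. d * lookup \<alpha> i) \<le> (\<Sum>i<N. d * t)"
      using h by (intro sum_mono mult_le_mono2) (auto simp: lookup_g)
    then have "deg_le (\<Sum>i<N. d * lookup \<alpha> i) \<subseteq> deg_le (d * (N * t))" by (auto simp: deg_le_def ac_simps)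
    ultimately show ?thesis using polys_on_mono polys_on_span by blast
  qed
  have "card ?B \<le> card (deg_le (d * (N * t)))" using finB by (rule card_image_le)
  also have "\<dots> \<le> Suc (d * (N * t)) ^ ?n" unfolding deg_le_def by (rule finite_expvecs_le(2)[OF finite_V])
  also have "\<dots> \<le> (D * Suc t) ^ ?n" by (intro power_mono) (auto simp: D_def algebra_simps)
  also have "\<dots> = t * Suc t ^ ?n" by (simp only: t_def power_mult_distrib)
  also have "\<dots> < Suc t ^ Suc ?n" by simp
  also have "\<dots> \<le> Suc t ^ N" by (rule power_increasing[OF N]) simp
  finally have "card ?B < card A" by (simp add: cardA)
  moreover have "finite ?B" using finB by simp
  ultimately obtain c where c: "\<exists>\<alpha>\<in>A. c \<alpha> \<noteq> 0" "(\<Sum>\<alpha>\<in>A. poly_scale (c \<alpha>) (xpow \<alpha>)) = 0"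
    using pv.exists_relation[OF finA, of ?B xpow] span by blast
  define A' where "A' = {\<alpha> \<in> A. c \<alpha> \<noteq> 0}"
  have "(\<Sum>\<alpha>\<in>A'. poly_scale (c \<alpha>) (xpow \<alpha>)) = (\<Sum>\<alpha>\<in>A. poly_scale (c \<alpha>) (xpow \<alpha>))"
    by (rule sum.mono_neutral_left) (use finA in \<open>auto simp: A'_def\<close>)
  moreover have "(\<Sum>\<alpha>\<in>A'. poly_scale (c \<alpha>) (xpow \<alpha>)) \<notin> Q 0"
    by (rule combination_notin) (use c(1) finA g_exp in \<open>auto simp: A'_def A_def atLeast0LessThan\<close>)
  ultimately show False using c(2) Q[of 0] by (simp add: prime_in_R_def)
qed

end

text \<open>A strict inclusion of primes survives contraction because a fraction and its numerator
  differ by a unit; the numerators chosen outside the smaller primes serve as the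
  \<open>x i\<close>.\<close>

theorem krull_dim_L: "krull_dim L = enat (card V)"
  unfolding krull_dim_def
proof (rule chain_height_eqI[OF prime_chain_exists])
  fix C :: "nat \<Rightarrow> _" and k
  assume "\<And>i. i \<le> k \<Longrightarrow> C i \<in> {P. primeideal P L}" and strict: "\<And>i. i < k \<Longrightarrow> C i \<subset> C (Suc i)"
  then have prime: "primeideal (C i) L" if "i \<le> k" for i using that by blast
  define Q where "Q i = {p \<in> carrier R. frac p 1 \<in> C i}" for i
  have "\<exists>p. p \<in> Q (Suc i) \<and> p \<notin> Q i" if i: "i < k" for i
  proof -
    interpret P: primeideal "C i" L using prime[of i] i by simp
    interpret P': primeideal "C (Suc i)" L using prime[of "Suc i"] i by simp
    from strict[OF i] obtain c where c: "c \<in> C (Suc i)" "c \<notin> C i" by blast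
    then have "c \<in> carrier L" by (metis P'.Icarr)
    then obtain p s where p: "p \<in> carrier R" "s \<in> den" "c = frac p s" by (rule L_carrierE)
    have "frac s 1 \<otimes>\<^bsub>L\<^esub> c = frac p 1" "frac 1 s \<otimes>\<^bsub>L\<^esub> frac p 1 = c"
      using p by (simp_all add: frac_mult frac_closed frac_eq_iff mult.commute)
    moreover have "frac s 1 \<otimes>\<^bsub>L\<^esub> c \<in> C (Suc i)" using c(1) p by (intro P'.I_l_closed) (auto simp: den_carrier den_one)
    moreover have "frac 1 s \<in> carrier L" using p by (simp add: R_closed)
    ultimately have "p \<in> Q (Suc i)" "p \<notin> Q i" using c(2) P.I_l_closed[of "frac p 1" "frac 1 s"] p(1) by (auto simp: Q_def)
    then show ?thesis by blast
  qed
  then obtain x where x: "\<And>i. i < k \<Longrightarrow> x i \<in> Q (Suc i)" "\<And>i. i < k \<Longrightarrow> x i \<notin> Q i" by metis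
  show "k \<le> card V"
  proof (rule prime_chain_length[of k Q x])
    show "prime_in_R (Q i)" if "i \<le> k" for i unfolding Q_def by (rule prime_in_R_contraction[OF prime[OF that]])
    show "Q i \<subseteq> Q (Suc i)" if "i < k" for i using strict[OF that] by (auto simp: Q_def)
  qed (use x in auto)
qed

end

section \<open>Edge ideals\<close>

definition edge_vec :: "'v set \<Rightarrow> ('v \<Rightarrow>\<^sub>0 nat)"
  where "edge_vec e = (\<Sum>v\<in>e. single v 1)"

lemma prod_Var: "(\<Prod>v\<in>e. Var v) = (single (edge_vec e) 1 :: ('v, 'k::field) mpoly)"
  unfolding edge_vec_def by (induction e rule: infinite_finite_induct) (auto simp: Var_def mult_single)

lemma edge_vec_in_expvecs: "e \<subseteq> V \<Longrightarrow> edge_vec e \<in> expvecs V"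
  unfolding edge_vec_def by (intro sum_in_expvecs) auto

lemma mdeg_edge_vec: "mdeg (edge_vec e) = card e"
  by (simp add: edge_vec_def mdeg_sum)

text \<open>The exponent form of multiplying a power of the ideal by the ideal, for the recursion of
  \<open>ideal_power\<close>.\<close>

lemma (in monomial_gens) Pw_plus: "{u + u' | u u'. u \<in> Pw t \<and> u' \<in> Pw 1} = Pw (Suc t)"
proof (intro equalityI subsetI)
  fix z assume "z \<in> {u + u' | u u'. u \<in> Pw t \<and> u' \<in> Pw 1}"
  then obtain u u' where u: "u \<in> Pw t" "u' \<in> Pw 1" "z = u + u'" by blast
  from u(2) obtain w a where "w \<in> expvecs V" "a \<in> expvecs {..<q}" "mdeg a = 1" "u' = w + esum a" by (rule PwE)
  with u have *: "u \<in> Pw t" "w \<in> expvecs V" "a \<in> expvecs {..<q}" "mdeg a = 1" "z = u + (w + esum a)"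
    by simp_all
  from Pw_add[OF Pw_add_esum[OF *(1,3)] *(2)] show "z \<in> Pw (Suc t)" using *(4,5) by (simp add: ac_simps)
next
  fix z assume "z \<in> Pw (Suc t)"
  then obtain w a where wa: "w \<in> expvecs V" "a \<in> expvecs {..<q}" "mdeg a = Suc t" "z = w + esum a" by (rule PwE)
  then obtain i b where ib: "i < q" "b \<in> expvecs {..<q}" "mdeg b = t" "a = b + single i 1"
    by (auto elim: expvecs_Suc_decomp)
  have "z = (w + esum b) + (0 + esum (single i 1))" by (simp add: wa(4) ib(4) esum_add add.assoc)
  moreover have "w + esum b \<in> Pw t" using PwI[OF wa(1) ib(2)] ib(3) by simp
  moreover have "0 + esum (single i 1) \<in> Pw 1" using PwI[of 0 "single i 1"] ib(1) by simp
  ultimately show "z \<in> {u + u' | u u'. u \<in> Pw t \<and> u' \<in> Pw 1}" by blast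
qed

lemma (in monomial_gens) Pw_1: "Pw 1 = {w + u | w u. w \<in> expvecs V \<and> u \<in> es ` {..<q}}"
proof (intro equalityI subsetI)
  fix z assume "z \<in> Pw 1"
  then obtain w a where wa: "w \<in> expvecs V" "a \<in> expvecs {..<q}" "mdeg a = Suc 0" "z = w + esum a" by (auto elim: PwE)
  then obtain i b where "i < q" "b \<in> expvecs {..<q}" "mdeg b = 0" "a = b + single i 1"
    by (auto elim: expvecs_Suc_decomp)
  then have "z = w + es i" using wa(4) by (simp add: esum_single flip: One_nat_def)
  then show "z \<in> {w + u | w u. w \<in> expvecs V \<and> u \<in> es ` {..<q}}" using wa(1) \<open>i < q\<close> by blast
next
  fix z assume "z \<in> {w + u | w u. w \<in> expvecs V \<and> u \<in> es ` {..<q}}"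
  then obtain w i where "w \<in> expvecs V" "i < q" "z = w + es i" by auto
  then show "z \<in> Pw 1" using PwI[of w "single i 1"] by (simp add: esum_single flip: One_nat_def)
qed

text \<open>Passes from algebra to counting: the lengths become \<open>card (jset t)\<close> and the
  dimension becomes the number of nodes, so the coefficient field no longer appears in the
  value.\<close>

lemma j_multiplicity_eq_jmult:
  fixes G :: "'v hypergraph"
  assumes "is_hypergraph G" "m \<ge> 1" "uniform m G"
    and f: "bij_betw f {..<q} (edges G)"
  shows "monomial_gens (nodes G) (\<lambda>i. edge_vec (f i)) q m"
    and "j_multiplicity (edge_ring TYPE('k::field) G) (edge_ideal TYPE('k) G) =
      monomial_gens.jmult (nodes G) (\<lambda>i. edge_vec (f i)) q"
proof -
  let ?V = "nodes G" and ?es = "\<lambda>i. edge_vec (f i)"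
  have edge: "f i \<subseteq> ?V" "card (f i) = m" if "i < q" for i
  proof -
    have "f i \<in> edges G" using bij_betwE[OF f] that by blast
    then show "f i \<subseteq> ?V" "card (f i) = m" using assms(1,3) by (simp_all add: is_hypergraph_def uniform_def)
  qed
  show gens: "monomial_gens ?V ?es q m"
    using assms(1,2) by unfold_locales (auto simp: is_hypergraph_def edge edge_vec_in_expvecs mdeg_edge_vec)
  interpret G: monomial_gens ?V ?es q m by (rule gens)
  interpret P: local_mpoly ?V "TYPE('k)" by unfold_locales (rule G.finite_V)
  have ring: "edge_ring TYPE('k) G = P.L"
    by (simp add: edge_ring_def localization_at_def P.L_def P.den_def)
  have "(\<lambda>e. P.frac (\<Prod>v\<in>e. Var v) 1) ` edges G = (\<lambda>u. P.frac (single u 1) 1) ` ?es ` {..<q}"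
    by (simp only: bij_betw_imp_surj_on[OF f, symmetric] image_image prod_Var)
  then have "edge_ideal TYPE('k) G = Idl\<^bsub>P.L\<^esub> ((\<lambda>u. P.frac (single u 1) 1) ` ?es ` {..<q})"
    unfolding edge_ideal_def ring P.den_def[symmetric] by (simp only:)
  also have "\<dots> = P.Loc (G.Pw 1)"
    unfolding G.Pw_1 by (rule P.genideal_monomials) (auto intro: G.es_expvecs)
  finally have ideal: "edge_ideal TYPE('k) G = P.Loc (G.Pw 1)" .
  have power: "ideal_power P.L (P.Loc (G.Pw 1)) t = P.Loc (G.Pw t)" for t
  proof (induction t)
    case 0
    show ?case by (simp add: P.ideal_power_0 G.Pw_0 P.Loc_expvecs)
  next
    case (Suc t)
    then show ?case
      by (simp only: P.ideal_power_Suc P.Loc_prod[OF G.upset_Pw G.upset_Pw] G.Pw_plus)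
  qed
  have length: "module_length P.L (local_cohomology_0 P.L (max_ideal P.L)
      (quot_module (ideal_module P.L (P.Loc (G.Pw t))) (P.Loc (G.Pw (Suc t))))) = enat (card (G.jset t))" for t
  proof -
    have "P.sat_exps (G.Pw t) (G.Pw (Suc t)) = G.sat t"
      by (simp add: P.sat_exps_def[OF G.upset_Pw G.upset_Pw G.Pw_Suc_subset] G.sat_def)
    then show ?thesis
      using P.module_length_local_coh[OF G.upset_Pw G.upset_Pw G.Pw_Suc_subset, of t] G.finite_jset[of t]
      by (simp add: P.local_coh_def[OF G.upset_Pw G.upset_Pw G.Pw_Suc_subset] G.jset_def)
  qed
  \<comment> \<open>Actual convergence makes \<open>lim\<close> meaningful here; the factorial in
    the definition then cancels the denominator.\<close>
  have "lim (\<lambda>t. real (card (G.jset t)) / real t ^ (card ?V - 1)) = G.jmult / fact (card ?V - 1)"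
    by (rule limI[OF G.card_jset_tendsto])
  then show "j_multiplicity (edge_ring TYPE('k) G) (edge_ideal TYPE('k) G) = G.jmult"
    unfolding j_multiplicity_def ring ideal power length P.krull_dim_L by (simp add: Let_def)
qed

theorem theorem9p2:
  fixes G H :: "'v hypergraph" and m :: nat
  assumes "is_hypergraph G"
    and "m \<ge> 1"
    and "uniform m G"
    and "j_multiplicity (edge_ring TYPE('k::field) G) (edge_ideal TYPE('k) G) \<noteq> 0"
    and "subhypergraph H G"
  shows "j_multiplicity (edge_ring TYPE('k) H) (edge_ideal TYPE('k) H)
    \<le> j_multiplicity (edge_ring TYPE('k) G) (edge_ideal TYPE('k) G)"
proof -
  have H: "is_hypergraph H" "nodes H \<subseteq> nodes G" "edges H \<subseteq> edges G" "uniform m H"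
    using assms(3,5) by (auto simp: subhypergraph_def uniform_def)
  have "edges G \<subseteq> Pow (nodes G)" "finite (nodes G)" using assms(1) by (auto simp: is_hypergraph_def)
  then have "finite (edges G)" by (simp add: finite_subset)
  then obtain f q f' q' where f: "bij_betw f {..<q::nat} (edges G)" and f': "bij_betw f' {..<q'::nat} (edges H)"
    using ex_bij_betw_nat_finite finite_subset[OF H(3)] by (metis atLeast0LessThan)
  have sub: "\<exists>j<q. edge_vec (f' i) = edge_vec (f j)" if "i < q'" for i
  proof -
    have "f' i \<in> f ` {..<q}" using f f' that H(3) by (auto simp: bij_betw_def)
    then show ?thesis by auto
  qed
  show ?thesis
    using jmult_mono[OF j_multiplicity_eq_jmult(1)[OF assms(1-3) f] j_multiplicity_eq_jmult(1)[OF H(1) assms(2) H(4) f'] H(2) sub]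
      assms(4)
    unfolding j_multiplicity_eq_jmult(2)[OF assms(1-3) f] j_multiplicity_eq_jmult(2)[OF H(1) assms(2) H(4) f'] by blast
qed

end
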